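(* Let $\phi,\psi:\mathbb{R}\times\mathbb{R}^k\to\mathbb{R}^k$ be continuously differentiable and $T$-periodic in $t$, and consider, for $\varepsilon>0$, the system $$\dot x=\varepsilon\phi(t,x)+\psi(t,x). \qquad (1)$$ Let $U\subset\mathbb{R}^k$ be open and bounded. Assume: (A0) $\Omega(T,0,\xi)=\xi$ for all $\xi\in\partial U$; (A1) $\eta(T,s,\xi)-\eta(0,s,\xi)\neq 0$ for all $s\in[0,T]$ and $\xi\in\partial U$; (A2) $\gamma(\eta(T,0,\cdot),U)\neq 0$. Then there exists $\varepsilon_0>0$ such that for every $\varepsilon\in(0,\varepsilon_0)$ system (1) has at least one $T$-periodic solution $x$ belonging to the set $X=\{x:\ \Omega(0,t,x(t))\in U \text{ for all } t\in[0,T]\}$.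
   Context: Standing assumption: solutions of the unperturbed system $\dot x=\psi(t,x)$ exist for all times. $\Omega(\cdot,t_0,\xi)$ denotes the solution of $\dot x=\psi(t,x)$ (i.e. system (1) with $\varepsilon=0$) satisfying $x(t_0)=\xi$. For $\xi\in\mathbb{R}^k$ consider the linear inhomogeneous system $$\dot y=\phi(t,\Omega(t,0,\xi))+\psi'_{x}(t,\Omega(t,0,\xi))\,y, \qquad (2)$$ where $\psi'_x$ is the Jacobian matrix of $\psi$ with respect to its second (spatial) variable. $\eta(\cdot,s,\xi)$ denotes the solution $y$ of (2) satisfying $y(s)=0$. For a continuous map $F:\bar U\to\mathbb{R}^k$ on the closure of a bounded open set $U$ with $F(\xi)\neq0$ on $\partial U$, $\gamma(F,U)$ denotes the rotation number (Brouwer degree $\deg(F,U,0)$) of the vector field $F$ on $\partial U$. *)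

theory Defs
  imports "HOL-Analysis.Analysis"
begin

definition C1_map :: "('a::real_normed_vector \<Rightarrow> 'b::real_normed_vector) \<Rightarrow> bool" where
  "C1_map f \<longleftrightarrow> (\<exists>f'. (\<forall>z. (f has_derivative blinfun_apply (f' z)) (at z)) \<and> continuous_on UNIV f')"

definition jac_det :: "(real^'k \<Rightarrow> real^'k) \<Rightarrow> real^'k \<Rightarrow> real" where
  "jac_det g x = det (matrix (frechet_derivative g (at x)))"

definition regular_degree_sum :: "(real^'k \<Rightarrow> real^'k) \<Rightarrow> (real^'k) set \<Rightarrow> int" where
  "regular_degree_sum g U = (\<Sum>x\<in>{x\<in>U. g x = 0}. if jac_det g x > 0 then 1 else -1)"

text \<open>Brouwer degree deg(F,U,0) (rotation number of F on the boundary of U), defined in the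
  standard analytic way: it is the common value of the regular signed zero count of every
  C1 map g, having 0 as a regular value in U, which is uniformly close enough to F on the
  closure of U.\<close>
definition brouwer_degree :: "(real^'k \<Rightarrow> real^'k) \<Rightarrow> (real^'k) set \<Rightarrow> int" where
  "brouwer_degree F U = (THE d. \<exists>\<delta>>0. \<forall>g. C1_map g
       \<and> (\<forall>x\<in>U. g x = 0 \<longrightarrow> jac_det g x \<noteq> 0)
       \<and> (\<forall>x\<in>closure U. norm (F x - g x) < \<delta>)
       \<longrightarrow> regular_degree_sum g U = d)"

end

theory Submission
  imports Defs
begin

text \<open>
  Let \<open>x\<close> be the solution of the perturbed system with \<open>x 0 = \<xi>\<close>. Since \<open>\<eta>\<close> is the derivative with respect to
  \<open>\<epsilon>\<close>, (A0) gives \<open>(x T - \<xi>) / \<epsilon> = \<eta> T 0 \<xi> + o(1)\<close> uniformly on the boundary of \<open>U\<close>, where (A1) with \<open>s = 0\<close>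
  keeps \<open>\<eta> T 0\<close> away from zero. Hence, if \<open>\<xi> \<mapsto> (x T - \<xi>) / \<epsilon>\<close> had no zero in \<open>U\<close>, the degree in (A2) would
  vanish; so there is a \<open>T\<close>-periodic solution with \<open>x 0 \<in> U\<close>. Put \<open>u t = \<Omega> 0 t (x t)\<close>. If \<open>u s = \<xi>\<close> were on the boundary,
  the same expansion around \<open>\<Omega> t 0 \<xi>\<close> started at time \<open>s\<close> would give
  \<open>0 = x T - x 0 = \<epsilon> (\<eta> T s \<xi> - \<eta> 0 s \<xi>) + o(\<epsilon>)\<close>, contradicting (A1). So \<open>u\<close> is a continuous curve that starts
  in \<open>U\<close> and never meets its boundary.

  Of degree theory only one fact is needed: a field that is close on the boundary to a nonvanishing
  field has degree zero. Signed zero counts are written as integrals of Jacobian determinants, which do not change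
  under compactly supported perturbations.
\<close>

section \<open>Continuously differentiable maps\<close>

text \<open>The invariance of integrals of Jacobian determinants is classically a divergence
  identity for cofactors, which uses second derivatives. The maps here are only C1, so the
  invariance is taken from volumes: adding a large multiple of the identity makes both maps
  injective with the same image, and polynomial dependence on the multiple carries the equality back
  to 0.

  The degree is a definite description. Hence 0 must be shown to be an admissible value and also the
  only one; the latter requires some regular C1 approximation to exist, which is where Sard's lemma
  enters. The zero-free comparison field, the scaled displacement of the perturbed flow, is only
  known to be continuous, so a polynomial replaces it before it is joined to a regular map.

  The expansion in \<epsilon> must be uniform in the starting time s and in \<xi>. All constants
  therefore come from one ball of radius \<open>R + 1\<close> around the unperturbed orbits, and
  Gronwall's inequality is used in both time directions, since s may lie anywhere in [0,T]. Joint
  continuity of \<eta> in s and \<xi> turns the pointwise condition (A1) into a positive lower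
  bound.\<close>

lemma C1_mapI:
  fixes f :: "'a::euclidean_space \<Rightarrow> 'b::real_normed_vector"
  assumes der: "\<And>z. (f has_derivative f' z) (at z)"
    and cont: "\<And>v. continuous_on UNIV (\<lambda>z. f' z v)"
  shows "C1_map f"
proof -
  have bl: "bounded_linear (f' z)" for z
    using der has_derivative_bounded_linear by blast
  \<comment> \<open>In finite dimension, continuity of the derivative in each direction v already
    gives continuity in the operator norm.\<close>
  have "continuous_on UNIV (\<lambda>z. Blinfun (f' z))"
    by (rule continuous_on_blinfun_componentwise) (simp add: bounded_linear_Blinfun_apply bl cont)
  then show ?thesis
    unfolding C1_map_def using der
    by (intro exI[of _ "\<lambda>z. Blinfun (f' z)"]) (simp add: bounded_linear_Blinfun_apply bl)
qed

lemma C1_map_has_derivative: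
  "C1_map f \<Longrightarrow> (f has_derivative frechet_derivative f (at z)) (at z)"
  unfolding C1_map_def by (metis frechet_derivative_works differentiableI)

lemma C1_map_continuous_derivative:
  assumes "C1_map f"
  shows "continuous_on S (\<lambda>z. frechet_derivative f (at z) v)"
proof -
  obtain f' where f': "\<And>z. (f has_derivative blinfun_apply (f' z)) (at z)" "continuous_on UNIV f'"
    using assms unfolding C1_map_def by blast
  have "frechet_derivative f (at z) = blinfun_apply (f' z)" for z
    using frechet_derivative_at[OF f'(1)] by simp
  moreover have "continuous_on S (\<lambda>z. blinfun_apply (f' z) v)"
    using f'(2) by (intro continuous_intros) (rule continuous_on_subset, auto)
  ultimately show ?thesis by simp
qed

lemma C1_map_continuous: "C1_map f \<Longrightarrow> continuous_on S f"
  by (meson C1_map_has_derivative continuous_at_imp_continuous_on has_derivative_continuous)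

lemma C1_map_bounded_linear:
  fixes f :: "'a::euclidean_space \<Rightarrow> 'b::real_normed_vector"
  shows "bounded_linear f \<Longrightarrow> C1_map f"
  by (rule C1_mapI[where f' = "\<lambda>_. f"]) (auto intro: bounded_linear_imp_has_derivative)

lemma C1_map_const:
  fixes c :: "'b::real_normed_vector"
  shows "C1_map (\<lambda>_::'a::euclidean_space. c)"
  by (rule C1_mapI[where f' = "\<lambda>_ _. 0"]) (auto intro: derivative_eq_intros)

lemma C1_map_add:
  fixes f g :: "'a::euclidean_space \<Rightarrow> 'b::real_normed_vector"
  assumes "C1_map f" "C1_map g"
  shows "C1_map (\<lambda>x. f x + g x)"
  by (rule C1_mapI) (auto intro!: derivative_intros C1_map_has_derivative assms
      continuous_on_add C1_map_continuous_derivative)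

lemma C1_map_diff:
  fixes f g :: "'a::euclidean_space \<Rightarrow> 'b::real_normed_vector"
  assumes "C1_map f" "C1_map g"
  shows "C1_map (\<lambda>x. f x - g x)"
  by (rule C1_mapI) (auto intro!: derivative_intros C1_map_has_derivative assms
      continuous_on_diff C1_map_continuous_derivative)

lemma C1_map_scaleR:
  fixes f :: "'a::euclidean_space \<Rightarrow> real" and g :: "'a \<Rightarrow> 'b::real_normed_vector"
  assumes "C1_map f" "C1_map g"
  shows "C1_map (\<lambda>x. f x *\<^sub>R g x)"
  by (rule C1_mapI[OF has_derivative_scaleR[OF C1_map_has_derivative[OF assms(1)]
          C1_map_has_derivative[OF assms(2)]]])
    (intro continuous_on_add continuous_on_scaleR C1_map_continuous C1_map_continuous_derivative assms)

lemma C1_map_mult: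
  fixes f g :: "'a::euclidean_space \<Rightarrow> real"
  shows "C1_map f \<Longrightarrow> C1_map g \<Longrightarrow> C1_map (\<lambda>x. f x * g x)"
  using C1_map_scaleR[of f g] by simp

lemma C1_map_prod:
  fixes f :: "'i \<Rightarrow> 'a::euclidean_space \<Rightarrow> real"
  assumes "finite I" "\<And>i. i \<in> I \<Longrightarrow> C1_map (f i)"
  shows "C1_map (\<lambda>x. \<Prod>i\<in>I. f i x)"
  using assms by (induction rule: finite_induct) (auto intro: C1_map_const C1_map_mult)

lemma C1_map_sum:
  fixes f :: "'i \<Rightarrow> 'a::euclidean_space \<Rightarrow> 'b::real_normed_vector"
  assumes "finite I" "\<And>i. i \<in> I \<Longrightarrow> C1_map (f i)"
  shows "C1_map (\<lambda>x. \<Sum>i\<in>I. f i x)"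
  using assms by (induction rule: finite_induct) (auto intro: C1_map_const C1_map_add)

lemma C1_map_compose:
  fixes f :: "'a::euclidean_space \<Rightarrow> 'b::euclidean_space" and g :: "'b \<Rightarrow> 'c::real_normed_vector"
  assumes "C1_map f" "C1_map g"
  shows "C1_map (\<lambda>x. g (f x))"
proof -
  obtain f' where f': "\<And>z. (f has_derivative blinfun_apply (f' z)) (at z)" "continuous_on UNIV f'"
    using assms unfolding C1_map_def by blast
  obtain g' where g': "\<And>z. (g has_derivative blinfun_apply (g' z)) (at z)" "continuous_on UNIV g'"
    using assms unfolding C1_map_def by blast
  show ?thesis
  proof (rule C1_mapI)
    show "((\<lambda>x. g (f x)) has_derivative (\<lambda>v. g' (f z) (f' z v))) (at z)" for z
      using has_derivative_compose[OF f'(1) g'(1)] by blast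
    show "continuous_on UNIV (\<lambda>z. blinfun_apply (g' (f z)) (blinfun_apply (f' z) v))" for v
      by (intro continuous_intros continuous_on_compose2[OF g'(2)] f'(2) C1_map_continuous assms) auto
  qed
qed

lemma C1_map_polynomial_function:
  fixes p :: "'a::euclidean_space \<Rightarrow> 'b::euclidean_space"
  assumes "polynomial_function p"
  shows "C1_map p"
proof -
  have real: "C1_map q" if "real_polynomial_function q" for q :: "'a \<Rightarrow> real"
    using that by (induction rule: real_polynomial_function.induct)
      (auto intro: C1_map_bounded_linear C1_map_const C1_map_add C1_map_mult)
  have "C1_map (\<lambda>x. \<Sum>b\<in>Basis. (p x \<bullet> b) *\<^sub>R b)"
    using assms unfolding polynomial_function_iff_Basis_inner
    by (intro C1_map_sum C1_map_scaleR C1_map_const real) auto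
  then show ?thesis by (simp add: euclidean_representation)
qed

lemma C1_map_lipschitz_on_cball:
  fixes f :: "'a::euclidean_space \<Rightarrow> 'b::real_normed_vector"
  assumes "C1_map f"
  obtains L where "L \<ge> 0"
    "\<And>x y. x \<in> cball c r \<Longrightarrow> y \<in> cball c r \<Longrightarrow> norm (f x - f y) \<le> L * norm (x - y)"
proof -
  obtain f' where f': "\<And>z. (f has_derivative blinfun_apply (f' z)) (at z)" "continuous_on UNIV f'"
    using assms unfolding C1_map_def by blast
  have "compact (f' ` cball c r)"
    using f'(2) by (intro compact_continuous_image compact_cball) (rule continuous_on_subset, auto)
  then obtain L where L: "L > 0" "\<And>z. z \<in> cball c r \<Longrightarrow> norm (f' z) \<le> L"
    using compact_imp_bounded bounded_pos by (metis image_eqI)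
  show thesis
  proof
    show "norm (f x - f y) \<le> L * norm (x - y)" if "x \<in> cball c r" "y \<in> cball c r" for x y
      by (rule differentiable_bound[OF convex_cball _ _ that])
        (use f'(1) L in \<open>auto intro: has_derivative_at_withinI simp flip: norm_blinfun.rep_eq\<close>)
  qed (use L in simp)
qed

section \<open>Piecewise quadratic steps and C1 bump functions\<close>

lemma has_real_derivative_max_square:
  "((\<lambda>t. (max 0 t)\<^sup>2) has_real_derivative 2 * max 0 t) (at (t::real))"
proof -
  consider "t > 0" | "t < 0" | "t = 0" by linarith
  then show ?thesis
  proof cases
    case 1
    have "((\<lambda>t. t\<^sup>2) has_real_derivative 2 * max 0 t) (at t)"
      using 1 by (auto intro!: derivative_eq_intros)
    then show ?thesis
      by (rule has_field_derivative_transform_within_open[where S = "{0<..}"]) (use 1 in auto)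
  next
    case 2
    have "((\<lambda>t. 0) has_real_derivative 2 * max 0 t) (at t)"
      using 2 by (auto intro!: derivative_eq_intros)
    then show ?thesis
      by (rule has_field_derivative_transform_within_open[where S = "{..<0}"]) (use 2 in auto)
  next
    case 3
    have "((\<lambda>h. (max 0 h)\<^sup>2 / h) \<longlongrightarrow> 0) (at (0::real))"
    proof (rule Lim_null_comparison)
      show "\<forall>\<^sub>F h in at 0. norm ((max 0 h)\<^sup>2 / h) \<le> \<bar>h :: real\<bar>"
        by (auto intro!: always_eventually simp: power2_eq_square max_def)
      show "((\<lambda>h. \<bar>h\<bar>) \<longlongrightarrow> 0) (at (0::real))"
        by (auto intro!: tendsto_eq_intros)
    qed
    with 3 show ?thesis
      by (simp add: DERIV_def)
  qed
qed

text \<open>Half the second difference, with increment r, of the C1 function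
  \<open>(max 0 t)\<^sup>2\<close>. For r > 0 it is 0 left of -r and \<open>r\<^sup>2\<close> right
  of r, and its derivative is the tent \<open>hat r\<close> carried by [-r,r].\<close>

definition soft_step :: "real \<Rightarrow> real \<Rightarrow> real" where
  "soft_step r t = ((max 0 (t + r))\<^sup>2 - 2 * (max 0 t)\<^sup>2 + (max 0 (t - r))\<^sup>2) / 2"

definition hat :: "real \<Rightarrow> real \<Rightarrow> real" where
  "hat r t = max 0 (t + r) - 2 * max 0 t + max 0 (t - r)"

lemma has_real_derivative_soft_step:
  "(soft_step r has_real_derivative hat r t) (at t within S)"
proof -
  have "(soft_step r has_real_derivative hat r t) (at t)"
    unfolding soft_step_def[abs_def] hat_def
  proof -
    have shift: "((\<lambda>t. (max 0 (t + c))\<^sup>2) has_real_derivative 2 * max 0 (t + c)) (at t)" for c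
      by (rule DERIV_shift[THEN iffD1]) (rule has_real_derivative_max_square)
    show "((\<lambda>t. ((max 0 (t + r))\<^sup>2 - 2 * (max 0 t)\<^sup>2 + (max 0 (t - r))\<^sup>2) / 2) has_real_derivative
        max 0 (t + r) - 2 * max 0 t + max 0 (t - r)) (at t)"
      by (rule DERIV_cdivide[OF DERIV_add[OF DERIV_diff[OF shift[of r] DERIV_cmult[OF
                has_real_derivative_max_square, of 2]] shift[of "- r"]], of 2, simplified,
            THEN DERIV_cong]) (simp add: field_simps)
  qed
  then show ?thesis by (rule has_field_derivative_at_within)
qed

lemma continuous_on_hat: "continuous_on S (hat r)"
  unfolding hat_def[abs_def] by (intro continuous_intros)

lemma hat_nonneg: "r > 0 \<Longrightarrow> hat r t \<ge> 0"
  by (auto simp: hat_def max_def)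

lemma hat_eq_0: "r > 0 \<Longrightarrow> \<bar>t\<bar> \<ge> r \<Longrightarrow> hat r t = 0"
  by (auto simp: hat_def max_def)

lemma hat_0: "r > 0 \<Longrightarrow> hat r 0 = r"
  by (auto simp: hat_def max_def)

lemma C1_map_soft_step: "C1_map (soft_step r)"
  by (rule C1_mapI[where f' = "\<lambda>t h. hat r t * h"])
    (use has_real_derivative_soft_step[where S = UNIV] in \<open>auto simp: has_field_derivative_def
      intro!: continuous_intros continuous_on_hat\<close>)

lemma soft_step_eq_0: "r > 0 \<Longrightarrow> t \<le> - r \<Longrightarrow> soft_step r t = 0"
  by (auto simp: soft_step_def)

lemma soft_step_eq_1: "t \<ge> 1 \<Longrightarrow> soft_step 1 t = 1"
  by (auto simp: soft_step_def max_def power2_eq_square algebra_simps)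

lemma soft_step_bounds: "0 \<le> soft_step 1 t" "soft_step 1 t \<le> 1"
proof -
  have mono: "soft_step 1 a \<le> soft_step 1 b" if "a \<le> b" for a b
    using DERIV_nonneg_imp_nondecreasing[OF that, of "soft_step 1"]
      has_real_derivative_soft_step[where S = UNIV] hat_nonneg[of 1] by force
  show "0 \<le> soft_step 1 t"
    \<comment> \<open>By monotonicity it suffices to compare with a point at or below -1, where the
      step is 0; the upper bound uses a point at or above 1.\<close>
    using mono[of "min t (-1)" t] soft_step_eq_0[of 1 "min t (-1)"] by simp
  show "soft_step 1 t \<le> 1"
    using mono[of t "max t 1"] soft_step_eq_1[of "max t 1"] by simp
qed

lemma C1_map_bump:
  fixes Z :: "'a::euclidean_space set"
  assumes Z: "compact Z" and U: "open U" "Z \<subseteq> U"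
  obtains l K where "C1_map l" "\<And>x. 0 \<le> l x \<and> l x \<le> (1::real)" "\<And>x. x \<in> Z \<Longrightarrow> l x = 1"
    "compact K" "K \<subseteq> U" "\<And>x. x \<notin> K \<Longrightarrow> l x = 0"
proof -
  \<comment> \<open>The argument of the step is at least 1 within distance r of c, and at most -1
    once the squared distance reaches twice \<open>r\<^sup>2\<close>. So b is 1 on the r-ball and 0
    outside the 2r-ball.\<close>
  define b where "b c r x = soft_step 1 (3 - 2 * ((x - c) \<bullet> (x - c)) / r\<^sup>2)" for c :: 'a and r x
  have C1_b: "C1_map (b c r)" for c r
  proof -
    have 1: "C1_map (\<lambda>x::'a. (x - c) \<bullet> (x - c))"
    proof (rule C1_mapI)
      fix x :: 'a
      have "((\<lambda>x. x - c) has_derivative (\<lambda>h. h)) (at x)"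
        by (auto intro!: derivative_eq_intros)
      then show "((\<lambda>x. (x - c) \<bullet> (x - c)) has_derivative (\<lambda>h. (x - c) \<bullet> h + h \<bullet> (x - c))) (at x)"
        by (rule has_derivative_inner) fact
    qed (intro continuous_intros)
    show ?thesis unfolding b_def[abs_def]
      using C1_map_compose[OF C1_map_diff[OF C1_map_const[of 3]
            C1_map_mult[OF C1_map_const[of "2 / r\<^sup>2"] 1]] C1_map_soft_step] by simp
  qed
  have "\<exists>r>0. cball z (2 * r) \<subseteq> U" if z: "z \<in> Z" for z
  proof -
    obtain e where e: "e > 0" "cball z e \<subseteq> U"
      using open_contains_cball[THEN iffD1, OF U(1)] subsetD[OF U(2) z] by blast
    show ?thesis by (rule exI[of _ "e / 2"]) (simp add: e)
  qed
  then obtain r where r: "\<And>z. z \<in> Z \<Longrightarrow> r z > 0 \<and> cball z (2 * r z) \<subseteq> U" by metis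
  have cover: "Z \<subseteq> (\<Union>z\<in>Z. ball z (r z))"
  proof
    fix z assume "z \<in> Z"
    then show "z \<in> (\<Union>z\<in>Z. ball z (r z))" using r[of z] by (intro UN_I[of z]) auto
  qed
  obtain C where C: "C \<subseteq> Z" "finite C" "Z \<subseteq> (\<Union>z\<in>C. ball z (r z))"
    using compactE_image[OF Z _ cover] by blast
  \<comment> \<open>Unlike a sum, this combination stays in [0,1]; it is 1 as soon as one b is 1,
    and 0 where all of them vanish.\<close>
  define l where "l x = 1 - (\<Prod>c\<in>C. 1 - b c (r c) x)" for x
  have b01: "0 \<le> b c s x \<and> b c s x \<le> 1" for c s x
    by (simp add: b_def soft_step_bounds)
  show thesis
  proof
    show "C1_map l" unfolding l_def[abs_def]
      by (intro C1_map_diff C1_map_const C1_map_prod C(2) C1_b[THEN C1_map_diff[OF C1_map_const]])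
    show "0 \<le> l x \<and> l x \<le> 1" for x
      using b01 by (auto simp: l_def intro!: prod_le_1 prod_nonneg)
    show "compact (\<Union>c\<in>C. cball c (2 * r c))" using C(2) by (intro compact_UN) auto
    show "(\<Union>c\<in>C. cball c (2 * r c)) \<subseteq> U" using r C(1) by blast
    show "l x = 1" if x: "x \<in> Z" for x
    proof -
      obtain c where c: "c \<in> C" "dist c x < r c" using C(3) x by force
      then have "(x - c) \<bullet> (x - c) \<le> (r c)\<^sup>2"
        using power_mono[of "norm (x - c)" "r c" 2]
        by (simp add: dist_norm norm_minus_commute[of c x] power2_norm_eq_inner)
      moreover have "r c > 0" using c C r by auto
      ultimately have "b c (r c) x = 1"
        unfolding b_def by (intro soft_step_eq_1) (simp add: divide_simps)
      then show ?thesis using c C(2) by (auto simp: l_def intro!: prod_zero)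
    qed
    show "l x = 0" if x: "x \<notin> (\<Union>c\<in>C. cball c (2 * r c))" for x
    proof -
      have "b c (r c) x = 0" if c: "c \<in> C" for c
      proof -
        have rc: "r c > 0" using c C r by auto
        have "2 * r c \<le> dist c x" using x c by auto
        then have "(2 * r c)\<^sup>2 \<le> (x - c) \<bullet> (x - c)"
          using power_mono[of "2 * r c" "norm (x - c)" 2] rc
          by (simp add: dist_norm norm_minus_commute[of c x] power2_norm_eq_inner)
        then have "2 * (r c)\<^sup>2 \<le> (x - c) \<bullet> (x - c)"
          by (simp add: power_mult_distrib) (use zero_le_power2[of "r c"] in linarith)
        then show ?thesis
          using rc unfolding b_def by (intro soft_step_eq_0) (simp_all add: divide_simps)
      qed
      then show ?thesis by (simp add: l_def)
    qed
  qed
qed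

section \<open>Jacobian determinants of compactly supported perturbations\<close>

abbreviation jac :: "(real^'n \<Rightarrow> real^'m) \<Rightarrow> real^'n \<Rightarrow> real^'n^'m" where
  "jac g x \<equiv> matrix (frechet_derivative g (at x))"

lemma continuous_on_det: 
  fixes A :: "'a::topological_space \<Rightarrow> real^'n^'n"
  assumes "continuous_on S A"
  shows "continuous_on S (\<lambda>x. det (A x))"
  unfolding det_def by (intro continuous_intros assms)

lemma C1_map_continuous_on_jac:
  fixes g :: "real^'n \<Rightarrow> real^'m"
  shows "C1_map g \<Longrightarrow> continuous_on S (jac g)"
  unfolding matrix_def by (intro continuous_intros C1_map_continuous_derivative)

text \<open>Continuous coefficients and one degree bound for all x are what permits integration
  coefficient by coefficient. Families of this kind contain s and the continuous functions of x and
  are closed under sums and products, hence under the Leibniz formula.\<close>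

lemma det_identity_perturbation_poly:
  fixes A :: "real^'m \<Rightarrow> real^'n^'n"
  assumes A: "continuous_on K A"
  shows "\<exists>P N. (\<forall>j. continuous_on K (\<lambda>x. coeff (P x) j)) \<and> (\<forall>x. degree (P x) \<le> N) \<and>
     (\<forall>s x. det (s *\<^sub>R mat 1 + A x) = poly (P x) s)"
proof -
  define pc where "pc q \<longleftrightarrow> (\<exists>P N. (\<forall>j. continuous_on K (\<lambda>x. coeff (P x) j)) \<and>
     (\<forall>x. degree (P x) \<le> N) \<and> (\<forall>s x. q s x = poly (P x) s))" for q :: "real \<Rightarrow> real^'m \<Rightarrow> real"
  have const: "pc (\<lambda>s x. c x)" if "continuous_on K c" for c
    unfolding pc_def
  proof (intro exI conjI allI)
    show "continuous_on K (\<lambda>x. coeff [:c x:] j)" for j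
      using that by (cases j) auto
  qed auto
  have var: "pc (\<lambda>s x. s)"
    unfolding pc_def by (intro exI[of _ "\<lambda>_. [:0, 1:]"] exI[of _ 1]) auto
  have add: "pc (\<lambda>s x. q s x + r s x)" if q: "pc q" and r: "pc r" for q r
  proof -
    obtain P N where P: "\<And>j. continuous_on K (\<lambda>x. coeff (P x) j)" "\<And>x. degree (P x) \<le> N"
      "\<And>s x. q s x = poly (P x) s" using q unfolding pc_def by blast
    obtain Q M where Q: "\<And>j. continuous_on K (\<lambda>x. coeff (Q x) j)" "\<And>x. degree (Q x) \<le> M"
      "\<And>s x. r s x = poly (Q x) s" using r unfolding pc_def by blast
    have "degree (P x + Q x) \<le> max N M" for x
      using P(2)[of x] Q(2)[of x] by (intro degree_add_le) auto
    then show ?thesis unfolding pc_def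
      by (intro exI[of _ "\<lambda>x. P x + Q x"] exI[of _ "max N M"]) (auto simp: P Q intro!: continuous_intros)
  qed
  have mult: "pc (\<lambda>s x. q s x * r s x)" if q: "pc q" and r: "pc r" for q r
  proof -
    obtain P N where P: "\<And>j. continuous_on K (\<lambda>x. coeff (P x) j)" "\<And>x. degree (P x) \<le> N"
      "\<And>s x. q s x = poly (P x) s" using q unfolding pc_def by blast
    obtain Q M where Q: "\<And>j. continuous_on K (\<lambda>x. coeff (Q x) j)" "\<And>x. degree (Q x) \<le> M"
      "\<And>s x. r s x = poly (Q x) s" using r unfolding pc_def by blast
    have "degree (P x * Q x) \<le> N + M" for x
      using P(2)[of x] Q(2)[of x] degree_mult_le[of "P x" "Q x"] by linarith
    then show ?thesis unfolding pc_def
      by (intro exI[of _ "\<lambda>x. P x * Q x"] exI[of _ "N + M"])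
        (auto simp: P Q coeff_mult intro!: continuous_intros)
  qed
  have sum: "pc (\<lambda>s x. \<Sum>i\<in>I. q i s x)" if "finite I" "\<And>i. i \<in> I \<Longrightarrow> pc (q i)" for I :: "('n \<Rightarrow> 'n) set" and q
    using that by (induction rule: finite_induct) (auto intro: const add)
  have prod: "pc (\<lambda>s x. \<Prod>i\<in>I. q i s x)" if "finite I" "\<And>i. i \<in> I \<Longrightarrow> pc (q i)" for I :: "'n set" and q
    using that by (induction rule: finite_induct) (auto intro: const mult)
  have entry: "pc (\<lambda>s x. (s *\<^sub>R mat 1 + A x) $ i $ j)" for i j
    by (simp add: mat_def, intro add mult var const conjI impI continuous_intros A)
  have "pc (\<lambda>s x. det (s *\<^sub>R mat 1 + A x))"
    unfolding det_def by (intro sum prod mult const entry continuous_intros) auto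
  then show ?thesis unfolding pc_def .
qed

lemma integral_det_identity_perturbation_poly:
  fixes A :: "real^'m \<Rightarrow> real^'n^'n"
  assumes A: "continuous_on (cbox a b) A"
  shows "\<exists>p. \<forall>s. ((\<lambda>x. det (s *\<^sub>R mat 1 + A x)) has_integral poly p s) (cbox a b)"
proof -
  obtain P N where P: "\<And>j. continuous_on (cbox a b) (\<lambda>x. coeff (P x) j)" "\<And>x. degree (P x) \<le> N"
      "\<And>s x. det (s *\<^sub>R mat 1 + A x) = poly (P x) s"
    using det_identity_perturbation_poly[OF A] by metis
  \<comment> \<open>All sums run to the common bound N; coefficients beyond the actual degree at x
    are 0.\<close>
  define p where "p = (\<Sum>j\<le>N. monom (integral (cbox a b) (\<lambda>x. coeff (P x) j)) j)"
  have "((\<lambda>x. \<Sum>j\<le>N. coeff (P x) j * s ^ j) has_integral poly p s) (cbox a b)" for s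
    unfolding p_def poly_sum poly_monom
    by (intro has_integral_sum has_integral_mult_left integrable_integral integrable_continuous P) auto
  moreover have "(\<Sum>j\<le>N. coeff (P x) j * s ^ j) = det (s *\<^sub>R mat 1 + A x)" for s x
    unfolding P(3) poly_altdef
    by (rule sum.mono_neutral_right) (use P(2) in \<open>auto simp: coeff_eq_0 not_le\<close>)
  ultimately show ?thesis by auto
qed

section \<open>Maps dominated by a large multiple of the identity\<close>

lemma det_scaleR: "det (s *\<^sub>R A) = s ^ CARD('n) * det A" for A :: "real^'n^'n"
proof -
  have "s *\<^sub>R A = (\<chi> i. s *s (A $ i))"
    by (simp add: vec_eq_iff)
  then show ?thesis using det_rows_mul[of "\<lambda>_. s" "\<lambda>i. A $ i"] by simp
qed

text \<open>Serves to drop the absolute value in the change of variables formula when the multiple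
  of the identity is large.\<close>

lemma det_pos_near_identity:
  obtains d where "d > 0" "\<And>A::real^'n^'n. norm (A - mat 1) < d \<Longrightarrow> det A > 0"
proof -
  have "continuous_on UNIV (det :: real^'n^'n \<Rightarrow> real)"
    using continuous_on_det[OF continuous_on_id] by simp
  then have "open {A::real^'n^'n. det A > 0}"
    by (intro open_Collect_less) auto
  then obtain d where "d > 0" "ball (mat 1) d \<subseteq> {A::real^'n^'n. det A > 0}"
    by (metis (mono_tags, lifting) det_I mem_Collect_eq openE zero_less_one)
  then show thesis
    by (intro that[of d]) (auto simp: dist_norm norm_minus_commute subset_iff)
qed

text \<open>Solving \<open>s z + b z = s x + a x\<close> for \<open>z\<close> by contraction.\<close>
lemma image_large_multiple_subset:
  fixes a b :: "'a::euclidean_space \<Rightarrow> 'a"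
  assumes R: "S \<subseteq> cball 0 R" and KS: "K \<subseteq> S"
    and La: "\<And>x y. x \<in> cball 0 (R + 1) \<Longrightarrow> y \<in> cball 0 (R + 1) \<Longrightarrow> norm (a x - a y) \<le> L * norm (x - y)"
    and Lb: "\<And>x y. x \<in> cball 0 (R + 1) \<Longrightarrow> y \<in> cball 0 (R + 1) \<Longrightarrow> norm (b x - b y) \<le> L * norm (x - y)"
    and M: "\<And>x y. x \<in> cball 0 (R + 1) \<Longrightarrow> y \<in> cball 0 (R + 1) \<Longrightarrow> norm (a x - b y) \<le> M"
    and s: "s > L" "s \<ge> M" "s > 0" "L \<ge> 0"
    and off: "\<And>x. x \<notin> K \<Longrightarrow> a x = b x"
  shows "(\<lambda>x. s *\<^sub>R x + a x) ` S \<subseteq> (\<lambda>x. s *\<^sub>R x + b x) ` S"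
proof clarify
  fix x assume x: "x \<in> S"
  let ?B = "cball 0 (R + 1) \<inter> cball x 1"
  \<comment> \<open>A fixed point z of this map solves s z + b z = s x + a x. The unit ball around x
    lies in the ball of radius R + 1, where the bounds are available; M \<le> s keeps the map inside
    it, and L / s < 1 makes it contract.\<close>
  let ?f = "\<lambda>z. x + (1 / s) *\<^sub>R (a x - b z)"
  have xB: "x \<in> cball 0 (R + 1)" using x R by auto
  have "\<exists>!z\<in>cball x 1. ?f z = z"
  proof (rule Banach_fix)
    have sub: "cball x 1 \<subseteq> cball 0 (R + 1)"
    proof
      fix z assume "z \<in> cball x 1"
      moreover have "norm x \<le> R" using x R by auto
      ultimately show "z \<in> cball 0 (R + 1)"
        using norm_triangle_sub[of z x] by (simp add: dist_norm norm_minus_commute)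
    qed
    show "complete (cball x 1)" by (simp add: compact_imp_complete)
    show "?f ` cball x 1 \<subseteq> cball x 1"
    proof clarify
      fix z assume "z \<in> cball x 1"
      then have "norm (a x - b z) \<le> s" using M[OF xB, of z] sub s(2) by auto
      then show "?f z \<in> cball x 1" using s(3) by (simp add: dist_norm divide_le_eq)
    qed
    show "dist (?f y) (?f z) \<le> L / s * dist y z" if "y \<in> cball x 1" "z \<in> cball x 1" for y z
    proof -
      have "dist (?f y) (?f z) = norm (b z - b y) / s"
        using s by (simp add: dist_norm flip: scaleR_diff_right)
      also have "\<dots> \<le> L * norm (z - y) / s"
        using Lb[OF subsetD[OF sub that(2)] subsetD[OF sub that(1)]] s by (intro divide_right_mono) auto
      finally show ?thesis by (simp add: dist_norm norm_minus_commute)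
    qed
  qed (use s in auto)
  then obtain z where z: "z \<in> cball x 1" "?f z = z" by blast
  have zB: "z \<in> cball 0 (R + 1)"
    using z(1) x R norm_triangle_sub[of z x] by (force simp: dist_norm norm_minus_commute)
  have "s *\<^sub>R ?f z = s *\<^sub>R z" using z(2) by simp
  then have eq: "s *\<^sub>R x + a x = s *\<^sub>R z + b z"
    using s by (simp add: scaleR_add_right algebra_simps)
  \<comment> \<open>Outside S the maps a and b agree, so such a z would have the same image as x
    under \<open>s *\<^sub>R x + a x\<close>; since s exceeds the Lipschitz constant of a, this
    forces z = x, which lies in S.\<close>
  have "z \<in> S"
  proof (rule ccontr)
    assume "z \<notin> S"
    then have "a z = b z" using off KS by auto
    then have "s *\<^sub>R (x - z) = a z - a x"
      using eq by (simp add: algebra_simps)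
    then have "s * norm (x - z) = norm (a z - a x)"
      using s by (metis abs_of_pos norm_scaleR)
    also have "\<dots> \<le> L * norm (x - z)"
      using La[OF zB xB] by (simp add: norm_minus_commute)
    finally have "norm (x - z) \<le> 0"
      using s by (simp add: mult_le_cancel_right not_less)
    then show False using x \<open>z \<notin> S\<close> by simp
  qed
  then show "s *\<^sub>R x + a x \<in> (\<lambda>x. s *\<^sub>R x + b x) ` S" using eq by auto
qed

text \<open>The expansion by s outweighs the Lipschitz constant L of a.\<close>

lemma inj_on_large_multiple:
  fixes a :: "'a::euclidean_space \<Rightarrow> 'a"
  assumes La: "\<And>x y. x \<in> D \<Longrightarrow> y \<in> D \<Longrightarrow> norm (a x - a y) \<le> L * norm (x - y)"
    and s: "s > L" "s > 0"
  shows "inj_on (\<lambda>x. s *\<^sub>R x + a x) D"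
proof (rule inj_onI)
  fix x y assume xy: "x \<in> D" "y \<in> D" "s *\<^sub>R x + a x = s *\<^sub>R y + a y"
  then have "s *\<^sub>R (x - y) = a y - a x" by (simp add: algebra_simps)
  then have "s * norm (x - y) = norm (a y - a x)" using s by (metis abs_of_pos norm_scaleR)
  also have "\<dots> \<le> L * norm (x - y)" using La[OF xy(2,1)] by (simp add: norm_minus_commute)
  finally show "x = y" using s by (simp add: mult_le_cancel_right not_less)
qed


text \<open>After adding \<open>s\<close> times the identity to \<open>g\<close> and \<open>h\<close>, the integrals of the Jacobian determinants are polynomials in \<open>s\<close>.
  For large \<open>s\<close> both maps are injective with positive determinants and the same image, so both integrals are its volume;
  hence the polynomials also agree at \<open>s = 0\<close>.\<close>
lemma integral_det_perturbation:
  fixes g h :: "real^'n::{finite,wellorder} \<Rightarrow> real^'n::_"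
  assumes g: "C1_map g" and h: "C1_map h" and K: "compact K" and off: "\<And>x. x \<notin> K \<Longrightarrow> h x = g x"
    and KS: "K \<subseteq> S"
  shows "((\<lambda>x. det (jac h x) - det (jac g x)) has_integral 0) S"
proof -
  obtain a where KB: "K \<subseteq> cbox (-a) a"
    using bounded_subset_cbox_symmetric[OF compact_imp_bounded[OF K]] by blast
  let ?B = "cbox (-a) a"
  obtain R where R: "?B \<subseteq> cball 0 R" "R > 0"
    using bounded_subset_ballD[OF bounded_cbox, of "-a" a 0] ball_subset_cball by blast
  let ?D = "cball 0 (R + 1) :: (real^'n::_) set"
  have BD: "?B \<subseteq> ?D" using R by auto
  obtain Lg where Lg: "Lg \<ge> 0" "\<And>x y. x \<in> ?D \<Longrightarrow> y \<in> ?D \<Longrightarrow> norm (g x - g y) \<le> Lg * norm (x - y)"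
    using C1_map_lipschitz_on_cball[OF g] by metis
  obtain Lh where Lh: "Lh \<ge> 0" "\<And>x y. x \<in> ?D \<Longrightarrow> y \<in> ?D \<Longrightarrow> norm (h x - h y) \<le> Lh * norm (x - y)"
    using C1_map_lipschitz_on_cball[OF h] by metis
  have "compact (g ` ?D)" "compact (h ` ?D)"
    by (auto intro!: compact_continuous_image C1_map_continuous g h)
  then obtain Mg Mh where M: "\<And>x. x \<in> ?D \<Longrightarrow> norm (g x) \<le> Mg" "\<And>x. x \<in> ?D \<Longrightarrow> norm (h x) \<le> Mh"
    unfolding compact_eq_bounded_closed bounded_iff by (metis image_eqI)
  have "compact (jac g ` ?B)" "compact (jac h ` ?B)"
    by (auto intro!: compact_continuous_image C1_map_continuous_on_jac g h)
  then obtain Cg Ch where C: "\<And>x. x \<in> ?B \<Longrightarrow> norm (jac g x) \<le> Cg" "\<And>x. x \<in> ?B \<Longrightarrow> norm (jac h x) \<le> Ch"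
    unfolding compact_eq_bounded_closed bounded_iff by (metis image_eqI)
  obtain d where d: "d > 0" "\<And>A::real^'n::_^'n::_. norm (A - mat 1) < d \<Longrightarrow> det A > 0"
    using det_pos_near_identity by blast
  have det_pos: "det (s *\<^sub>R mat 1 + A) > 0" if "norm A < s * d" "s > 0" for A :: "real^'n::_^'n::_" and s
  proof -
    have "norm ((mat 1 + (1 / s) *\<^sub>R A) - mat 1) < d"
      using that by (simp add: divide_simps mult.commute)
    then have "det (mat 1 + (1 / s) *\<^sub>R A) > 0" by (rule d)
    moreover have "s *\<^sub>R mat 1 + A = s *\<^sub>R (mat 1 + (1 / s) *\<^sub>R A)"
      using that by (simp add: scaleR_add_right)
    ultimately show ?thesis using that by (simp add: det_scaleR)
  qed
  define L where "L = max Lg Lh"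
  have lip_g: "norm (g x - g y) \<le> L * norm (x - y)" if "x \<in> ?D" "y \<in> ?D" for x y
    using Lg(2)[OF that] mult_right_mono[of Lg L "norm (x - y)"] by (simp add: L_def)
  have lip_h: "norm (h x - h y) \<le> L * norm (x - y)" if "x \<in> ?D" "y \<in> ?D" for x y
    using Lh(2)[OF that] mult_right_mono[of Lh L "norm (x - y)"] by (simp add: L_def)
  have gh: "norm (g x - h y) \<le> Mg + Mh" if "x \<in> ?D" "y \<in> ?D" for x y
    using M(1)[OF that(1)] M(2)[OF that(2)] norm_triangle_ineq4[of "g x" "h y"] by linarith
  have hg: "norm (h x - g y) \<le> Mg + Mh" if "x \<in> ?D" "y \<in> ?D" for x y
    using gh[OF that(2,1)] by (simp add: norm_minus_commute)
  obtain p q where pq: "\<And>s. ((\<lambda>x. det (s *\<^sub>R mat 1 + jac g x)) has_integral poly p s) ?B"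
      "\<And>s. ((\<lambda>x. det (s *\<^sub>R mat 1 + jac h x)) has_integral poly q s) ?B"
    using integral_det_identity_perturbation_poly[OF C1_map_continuous_on_jac] g h by metis
  \<comment> \<open>The entries serve, in turn, positivity of s, injectivity (s > L), the self-map
    condition of the contraction, and positivity of the two determinants.\<close>
  define s0 where "s0 = max 1 (max (L + 1) (max (Mg + Mh) (max (Cg / d + 1) (Ch / d + 1))))"
  \<comment> \<open>With a positive determinant and an injective map, the integral of the
    determinant is the volume of the image of the box.\<close>
  have volume: "measure lebesgue ((\<lambda>x. s *\<^sub>R x + f x) ` ?B) = I"
    if s: "s \<ge> s0" and f: "C1_map f" and lip: "\<And>x y. x \<in> ?D \<Longrightarrow> y \<in> ?D \<Longrightarrow> norm (f x - f y) \<le> L * norm (x - y)"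
      and bound: "\<And>x. x \<in> ?B \<Longrightarrow> norm (jac f x) < s * d"
      and I: "((\<lambda>x. det (s *\<^sub>R mat 1 + jac f x)) has_integral I) ?B" for s f I
  proof -
    have s': "s > 0" "s > L" using s by (auto simp: s0_def)
    have mat: "matrix (\<lambda>v. s *\<^sub>R v + frechet_derivative f (at x) v) = s *\<^sub>R mat 1 + jac f x" for x
      by (simp add: matrix_def vec_eq_iff mat_def axis_def)
    have "((\<lambda>x. \<bar>det (matrix (\<lambda>v. s *\<^sub>R v + frechet_derivative f (at x) v))\<bar>) has_integral I) ?B"
      unfolding mat using I
      by (rule has_integral_eq[rotated]) (use det_pos[OF bound s'(1)] in force)
    moreover have "((\<lambda>x. s *\<^sub>R x + f x) has_derivative
        (\<lambda>v. s *\<^sub>R v + frechet_derivative f (at x) v)) (at x within ?B)" for x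
      by (intro derivative_intros has_derivative_at_withinI[OF C1_map_has_derivative] f)
    moreover have "inj_on (\<lambda>x. s *\<^sub>R x + f x) ?B"
      using inj_on_large_multiple[OF lip s'(2,1)] BD by (rule inj_on_subset)
    ultimately show ?thesis
      using has_measure_differentiable_image[of ?B "\<lambda>x. s *\<^sub>R x + f x"
          "\<lambda>x v. s *\<^sub>R v + frechet_derivative f (at x) v" I] by auto
  qed
  have eq: "poly p s = poly q s" if s: "s \<ge> s0" for s
  proof -
    have s': "s > 0" "s > L" "s \<ge> Mg + Mh" "L \<ge> 0" using s Lg by (auto simp: s0_def L_def)
    have "(\<lambda>x. s *\<^sub>R x + g x) ` ?B = (\<lambda>x. s *\<^sub>R x + h x) ` ?B"
    proof
      show "(\<lambda>x. s *\<^sub>R x + g x) ` ?B \<subseteq> (\<lambda>x. s *\<^sub>R x + h x) ` ?B"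
        by (rule image_large_multiple_subset[OF R(1) KB lip_g lip_h gh]) (use s' off in auto)
      show "(\<lambda>x. s *\<^sub>R x + h x) ` ?B \<subseteq> (\<lambda>x. s *\<^sub>R x + g x) ` ?B"
        by (rule image_large_multiple_subset[OF R(1) KB lip_h lip_g hg]) (use s' off in auto)
    qed
    moreover have "norm (jac g x) < s * d" "norm (jac h x) < s * d" if "x \<in> ?B" for x
    proof -
      have "s > Cg / d" "s > Ch / d" using s by (auto simp: s0_def)
      then show "norm (jac g x) < s * d" "norm (jac h x) < s * d"
        using C[OF that] d(1) by (auto simp: divide_less_eq)
    qed
    ultimately show ?thesis
      using volume[OF s g lip_g _ pq(1)] volume[OF s h lip_h _ pq(2)] by simp
  qed
  \<comment> \<open>The two polynomials agree on the half-line from s0, an infinite set; the value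
    needed is the one at s = 0.\<close>
  have "p = q"
  proof (rule ccontr)
    assume "p \<noteq> q"
    then have "finite {s. poly (p - q) s = 0}" by (intro poly_roots_finite) auto
    moreover have "{s0..} \<subseteq> {s. poly (p - q) s = 0}" using eq by auto
    ultimately show False using infinite_Ici finite_subset by blast
  qed
  then have B: "((\<lambda>x. det (jac h x) - det (jac g x)) has_integral 0) ?B"
    using has_integral_diff[OF pq(2)[of 0] pq(1)[of 0]] by simp
  \<comment> \<open>The complement of the compact K is open, so g and h agree near x and have the
    same derivative. The integrand thus lives on K, and the box may be exchanged for S.\<close>
  have zero: "det (jac h x) - det (jac g x) = 0" if x: "x \<notin> K" for x
  proof -
    have "(h has_derivative frechet_derivative g (at x)) (at x)"
      using C1_map_has_derivative[OF g] by (rule has_derivative_transform_within_open[of _ _ _ _ "- K"])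
        (use K x off in \<open>auto intro: compact_imp_closed\<close>)
    then show ?thesis by (simp flip: frechet_derivative_at)
  qed
  have "((\<lambda>x. if x \<in> ?B then det (jac h x) - det (jac g x) else 0) has_integral 0) UNIV"
    using B by (simp only: has_integral_restrict_UNIV)
  moreover have "(\<lambda>x. if x \<in> ?B then det (jac h x) - det (jac g x) else 0)
      = (\<lambda>x. if x \<in> S then det (jac h x) - det (jac g x) else 0)"
    using zero KB KS by fastforce
  ultimately show ?thesis by (simp only: has_integral_restrict_UNIV)
qed

section \<open>Signed zero counts as integrals\<close>

lemma has_integral_zero_extension:
  fixes f :: "'a::euclidean_space \<Rightarrow> 'b::banach"
  assumes "(f has_integral i) S" "S \<subseteq> T" "\<And>x. x \<in> T \<Longrightarrow> x \<notin> S \<Longrightarrow> f x = 0"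
  shows "(f has_integral i) T"
proof -
  have "((\<lambda>x. if x \<in> S then f x else 0) has_integral i) UNIV"
    using assms(1) by (simp only: has_integral_restrict_UNIV)
  moreover have "(\<lambda>x. if x \<in> S then f x else 0) = (\<lambda>x. if x \<in> T then f x else 0)"
    using assms(2,3) by fastforce
  ultimately show ?thesis by (simp only: has_integral_restrict_UNIV)
qed

section \<open>A test density that is itself a Jacobian determinant\<close>

definition cube_map :: "real \<Rightarrow> real^'n \<Rightarrow> real^'n" where
  "cube_map r y = (\<chi> i. soft_step r (y $ i))"

text \<open>The Jacobian determinant of \<open>cube_map r\<close>, a product of tents carried by the
  cube of half-side r. Because of this origin, \<open>cube_density r (g x) * det (jac g x)\<close>
  is again a Jacobian determinant, that of \<open>cube_map r\<close> composed with g, so the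
  invariance under compact perturbations applies to it.\<close>

definition cube_density :: "real \<Rightarrow> real^'n \<Rightarrow> real" where
  "cube_density r y = (\<Prod>i\<in>UNIV. hat r (y $ i))"

lemma has_derivative_cube_map:
  fixes y :: "real^'n"
  shows "(cube_map r has_derivative (\<lambda>v. \<chi> i. hat r (y $ i) * v $ i)) (at y)"
proof (subst has_derivative_componentwise_within, clarsimp simp: Basis_vec_def)
  fix i :: 'n
  have 1: "((\<lambda>y. y $ i) has_derivative (\<lambda>v. v $ i)) (at y)"
    by (rule bounded_linear_imp_has_derivative[OF bounded_linear_vec_nth])
  have 2: "(soft_step r has_derivative (\<lambda>h. hat r (y $ i) * h)) (at (y $ i))"
    using has_real_derivative_soft_step by (simp add: has_field_derivative_def)
  show "((\<lambda>y. cube_map r y \<bullet> axis i 1) has_derivative (\<lambda>v. (\<chi> i. hat r (y $ i) * v $ i) \<bullet> axis i 1)) (at y)"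
    using has_derivative_compose[OF 1 2] by (simp add: cube_map_def inner_axis)
qed

lemma C1_map_cube_map: "C1_map (cube_map r)"
  by (rule C1_mapI[OF has_derivative_cube_map])
    (intro continuous_intros continuous_on_compose2[OF continuous_on_hat[of UNIV]], auto)

lemma det_jac_cube_map:
  fixes g :: "real^'n \<Rightarrow> real^'n"
  assumes g: "C1_map g"
  shows "det (jac (\<lambda>x. cube_map r (g x)) x) = cube_density r (g x) * det (jac g x)"
proof -
  let ?D = "\<lambda>v. \<chi> i. hat r (g x $ i) * v $ i"
  let ?g' = "frechet_derivative g (at x)"
  have lin: "linear ?D" "linear ?g'"
    using has_derivative_linear[OF has_derivative_cube_map] has_derivative_linear[OF C1_map_has_derivative[OF g]]
    by auto
  have "((\<lambda>x. cube_map r (g x)) has_derivative ?D \<circ> ?g') (at x)"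
    using has_derivative_compose[OF C1_map_has_derivative[OF g] has_derivative_cube_map] by (simp add: o_def)
  then have "jac (\<lambda>x. cube_map r (g x)) x = matrix ?D ** jac g x"
    using lin by (simp add: matrix_compose flip: frechet_derivative_at)
  moreover have "det (matrix ?D) = cube_density r (g x)"
    unfolding cube_density_def by (subst det_diagonal) (auto simp: matrix_def axis_def)
  ultimately show ?thesis by (simp add: det_mul)
qed

lemma continuous_on_cube_density: "continuous_on S (cube_density r)"
  unfolding cube_density_def
  by (intro continuous_intros continuous_on_compose2[OF continuous_on_hat[of UNIV]]) auto

text \<open>Each coordinate is below r in absolute value, so the l1 norm bounds the Euclidean one.
  The factor CARD('n) is compensated later by the choice of r.\<close>

lemma cube_density_support:
  assumes "r > 0" "cube_density r (y :: real^'n) \<noteq> 0"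
  shows "norm y < real CARD('n) * r"
proof -
  have "\<bar>y $ i\<bar> < r" for i
    using assms hat_eq_0[of r "y $ i"] by (force simp: cube_density_def)
  then have "(\<Sum>i\<in>UNIV. \<bar>y $ i\<bar>) < (\<Sum>i\<in>(UNIV::'n set). r)"
    by (intro sum_strict_mono) auto
  with norm_le_l1_cart[of y] show ?thesis by simp
qed

lemma cube_density_nonneg: "r > 0 \<Longrightarrow> cube_density r y \<ge> 0"
  unfolding cube_density_def by (intro prod_nonneg ballI hat_nonneg)

lemma cube_density_integral:
  assumes r: "r > 0"
  obtains I where "I \<noteq> 0" "(cube_density r has_integral I) (UNIV :: (real^'n) set)"
proof -
  obtain a :: "real^'n" where a: "ball 0 (real CARD('n) * r) \<subseteq> cbox (-a) a"
    using bounded_subset_cbox_symmetric[OF bounded_ball] by blast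
  obtain I where I: "(cube_density r has_integral I) (cbox (-a) a)"
    using integrable_continuous[OF continuous_on_cube_density] by blast
  have z: "0 \<in> box (-a) a"
  proof -
    have "0 \<in> ball (0::real^'n) (real CARD('n) * r)" using r by simp
    then show ?thesis using interior_mono[OF a] by (auto simp: interior_cbox)
  qed
  \<comment> \<open>A nonnegative continuous function with integral 0 would vanish at the origin,
    where the density is a power of r.\<close>
  have "I \<noteq> 0"
  proof
    assume "I = 0"
    then have "cube_density r (0::real^'n) = 0"
      using has_integral_0_cbox_imp_0[OF continuous_on_cube_density cube_density_nonneg[OF r], of "-a" a 0] I z
        box_subset_cbox by blast
    then show False using r by (simp add: cube_density_def hat_0)
  qed
  moreover have "(cube_density r has_integral I) (UNIV :: (real^'n) set)"
    by (rule has_integral_zero_extension[OF I]) (use cube_density_support[OF r] a in \<open>auto simp: subset_iff\<close>)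
  ultimately show thesis by (rule that)
qed

text \<open>Change of variables on a chart where the Jacobian has constant sign \<sigma>: the
  formula involves the absolute value of the determinant, and multiplying by \<sigma> restores the
  signed one. Each regular zero thus contributes its sign times I.\<close>

lemma cube_density_integral_chart:
  fixes g :: "real^'n::{finite,wellorder} \<Rightarrow> real^'n::_"
  assumes g: "C1_map g" and V: "open V" "inj_on g V" and W: "ball 0 (real CARD('n) * r) \<subseteq> g ` V"
    and sgn: "\<And>x. x \<in> V \<Longrightarrow> \<bar>det (jac g x)\<bar> = \<sigma> * det (jac g x)" and \<sigma>: "\<sigma> * \<sigma> = 1"
    and r: "r > 0" and I: "(cube_density r has_integral I) (UNIV :: (real^'n::_) set)"
  shows "((\<lambda>x. cube_density r (g x) * det (jac g x)) has_integral (\<sigma> * I)) V"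
proof -
  let ?\<rho> = "cube_density r :: real^'n::_ \<Rightarrow> real"
  have "((\<lambda>y. if y \<in> g ` V then ?\<rho> y else 0) has_integral I) UNIV"
  proof (rule has_integral_eq[OF _ I])
    show "?\<rho> y = (if y \<in> g ` V then ?\<rho> y else 0)" for y
      using cube_density_support[OF r, of y] W by (auto simp: subset_iff)
  qed
  then have \<rho>I: "(?\<rho> has_integral I) (g ` V)" by (simp only: has_integral_restrict_UNIV)
  then have abs: "?\<rho> absolutely_integrable_on (g ` V)"
    by (intro nonnegative_absolutely_integrable_1 cube_density_nonneg r) auto
  \<comment> \<open>The change of variables formula speaks of vector-valued integrands, so the
    scalar density is carried through \<open>real^1\<close>.\<close>
  have "(\<lambda>x. \<bar>det (jac g x)\<bar> *\<^sub>R (vec (?\<rho> (g x)) :: real^1)) absolutely_integrable_on V \<and>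
           integral V (\<lambda>x. \<bar>det (jac g x)\<bar> *\<^sub>R (vec (?\<rho> (g x)) :: real^1)) = vec I
     \<longleftrightarrow> (\<lambda>y. vec (?\<rho> y) :: real^1) absolutely_integrable_on (g ` V)
       \<and> integral (g ` V) (\<lambda>y. vec (?\<rho> y) :: real^1) = vec I"
    using V(1) by (intro has_absolute_integral_change_of_variables V(2)
        has_derivative_at_withinI[OF C1_map_has_derivative[OF g]]
        borel_open[THEN sets_completionI_sets[of _ lborel, unfolded sets_lborel]])
  moreover have "(\<lambda>y. vec (?\<rho> y) :: real^1) absolutely_integrable_on (g ` V)"
    using abs unfolding absolutely_integrable_on_1_iff vec_component .
  moreover have "integral (g ` V) (\<lambda>y. vec (?\<rho> y) :: real^1) = vec I"
    unfolding integral_on_1_eq vec_component integral_unique[OF \<rho>I] ..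
  ultimately have "(\<lambda>x. \<bar>det (jac g x)\<bar> *\<^sub>R (vec (?\<rho> (g x)) :: real^1)) absolutely_integrable_on V"
      "integral V (\<lambda>x. \<bar>det (jac g x)\<bar> *\<^sub>R (vec (?\<rho> (g x)) :: real^1)) = vec I"
    by blast+
  then have "(\<lambda>x. \<bar>det (jac g x)\<bar> * ?\<rho> (g x)) absolutely_integrable_on V"
      "integral V (\<lambda>x. \<bar>det (jac g x)\<bar> * ?\<rho> (g x)) = I"
    unfolding absolutely_integrable_on_1_iff integral_on_1_eq by (simp_all add: vec_eq_iff)
  then have "((\<lambda>x. \<bar>det (jac g x)\<bar> * ?\<rho> (g x)) has_integral I) V"
    using absolutely_integrable_on_def has_integral_iff by blast
  then have "((\<lambda>x. \<sigma> * (\<bar>det (jac g x)\<bar> * ?\<rho> (g x))) has_integral \<sigma> * I) V"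
    by (rule has_integral_mult_right)
  moreover have "\<sigma> * (\<bar>det (jac g x)\<bar> * ?\<rho> (g x)) = cube_density r (g x) * det (jac g x)" if "x \<in> V" for x
    using sgn[OF that] \<sigma> by (metis mult.assoc mult.commute mult.left_neutral)
  ultimately show ?thesis
    by (rule has_integral_eq[rotated])
qed

lemma local_chart_at_regular_zero:
  fixes g :: "real^'n \<Rightarrow> real^'n"
  assumes g: "C1_map g" and N: "open N" "x \<in> N" and reg: "det (jac g x) \<noteq> 0"
  obtains V where "open V" "x \<in> V" "V \<subseteq> N" "inj_on g V" "open (g ` V)"
    "\<And>y. y \<in> V \<Longrightarrow> \<bar>det (jac g y)\<bar> = (if det (jac g x) > 0 then 1 else - 1) * det (jac g y)"
proof -
  obtain g' where g': "\<And>z. (g has_derivative blinfun_apply (g' z)) (at z)" "continuous_on UNIV g'"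
    using g unfolding C1_map_def by blast
  have eq: "frechet_derivative g (at z) = blinfun_apply (g' z)" for z
    using frechet_derivative_at[OF g'(1)] by simp
  \<comment> \<open>Restricting to points where the determinant has the same sign as at x makes that
    sign constant on the chart.\<close>
  define P where "P = N \<inter> {y. det (jac g x) * det (jac g y) > 0}"
  have cont: "continuous_on UNIV (\<lambda>y. det (jac g y))"
    by (intro continuous_on_det C1_map_continuous_on_jac g)
  have "open {y. det (jac g x) * det (jac g y) > 0}"
    by (intro open_Collect_less continuous_intros cont)
  then have P: "open P" "x \<in> P"
    unfolding P_def using N reg by (auto simp: zero_less_mult_iff)
  have lin: "linear (blinfun_apply (g' x))" using bounded_linear.linear[OF blinfun.bounded_linear_right] .
  have "invertible (jac g x)" using reg by (simp add: invertible_det_nz)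
  then obtain B where B: "B ** jac g x = mat 1" unfolding invertible_def by blast
  have inv: "Blinfun ((*v) B) o\<^sub>L g' x = id_blinfun"
  proof (rule blinfun_eqI)
    fix v
    have "blinfun_apply (Blinfun ((*v) B) o\<^sub>L g' x) v = B *v (jac g x *v v)"
      using lin by (simp add: bounded_linear_Blinfun_apply eq matrix_works)
    then show "blinfun_apply (Blinfun ((*v) B) o\<^sub>L g' x) v = blinfun_apply id_blinfun v"
      by (simp add: matrix_vector_mul_assoc B)
  qed
  obtain V W k where V: "open V" "V \<subseteq> P" "x \<in> V" and W: "open W" and hom: "homeomorphism V W g k"
    by (rule inverse_function_theorem[OF P(1) g'(1) continuous_on_subset[OF g'(2) subset_UNIV] P(2) inv])
      (rule that, assumption+)
  show thesis
  proof
    show "inj_on g V" using hom unfolding homeomorphism_def by (intro inj_on_inverseI[of _ k]) blast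
    show "open (g ` V)" using hom W by (simp add: homeomorphism_image1)
    show "\<bar>det (jac g y)\<bar> = (if det (jac g x) > 0 then 1 else - 1) * det (jac g y)" if "y \<in> V" for y
      using V(2) that by (auto simp: P_def zero_less_mult_iff split: if_splits)
    show "V \<subseteq> N" using V(2) by (simp add: P_def)
  qed (rule V)+
qed


lemma compact_positive_lower_bound:
  fixes f :: "'a::topological_space \<Rightarrow> real"
  assumes "compact S" "continuous_on S f" "\<And>x. x \<in> S \<Longrightarrow> f x > 0"
  obtains c where "c > 0" "\<And>x. x \<in> S \<Longrightarrow> c \<le> f x"
proof (cases "S = {}")
  case False
  then obtain x where "x \<in> S" "\<And>y. y \<in> S \<Longrightarrow> f x \<le> f y"
    using continuous_attains_inf[OF assms(1) _ assms(2)] by auto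
  then show thesis using that[of "f x"] assms(3) by auto
qed (use that[of 1] in auto)

text \<open>Having no zeros on the frontier makes the zero set compact; it is covered by injectivity
  neighbourhoods, each of which contains a single zero.\<close>

lemma finite_regular_zeros:
  fixes g :: "real^'n \<Rightarrow> real^'n"
  assumes g: "C1_map g" and U: "open U" "bounded U"
    and reg: "\<And>x. x \<in> U \<Longrightarrow> g x = 0 \<Longrightarrow> det (jac g x) \<noteq> 0"
    and fr: "\<And>x. x \<in> frontier U \<Longrightarrow> g x \<noteq> 0"
  shows "finite {x \<in> U. g x = 0}"
proof -
  let ?Z = "{x \<in> U. g x = 0}"
  have "?Z = closure U \<inter> {x. g x = 0}"
    using fr U(1) by (auto simp: frontier_def interior_open closure_subset[THEN subsetD])
  then have Z: "compact ?Z"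
    using U(2) by (auto intro!: closed_Collect_eq C1_map_continuous g continuous_on_const compact_Int_closed)
  have "\<exists>V. open V \<and> x \<in> V \<and> inj_on g V" if x: "x \<in> ?Z" for x
  proof -
    have "det (jac g x) \<noteq> 0" using reg x by auto
    then show ?thesis by (rule local_chart_at_regular_zero[OF g open_UNIV UNIV_I]) blast
  qed
  then obtain V where V: "\<And>x. x \<in> ?Z \<Longrightarrow> open (V x) \<and> x \<in> V x \<and> inj_on g (V x)" by metis
  then have "?Z \<subseteq> (\<Union>x\<in>?Z. V x)" by blast
  then obtain C where C: "C \<subseteq> ?Z" "finite C" "?Z \<subseteq> (\<Union>x\<in>C. V x)"
    using compactE_image[OF Z, of ?Z V] V by (metis (no_types, lifting))
  have "?Z \<subseteq> C"
  proof
    fix x assume x: "x \<in> ?Z"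
    then obtain c where c: "c \<in> C" "x \<in> V c" using C(3) by blast
    then have "c \<in> ?Z" using C(1) by blast
    then have "x = c" using V[of c] c x by (auto simp: inj_on_def)
    then show "x \<in> C" using c by simp
  qed
  then show ?thesis using C(2) finite_subset by blast
qed

text \<open>\<open>g\<close> is changed on a compact subset of \<open>U\<close> into a nonvanishing \<open>h\<close>. Composing with \<open>cube_map r\<close> for a small \<open>r\<close> makes
  the Jacobian determinant of \<open>h\<close> vanish on \<open>U\<close> and localises that of \<open>g\<close> near the zeros.\<close>
lemma regular_degree_sum_eq_0:
  fixes g G :: "real^'n::{finite,wellorder} \<Rightarrow> real^'n::_"
  assumes g: "C1_map g" and U: "open U" "bounded U"
    and reg: "\<And>x. x \<in> U \<Longrightarrow> g x = 0 \<Longrightarrow> det (jac g x) \<noteq> 0"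
    and G: "continuous_on (closure U) G" "\<And>x. x \<in> closure U \<Longrightarrow> G x \<noteq> 0"
    and close: "\<And>x. x \<in> frontier U \<Longrightarrow> norm (g x - G x) < norm (G x)"
  shows "regular_degree_sum g U = 0"
proof -
  define Z where "Z = {x \<in> U. g x = 0}"
  have compU: "compact (closure U)" using U(2) by simp
  have frU: "frontier U = closure U - U" using U(1) by (simp add: frontier_def interior_open)
  have fr: "g x \<noteq> 0" if "x \<in> frontier U" for x using close[OF that] by auto
  have fin: "finite Z" unfolding Z_def by (rule finite_regular_zeros[OF g U reg fr])
  obtain c where c: "c > 0" "\<And>x. x \<in> closure U \<Longrightarrow> c \<le> norm (G x)"
    by (rule compact_positive_lower_bound[OF compU, of "\<lambda>x. norm (G x)"])
      (use G in \<open>auto intro: continuous_intros\<close>)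
  \<comment> \<open>G is only continuous. The polynomial H is C1, and an error below c keeps H x in
    the open ball around G x of radius norm (G x), which misses 0.\<close>
  obtain H where H: "polynomial_function H" "\<And>x. x \<in> closure U \<Longrightarrow> norm (G x - H x) < c"
    using Stone_Weierstrass_polynomial_function[OF compU G(1) c(1)] by blast
  have C1H: "C1_map H" by (rule C1_map_polynomial_function[OF H(1)])
  have GH: "norm (H x - G x) < norm (G x)" if "x \<in> closure U" for x
    using H(2)[OF that] c(2)[OF that] by (simp add: norm_minus_commute)
  \<comment> \<open>The points where the segment from g x to H x meets 0. On the frontier both ends
    lie in the open ball around G x of radius norm (G x), which is convex and misses 0; so Y avoids
    the frontier.\<close>
  define Y where "Y = snd ` (({0..1} \<times> closure U) \<inter> {p. (1 - fst p) *\<^sub>R g (snd p) + fst p *\<^sub>R H (snd p) = 0})"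
  have "closed {p. (1 - fst p) *\<^sub>R g (snd p) + fst p *\<^sub>R H (snd p) = 0}"
    by (intro closed_Collect_eq continuous_intros
        continuous_on_compose2[OF C1_map_continuous[OF g, of UNIV]]
        continuous_on_compose2[OF C1_map_continuous[OF C1H, of UNIV]]) auto
  then have Y: "compact Y"
    unfolding Y_def
    by (intro compact_continuous_image continuous_on_snd continuous_on_id compact_Int_closed compact_Times compU) auto
  have Y_fr: "x \<notin> frontier U" if "x \<in> Y" for x
  proof
    assume x: "x \<in> frontier U"
    obtain t where t: "0 \<le> t" "t \<le> 1" "(1 - t) *\<^sub>R g x + t *\<^sub>R H x = 0" using \<open>x \<in> Y\<close> unfolding Y_def by auto
    have "G x = - ((1 - t) *\<^sub>R (g x - G x) + t *\<^sub>R (H x - G x))"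
      using t(3) by (simp add: algebra_simps)
    then have "norm (G x) \<le> (1 - t) * norm (g x - G x) + t * norm (H x - G x)"
      using norm_triangle_ineq[of "(1 - t) *\<^sub>R (g x - G x)" "t *\<^sub>R (H x - G x)"] t(1,2)
      by (metis abs_of_nonneg diff_ge_0_iff_ge norm_minus_cancel norm_scaleR)
    moreover have "(1 - t) * norm (g x - G x) + t * norm (H x - G x) < norm (G x)"
      by (rule convex_bound_lt) (use close[OF x] GH[of x] x t frU in auto)
    ultimately show False by simp
  qed
  have "Y \<subseteq> closure U" unfolding Y_def by auto
  then have "Y \<subseteq> U" using frU Y_fr by blast
  obtain l K where l: "C1_map l" "\<And>x. 0 \<le> l x \<and> l x \<le> (1::real)" "\<And>x. x \<in> Y \<Longrightarrow> l x = 1"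
      and K: "compact K" "K \<subseteq> U" "\<And>x. x \<notin> K \<Longrightarrow> l x = 0"
    using C1_map_bump[OF Y U(1) \<open>Y \<subseteq> U\<close>] by blast
  \<comment> \<open>A zero x of h in the closure lies in Y, with parameter l x; but l is 1 on Y, so
    H x would be 0.\<close>
  define h where "h x = g x + l x *\<^sub>R (H x - g x)" for x
  have h: "C1_map h" unfolding h_def[abs_def] by (intro C1_map_add C1_map_scaleR C1_map_diff g l(1) C1H)
  have h_nz: "h x \<noteq> 0" if x: "x \<in> closure U" for x
  proof
    assume 0: "h x = 0"
    then have "x \<in> Y" unfolding Y_def using x l(2)[of x]
      by (intro image_eqI[of _ _ "(l x, x)"]) (auto simp: h_def algebra_simps)
    then have "H x = 0" using 0 l(3) by (simp add: h_def)
    then show False using GH[OF x] by simp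
  qed
  obtain mh where mh: "mh > 0" "\<And>x. x \<in> closure U \<Longrightarrow> mh \<le> norm (h x)"
    by (rule compact_positive_lower_bound[OF compU, of "\<lambda>x. norm (h x)"])
      (use h_nz in \<open>auto intro: continuous_intros C1_map_continuous h\<close>)
  \<comment> \<open>Charts will be taken inside balls of half this radius, so that charts of
    different zeros are disjoint.\<close>
  have "\<exists>d>0. \<forall>y\<in>Z. y \<noteq> x \<longrightarrow> d \<le> dist x y" for x
    by (rule finite_set_avoid[OF fin])
  then obtain d where d: "\<And>x. d x > 0" "\<And>x y. y \<in> Z \<Longrightarrow> y \<noteq> x \<Longrightarrow> d x \<le> dist x y" by metis
  define \<sigma> where "\<sigma> x = (if det (jac g x) > 0 then 1 else - 1 :: real)" for x
  define chart where "chart x V \<longleftrightarrow> open V \<and> x \<in> V \<and> V \<subseteq> U \<inter> ball x (d x / 2) \<and> inj_on g V \<and>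
      open (g ` V) \<and> (\<forall>y\<in>V. \<bar>det (jac g y)\<bar> = \<sigma> x * det (jac g y))" for x V
  have "\<exists>V. chart x V" if x: "x \<in> Z" for x
  proof -
    have "open (U \<inter> ball x (d x / 2))" "x \<in> U \<inter> ball x (d x / 2)" "det (jac g x) \<noteq> 0"
      using x d(1)[of x] reg U(1) by (auto simp: Z_def)
    then show ?thesis
      unfolding chart_def \<sigma>_def by (rule local_chart_at_regular_zero[OF g]) blast
  qed
  then obtain V where "\<And>x. x \<in> Z \<Longrightarrow> chart x (V x)" by metis
  then have V: "open (V x)" "x \<in> V x" "V x \<subseteq> U" "V x \<subseteq> ball x (d x / 2)" "inj_on g (V x)"
      "open (g ` V x)" "\<And>y. y \<in> V x \<Longrightarrow> \<bar>det (jac g y)\<bar> = \<sigma> x * det (jac g y)" if "x \<in> Z" for x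
    unfolding chart_def using that by blast+
  have disj: "V x \<inter> V y = {}" if xy: "x \<in> Z" "y \<in> Z" "x \<noteq> y" for x y
  proof (rule ccontr)
    assume "V x \<inter> V y \<noteq> {}"
    then obtain z where z: "z \<in> V x" "z \<in> V y" by blast
    have "dist x z < d x / 2" "dist y z < d y / 2"
      using subsetD[OF V(4)[OF xy(1)] z(1)] subsetD[OF V(4)[OF xy(2)] z(2)] by simp_all
    moreover have "d x \<le> dist x y" "d y \<le> dist y x" using d(2)[OF xy(2)] d(2)[OF xy(1)] xy(3) by auto
    ultimately show False using dist_triangle2[of x y z] dist_commute[of x y] by linarith
  qed
  have "\<exists>e>0. ball 0 e \<subseteq> g ` V x" if x: "x \<in> Z" for x
  proof -
    have "g x = 0" using x by (simp add: Z_def)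
    then have "0 \<in> g ` V x" using V(2)[OF x] by (metis image_eqI)
    then show ?thesis using open_contains_ball[THEN iffD1, OF V(6)[OF x]] by blast
  qed
  then obtain e where e: "\<And>x. x \<in> Z \<Longrightarrow> e x > 0 \<and> ball 0 (e x) \<subseteq> g ` V x" by metis
  have "compact (closure U - (\<Union>x\<in>Z. V x))"
    by (intro compact_diff compU open_UN ballI V(1))
  then obtain mg where mg: "mg > 0" "\<And>x. x \<in> closure U - (\<Union>x\<in>Z. V x) \<Longrightarrow> mg \<le> norm (g x)"
  proof (rule compact_positive_lower_bound[of _ "\<lambda>x. norm (g x)"])
    fix x assume x: "x \<in> closure U - (\<Union>x\<in>Z. V x)"
    then have "x \<notin> Z" using V(2) by blast
    then have "g x \<noteq> 0" using x fr frU by (auto simp: Z_def)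
    then show "norm (g x) > 0" by simp
  qed (auto intro: continuous_intros C1_map_continuous g)
  \<comment> \<open>With the density carried by the ball of radius m, m \<le> mh makes it vanish
    along h, m \<le> mg makes it vanish along g outside the charts, and m \<le> e x puts its support
    into the image of each chart.\<close>
  define A where "A = insert mh (insert mg (e ` Z))"
  define m where "m = Min A"
  have A: "finite A" "A \<noteq> {}" "\<And>a. a \<in> A \<Longrightarrow> a > 0"
    unfolding A_def using fin e mh(1) mg(1) by auto
  have m: "m > 0" "m \<le> mh" "m \<le> mg"
    unfolding m_def by (rule A(3)[OF Min_in] Min_le A | simp add: A_def)+
  have me: "m \<le> e x" if "x \<in> Z" for x
    unfolding m_def using that by (intro Min_le A) (simp add: A_def)
  define r where "r = m / CARD('n)"
  have r: "r > 0" "real CARD('n) * r = m" using m(1) by (auto simp: r_def)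
  have density0: "cube_density r (y::real^'n::_) = 0" if "norm y \<ge> m" for y
    using cube_density_support[OF r(1), of y] r(2) that by force
  obtain I where I: "I \<noteq> 0" "(cube_density r has_integral I) (UNIV :: (real^'n::_) set)"
    by (rule cube_density_integral[OF r(1)])
  let ?f = "\<lambda>x. cube_density r (g x) * det (jac g x)"
  have "(?f has_integral (\<sigma> x * I)) (V x)" if x: "x \<in> Z" for x
  proof (rule cube_density_integral_chart[OF g])
    show "ball 0 (real CARD('n) * r) \<subseteq> g ` V x"
      using e[OF x] me[OF x] r(2) by (auto simp: subset_iff)
    show "\<sigma> x * \<sigma> x = 1" by (simp add: \<sigma>_def)
  qed (rule V[OF x] I r | assumption)+
  then have "(?f has_integral (\<Sum>x\<in>Z. \<sigma> x * I)) (\<Union>x\<in>Z. V x)"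
    by (intro has_integral_UN fin pairwiseI) (simp_all add: disj)
  then have sum: "(?f has_integral (\<Sum>x\<in>Z. \<sigma> x * I)) U"
  proof (rule has_integral_zero_extension)
    show "(\<Union>x\<in>Z. V x) \<subseteq> U" by (rule UN_least) (rule V(3))
    fix x assume "x \<in> U" "x \<notin> (\<Union>x\<in>Z. V x)"
    then have "mg \<le> norm (g x)" using closure_subset[of U] by (intro mg(2)) blast
    then have "cube_density r (g x) = 0" using m(3) by (intro density0) linarith
    then show "?f x = 0" by simp
  qed
  \<comment> \<open>The perturbation from g to h happens on K; after composition with
    \<open>cube_map r\<close> the h-term is 0 on U, so the g-term must have integral 0 as
    well.\<close>
  have "((\<lambda>x. det (jac (\<lambda>x. cube_map r (h x)) x) - det (jac (\<lambda>x. cube_map r (g x)) x)) has_integral 0) U"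
  proof (rule integral_det_perturbation[OF _ _ K(1) _ K(2)])
    show "cube_map r (h x) = cube_map r (g x)" if "x \<notin> K" for x
      by (simp add: h_def K(3)[OF that])
  qed (rule C1_map_compose[OF g C1_map_cube_map] C1_map_compose[OF h C1_map_cube_map])+
  then have neg: "((\<lambda>x. - ?f x) has_integral 0) U"
  proof (rule has_integral_eq[rotated])
    fix x assume "x \<in> U"
    then have "mh \<le> norm (h x)" using closure_subset[of U] by (intro mh(2)) blast
    then have "cube_density r (h x) = 0" using m(2) by (intro density0) linarith
    then show "det (jac (\<lambda>x. cube_map r (h x)) x) - det (jac (\<lambda>x. cube_map r (g x)) x) = - ?f x"
      unfolding det_jac_cube_map[OF g] det_jac_cube_map[OF h] by simp
  qed
  have "- (\<Sum>x\<in>Z. \<sigma> x * I) = 0"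
    by (rule has_integral_unique[OF has_integral_neg[OF sum] neg])
  then have "(\<Sum>x\<in>Z. \<sigma> x) * I = 0" by (simp add: sum_distrib_right)
  then have "(\<Sum>x\<in>Z. \<sigma> x) = 0" using I(1) by simp
  moreover have "(\<Sum>x\<in>Z. \<sigma> x) = real_of_int (regular_degree_sum g U)"
    unfolding regular_degree_sum_def of_int_sum Z_def by (rule sum.cong) (simp_all add: \<sigma>_def jac_det_def)
  ultimately show ?thesis by linarith
qed

text \<open>Polynomials are dense in the continuous functions on the closure; by Sard's lemma the
  critical values of one fill no ball, so a small shift y that is not a critical value makes every
  zero regular.\<close>

lemma regular_approximation:
  fixes F :: "real^'n::{finite,wellorder} \<Rightarrow> real^'n::_"
  assumes U: "bounded U" and F: "continuous_on (closure U) F" and \<delta>: "\<delta> > 0"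
  obtains g where "C1_map g" "\<And>x. x \<in> U \<Longrightarrow> g x = 0 \<Longrightarrow> det (jac g x) \<noteq> 0"
    "\<And>x. x \<in> closure U \<Longrightarrow> norm (F x - g x) < \<delta>"
proof -
  obtain p where p: "polynomial_function p" "\<And>x. x \<in> closure U \<Longrightarrow> norm (F x - p x) < \<delta> / 2"
    using Stone_Weierstrass_polynomial_function[OF _ F, of "\<delta> / 2"] U \<delta> by auto
  have C1: "C1_map p" by (rule C1_map_polynomial_function[OF p(1)])
  let ?S = "{x. det (jac p x) = 0}"
  have "negligible (p ` ?S)"
  proof (rule baby_Sard)
    show "(p has_derivative frechet_derivative p (at x)) (at x within ?S)" for x
      by (rule has_derivative_at_withinI[OF C1_map_has_derivative[OF C1]])
    show "rank (matrix (frechet_derivative p (at x))) < CARD('n)" if "x \<in> ?S" for x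
      using that by (simp add: det_eq_0_rank)
  qed auto
  then have "\<not> ball 0 (\<delta> / 2) \<subseteq> p ` ?S"
    using open_not_negligible[of "ball (0::real^'n::_) (\<delta> / 2)"] negligible_subset[of "p ` ?S"] \<delta>
    by (metis ball_eq_empty half_gt_zero not_le open_ball)
  then obtain y where "y \<in> ball 0 (\<delta> / 2)" and y: "y \<notin> p ` ?S" by blast
  then have y_small: "norm y < \<delta> / 2" by simp
  show thesis
  proof
    show "C1_map (\<lambda>x. p x - y)" by (intro C1_map_diff C1 C1_map_const)
    have "jac (\<lambda>x. p x - y) x = jac p x" for x
    proof -
      have "((\<lambda>x. p x - y) has_derivative frechet_derivative p (at x)) (at x)"
        using C1_map_has_derivative[OF C1] by (auto intro!: derivative_eq_intros)
      then show ?thesis by (simp flip: frechet_derivative_at)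
    qed
    then show "det (jac (\<lambda>x. p x - y) x) \<noteq> 0" if "p x - y = 0" for x
      using y that by auto
    show "norm (F x - (p x - y)) < \<delta>" if x: "x \<in> closure U" for x
    proof -
      have "F x - (p x - y) = (F x - p x) + y" by simp
      then have "norm (F x - (p x - y)) \<le> norm (F x - p x) + norm y"
        using norm_triangle_ineq by metis
      then show ?thesis using p(2)[OF x] y_small by linarith
    qed
  qed
qed

section \<open>Removing the well-order on the index type\<close>

text \<open>The change of variables formula and Sard's lemma are only available for well-ordered index types,
  so an arbitrary finite index type is replaced by a copy ordered through an enumeration.\<close>
typedef 'a enumerated = "UNIV :: 'a set" by simp

lemma bij_Rep_enumerated: "bij Rep_enumerated"
  by (metis Abs_enumerated_inverse Rep_enumerated_inverse UNIV_I bijI')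

instance enumerated :: (finite) finite
proof
  have "finite (Rep_enumerated -` (UNIV :: 'a set))"
    by (rule finite_vimageI) (simp_all add: bij_is_inj bij_Rep_enumerated)
  then show "finite (UNIV :: 'a enumerated set)" by simp
qed

instantiation enumerated :: (finite) linorder
begin

definition less_eq_enumerated :: "'a enumerated \<Rightarrow> 'a enumerated \<Rightarrow> bool" where
  "x \<le> y \<longleftrightarrow> to_nat (Rep_enumerated x) \<le> to_nat (Rep_enumerated y)"

definition less_enumerated :: "'a enumerated \<Rightarrow> 'a enumerated \<Rightarrow> bool" where
  "x < y \<longleftrightarrow> to_nat (Rep_enumerated x) < to_nat (Rep_enumerated y)"

instance
  by standard (auto simp: less_eq_enumerated_def less_enumerated_def Rep_enumerated_inject)

end

instance enumerated :: (finite) wellorder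
proof
  fix P :: "'a enumerated \<Rightarrow> bool" and a
  assume "\<And>x. (\<And>y. y < x \<Longrightarrow> P y) \<Longrightarrow> P x"
  then show "P a"
    using measure_induct_rule[of "\<lambda>x. to_nat (Rep_enumerated x)" P a]
    unfolding less_enumerated_def by blast
qed

text \<open>The conjugate of a transposition is a transposition, so the length of the product is
  kept. The bijection r may join two different types.\<close>

lemma swapidseq_conjugate:
  assumes "swapidseq n p" and r: "bij r"
  shows "swapidseq n (inv r \<circ> p \<circ> r)"
  using assms(1)
proof (induction rule: swapidseq.induct)
  case id
  have "inv r \<circ> id \<circ> r = id" using r by (auto simp: fun_eq_iff bij_is_inj)
  then show ?case by (simp only: swapidseq.id)
next
  case (comp_Suc n p a b)
  have r_inv: "r (inv r x) = x" for x using r by (simp add: bij_is_surj surj_f_inv_f)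
  have inv_r_eq: "inv r x = inv r y \<longleftrightarrow> x = y" for x y by (metis r_inv)
  have "inv r \<circ> (Transposition.transpose a b \<circ> p) \<circ> r = Transposition.transpose (inv r a) (inv r b) \<circ> (inv r \<circ> p \<circ> r)"
    by (auto simp: fun_eq_iff Transposition.transpose_def r_inv inv_r_eq)
  moreover have "inv r a \<noteq> inv r b"
    using comp_Suc r by (metis bij_inv_eq_iff)
  ultimately show ?case
    using swapidseq.comp_Suc[OF comp_Suc.IH, of "inv r a" "inv r b"] by (simp only: simp_thms)
qed

lemma sign_conjugate:
  assumes p: "permutation p" and r: "bij r"
  shows "sign (inv r \<circ> p \<circ> r) = sign p"
proof -
  obtain n where n: "swapidseq n p" using p unfolding permutation_def by blast
  then have "evenperm p = even n" "evenperm (inv r \<circ> p \<circ> r) = even n"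
    using swapidseq_conjugate[OF n r] evenperm_unique by blast+
  then show ?thesis by (simp add: sign_def)
qed

text \<open>Renaming rows and columns by the same bijection conjugates the permutations in the
  Leibniz sum, which leaves their signs and the products unchanged.\<close>

lemma det_reindex:
  fixes A :: "real^'n^'n" and r :: "'m::finite \<Rightarrow> 'n"
  assumes r: "bij r"
  shows "det (\<chi> i j. A $ r i $ r j) = det A"
proof -
  have [simp]: "r (inv r x) = x" "inv r (r y) = y" for x y
    using r by (simp_all add: bij_is_inj bij_is_surj surj_f_inv_f)
  have r': "bij (inv r)" and inv: "inv (inv r) = r" using r by (simp_all add: bij_imp_bij_inv inv_inv_eq)
  show ?thesis
    unfolding det_def
  proof (rule sum.reindex_bij_witness[of _ "\<lambda>p. inv r \<circ> p \<circ> r" "\<lambda>q. r \<circ> q \<circ> inv r"])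
    fix q :: "'m \<Rightarrow> 'm" assume "q \<in> {p. p permutes UNIV}"
    then have q: "bij q" by (simp add: permutes_bij)
    show "inv r \<circ> (r \<circ> q \<circ> inv r) \<circ> r = q" by (auto simp: fun_eq_iff)
    have "bij (r \<circ> q \<circ> inv r)" using q r r' by (simp add: bij_comp)
    then show "r \<circ> q \<circ> inv r \<in> {p. p permutes UNIV}" by (auto intro: bij_imp_permutes)
    have "permutation q" using q by (simp add: permutation)
    then have "sign (r \<circ> q \<circ> inv r) = sign q"
      using sign_conjugate[OF _ r'] by (simp add: inv)
    moreover have "(\<Prod>i\<in>UNIV. A $ i $ (r \<circ> q \<circ> inv r) i) = (\<Prod>i\<in>UNIV. A $ r i $ r (q i))"
      by (rule prod.reindex_bij_witness[of _ r "inv r"]) auto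
    ultimately show "of_int (sign (r \<circ> q \<circ> inv r)) * (\<Prod>i\<in>UNIV. A $ i $ (r \<circ> q \<circ> inv r) i)
        = of_int (sign q) * (\<Prod>i\<in>UNIV. (\<chi> i j. A $ r i $ r j) $ i $ q i)" by simp
  next
    fix p :: "'n \<Rightarrow> 'n" assume "p \<in> {p. p permutes UNIV}"
    then have p: "bij p" by (simp add: permutes_bij)
    show "r \<circ> (inv r \<circ> p \<circ> r) \<circ> inv r = p" by (auto simp: fun_eq_iff)
    have "bij (inv r \<circ> p \<circ> r)" using p r r' by (simp add: bij_comp)
    then show "inv r \<circ> p \<circ> r \<in> {p. p permutes UNIV}" by (auto intro: bij_imp_permutes)
  qed
qed

section \<open>Isometric transfer of fields to the well-ordered index type\<close>

definition to_enum :: "real^'k \<Rightarrow> real^'k enumerated" where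
  "to_enum x = (\<chi> i. x $ Rep_enumerated i)"

definition of_enum :: "real^'k enumerated \<Rightarrow> real^'k" where
  "of_enum y = (\<chi> i. y $ Abs_enumerated i)"

lemma of_to_enum [simp]: "of_enum (to_enum x) = x" "to_enum (of_enum y) = y"
  by (simp_all add: to_enum_def of_enum_def vec_eq_iff Abs_enumerated_inverse Rep_enumerated_inverse)

lemma linear_to_enum: "linear to_enum" and linear_of_enum: "linear of_enum"
  by (auto simp: linear_iff to_enum_def of_enum_def vec_eq_iff)

lemma bounded_linear_to_enum: "bounded_linear to_enum" and bounded_linear_of_enum: "bounded_linear of_enum"
  by (simp_all add: linear_to_enum linear_of_enum flip: linear_conv_bounded_linear)

lemma norm_to_enum [simp]: "norm (to_enum x) = norm x"
  unfolding norm_vec_def L2_set_def to_enum_def vec_lambda_beta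
  by (intro arg_cong[where f = sqrt] sum.reindex_bij_betw[of Rep_enumerated])
    (simp add: bij_Rep_enumerated)

lemma to_enum_eq_0 [simp]: "to_enum x = 0 \<longleftrightarrow> x = 0"
  by (metis norm_eq_zero norm_to_enum)

lemma bij_to_enum: "bij to_enum"
  by (metis bijI' of_to_enum)

definition conj_enum :: "(real^'k \<Rightarrow> real^'k) \<Rightarrow> real^'k enumerated \<Rightarrow> real^'k enumerated" where
  "conj_enum g y = to_enum (g (of_enum y))"

definition conj_of_enum :: "(real^'k enumerated \<Rightarrow> real^'k enumerated) \<Rightarrow> real^'k \<Rightarrow> real^'k" where
  "conj_of_enum g y = of_enum (g (to_enum y))"

lemma conj_enum_of_enum: "conj_enum (conj_of_enum g) = g"
  by (simp add: conj_enum_def conj_of_enum_def fun_eq_iff)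

lemma C1_map_conj_enum: "C1_map g \<Longrightarrow> C1_map (conj_enum g)"
  unfolding conj_enum_def[abs_def]
  by (rule C1_map_compose[OF C1_map_compose[OF C1_map_bounded_linear[OF bounded_linear_of_enum]]
      C1_map_bounded_linear[OF bounded_linear_to_enum]])

lemma C1_map_conj_of_enum: "C1_map g \<Longrightarrow> C1_map (conj_of_enum g)"
  unfolding conj_of_enum_def[abs_def]
  by (rule C1_map_compose[OF C1_map_compose[OF C1_map_bounded_linear[OF bounded_linear_to_enum]]
      C1_map_bounded_linear[OF bounded_linear_of_enum]])

text \<open>The coordinate change sends basis vectors to basis vectors, so the Jacobian matrix is
  only reindexed, by one bijection for rows and columns alike.\<close>

lemma det_jac_conj_enum:
  fixes g :: "real^'k \<Rightarrow> real^'k"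
  assumes g: "C1_map g"
  shows "det (jac (conj_enum g) (to_enum x)) = det (jac g x)"
proof -
  let ?g' = "frechet_derivative g (at x)"
  have "(of_enum has_derivative of_enum) (at (to_enum x))"
    by (rule bounded_linear_imp_has_derivative[OF bounded_linear_of_enum])
  moreover have "(g has_derivative ?g') (at (of_enum (to_enum x)))"
    using C1_map_has_derivative[OF g] by simp
  ultimately have "((\<lambda>y. g (of_enum y)) has_derivative (\<lambda>v. ?g' (of_enum v))) (at (to_enum x))"
    by (rule has_derivative_compose)
  then have "((\<lambda>y. to_enum (g (of_enum y))) has_derivative (\<lambda>v. to_enum (?g' (of_enum v)))) (at (to_enum x))"
    by (rule bounded_linear.has_derivative[OF bounded_linear_to_enum])
  then have eq: "frechet_derivative (conj_enum g) (at (to_enum x)) = (\<lambda>v. to_enum (?g' (of_enum v)))"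
    unfolding conj_enum_def[abs_def] by (rule frechet_derivative_at[symmetric])
  have ax: "of_enum (axis j 1) = axis (Rep_enumerated j) 1" for j :: "'k enumerated"
    by (auto simp: of_enum_def axis_def vec_eq_iff Rep_enumerated_inverse Abs_enumerated_inverse)
  have "jac (conj_enum g) (to_enum x) = (\<chi> i j. to_enum (?g' (of_enum (axis j 1))) $ i)"
    by (simp add: matrix_def eq)
  also have "\<dots> = (\<chi> i j. jac g x $ Rep_enumerated i $ Rep_enumerated j)"
    by (simp add: ax matrix_def to_enum_def)
  finally have "jac (conj_enum g) (to_enum x) = (\<chi> i j. jac g x $ Rep_enumerated i $ Rep_enumerated j)" .
  then show ?thesis using det_reindex[OF bij_Rep_enumerated] by simp
qed

lemma regular_degree_sum_conj_enum:
  assumes "C1_map g"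
  shows "regular_degree_sum (conj_enum g) (to_enum ` U) = regular_degree_sum g U"
proof -
  have zeros: "{y \<in> to_enum ` U. conj_enum g y = 0} = to_enum ` {x \<in> U. g x = 0}"
  proof (intro equalityI subsetI)
    fix y assume "y \<in> {y \<in> to_enum ` U. conj_enum g y = 0}"
    then obtain x where "x \<in> U" "y = to_enum x" "conj_enum g y = 0" by blast
    then show "y \<in> to_enum ` {x \<in> U. g x = 0}" by (simp add: conj_enum_def)
  next
    fix y assume "y \<in> to_enum ` {x \<in> U. g x = 0}"
    then obtain x where "x \<in> U" "y = to_enum x" "g x = 0" by blast
    then show "y \<in> {y \<in> to_enum ` U. conj_enum g y = 0}" by (simp add: conj_enum_def)
  qed
  have inj: "inj_on to_enum A" for A :: "(real^'k) set"
    using bij_is_inj[OF bij_to_enum] by (rule inj_on_subset) simp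
  show ?thesis
    unfolding regular_degree_sum_def zeros
    by (subst sum.reindex[OF inj]) (simp add: jac_det_def det_jac_conj_enum[OF assms])
qed

section \<open>A vanishing criterion for the Brouwer degree\<close>

lemma closure_to_enum: "closure (to_enum ` U) = to_enum ` closure U"
  by (rule closure_injective_linear_image[OF linear_to_enum, symmetric]) (rule bij_is_inj[OF bij_to_enum])

lemma open_to_enum: "open U \<Longrightarrow> open (to_enum ` U)"
  by (rule open_surjective_linear_image[OF _ linear_to_enum bij_is_surj[OF bij_to_enum]])

lemma frontier_to_enum: "open U \<Longrightarrow> frontier (to_enum ` U) = to_enum ` frontier U"
  unfolding frontier_def
  by (simp add: interior_open open_to_enum closure_to_enum image_set_diff[OF bij_is_inj[OF bij_to_enum]])

lemma bounded_to_enum: "bounded U \<Longrightarrow> bounded (to_enum ` U)"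
  by (rule bounded_linear_image[OF _ bounded_linear_to_enum])

lemma continuous_on_conj_enum:
  assumes "continuous_on (closure U) F"
  shows "continuous_on (closure (to_enum ` U)) (conj_enum F)"
proof -
  have "continuous_on (to_enum ` closure U) (\<lambda>y. F (of_enum y))"
    by (rule continuous_on_compose2[OF assms linear_continuous_on[OF bounded_linear_of_enum]]) auto
  then show ?thesis
    unfolding conj_enum_def closure_to_enum by (rule bounded_linear.continuous_on[OF bounded_linear_to_enum])
qed

text \<open>The hypothesis on the frontier survives small changes of F, so every regular g close to
  F has zero count 0 and 0 is admissible in the definition. It is the only admissible value because
  a regular g arbitrarily close to F exists.\<close>

lemma brouwer_degree_eq_0:
  fixes F G :: "real^'k \<Rightarrow> real^'k"
  assumes U: "open U" "bounded U"
    and F: "continuous_on (closure U) F" and G: "continuous_on (closure U) G" "\<And>x. x \<in> closure U \<Longrightarrow> G x \<noteq> 0"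
    and close: "\<And>x. x \<in> frontier U \<Longrightarrow> norm (F x - G x) < norm (G x)"
  shows "brouwer_degree F U = 0"
proof -
  let ?P = "\<lambda>d. \<exists>\<delta>>0. \<forall>g. C1_map g \<and> (\<forall>x\<in>U. g x = 0 \<longrightarrow> jac_det g x \<noteq> 0)
       \<and> (\<forall>x\<in>closure U. norm (F x - g x) < \<delta>) \<longrightarrow> regular_degree_sum g U = d"
  have fr: "frontier U \<subseteq> closure U" by (simp add: frontier_def)
  have "compact (frontier U)" using U(2) by (simp add: compact_frontier_bounded)
  moreover have "continuous_on (frontier U) (\<lambda>x. norm (G x) - norm (F x - G x))"
    by (intro continuous_intros continuous_on_subset[OF F fr] continuous_on_subset[OF G(1) fr])
  \<comment> \<open>The slack of the strict inequality on the compact frontier: any g within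
    \<delta> of F inherits the inequality.\<close>
  ultimately obtain \<delta> where \<delta>: "\<delta> > 0" "\<And>x. x \<in> frontier U \<Longrightarrow> \<delta> \<le> norm (G x) - norm (F x - G x)"
    by (rule compact_positive_lower_bound) (use close in auto)
  have count: "regular_degree_sum g U = 0" if g: "C1_map g" "\<And>x. x \<in> U \<Longrightarrow> g x = 0 \<Longrightarrow> jac_det g x \<noteq> 0"
    "\<And>x. x \<in> closure U \<Longrightarrow> norm (F x - g x) < \<delta>" for g
  proof -
    have diff: "norm (conj_enum g (to_enum x) - conj_enum G (to_enum x)) = norm (g x - G x)" for x
      by (simp add: conj_enum_def linear_to_enum flip: linear_diff)
    have "regular_degree_sum (conj_enum g) (to_enum ` U) = 0"
    proof (rule regular_degree_sum_eq_0[where G = "conj_enum G"])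
      fix y assume "y \<in> frontier (to_enum ` U)"
      then obtain x where x: "x \<in> frontier U" "y = to_enum x" by (auto simp: frontier_to_enum U)
      have "norm (g x - G x) \<le> norm (F x - G x) + norm (F x - g x)"
        using norm_triangle_ineq4[of "F x - G x" "F x - g x"] by simp
      then have "norm (g x - G x) < norm (G x)"
        using \<delta>(2)[OF x(1)] g(3)[OF subsetD[OF fr x(1)]] by linarith
      then show "norm (conj_enum g y - conj_enum G y) < norm (conj_enum G y)"
        unfolding x(2) diff by (simp add: conj_enum_def)
    next
      fix y assume y: "y \<in> to_enum ` U" "conj_enum g y = 0"
      then obtain x where x: "x \<in> U" "y = to_enum x" by auto
      have "g x = 0" using y(2) x(2) by (metis conj_enum_def norm_eq_zero norm_to_enum of_to_enum(1))
      then show "det (jac (conj_enum g) y) \<noteq> 0"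
        using g(2)[OF x(1)] by (simp add: x(2) det_jac_conj_enum[OF g(1)] jac_det_def)
    next
      fix y assume "y \<in> closure (to_enum ` U)"
      then obtain x where x: "x \<in> closure U" "y = to_enum x" by (auto simp: closure_to_enum)
      show "conj_enum G y \<noteq> 0"
        using G(2)[OF x(1)] by (metis conj_enum_def norm_eq_zero norm_to_enum of_to_enum(1) x(2))
    qed (rule C1_map_conj_enum g open_to_enum bounded_to_enum continuous_on_conj_enum U G)+
    then show ?thesis by (simp add: regular_degree_sum_conj_enum[OF g(1)])
  qed
  have "?P 0" using \<delta>(1) count by blast
  moreover have "d = 0" if d: "?P d" for d
  proof -
    obtain \<delta>' where \<delta>': "\<delta>' > 0" and d': "\<And>g. C1_map g \<Longrightarrow> (\<And>x. x \<in> U \<Longrightarrow> g x = 0 \<Longrightarrow> jac_det g x \<noteq> 0)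
       \<Longrightarrow> (\<And>x. x \<in> closure U \<Longrightarrow> norm (F x - g x) < \<delta>') \<Longrightarrow> regular_degree_sum g U = d"
      using d by blast
    \<comment> \<open>Closeness below both tolerances makes one and the same map have count d and
      count 0.\<close>
    obtain h where h: "C1_map h" "\<And>y. y \<in> to_enum ` U \<Longrightarrow> h y = 0 \<Longrightarrow> det (jac h y) \<noteq> 0"
      "\<And>y. y \<in> closure (to_enum ` U) \<Longrightarrow> norm (conj_enum F y - h y) < min \<delta> \<delta>'"
      by (rule regular_approximation[OF bounded_to_enum[OF U(2)] continuous_on_conj_enum[OF F], of "min \<delta> \<delta>'"])
        (use \<delta>(1) \<delta>' in simp, rule that)
    define g where "g = conj_of_enum h"
    have g: "C1_map g" "conj_enum g = h"
      unfolding g_def using C1_map_conj_of_enum[OF h(1)] by (simp_all add: conj_enum_of_enum)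
    have near: "norm (F x - g x) < min \<delta> \<delta>'" if x: "x \<in> closure U" for x
    proof -
      have "norm (F x - g x) = norm (to_enum (F x - g x))" by simp
      also have "to_enum (F x - g x) = conj_enum F (to_enum x) - conj_enum g (to_enum x)"
        by (simp add: conj_enum_def linear_diff[OF linear_to_enum])
      also have "norm \<dots> < min \<delta> \<delta>'" unfolding g(2) using x by (intro h(3)) (simp add: closure_to_enum)
      finally show ?thesis .
    qed
    have reg: "jac_det g x \<noteq> 0" if "x \<in> U" "g x = 0" for x
      using h(2)[of "to_enum x"] that det_jac_conj_enum[OF g(1), of x] linear_0[OF linear_to_enum]
      unfolding g(2)[symmetric] by (simp add: conj_enum_def jac_det_def)
    have "regular_degree_sum g U = d" using d'[OF g(1) reg] near by simp
    moreover have "regular_degree_sum g U = 0" using count[OF g(1) reg] near by simp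
    ultimately show "d = 0" by simp
  qed
  ultimately show ?thesis unfolding brouwer_degree_def by (rule the_equality)
qed

section \<open>Ordinary differential equations on a compact interval\<close>

definition solves_on :: "(real \<Rightarrow> 'a::real_normed_vector \<Rightarrow> 'a) \<Rightarrow> (real \<Rightarrow> 'a) \<Rightarrow> real set \<Rightarrow> bool" where
  "solves_on f x S \<longleftrightarrow> (\<forall>t\<in>S. (x has_vector_derivative f t (x t)) (at t within S))"

text \<open>For the squared norm, the bound on u' gives the growth rate 2 L + 1 and the source
  \<open>c\<^sup>2\<close>; the exponential accounts for the rate over a time T, and the factor 1 +
  T for the initial value together with the accumulated source.\<close>

definition gronwall_const :: "real \<Rightarrow> real \<Rightarrow> real" where
  "gronwall_const L T = (1 + T) * exp ((2 * L + 1) * T)"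

lemma gronwall_const_ge_1: "L \<ge> 0 \<Longrightarrow> T \<ge> 0 \<Longrightarrow> gronwall_const L T \<ge> 1"
  unfolding gronwall_const_def using mult_mono[of 1 "1 + T" 1 "exp ((2 * L + 1) * T)"] by simp

lemma gronwall_const_mono:
  "0 \<le> L \<Longrightarrow> 0 \<le> T \<Longrightarrow> T \<le> T' \<Longrightarrow> gronwall_const L T \<le> gronwall_const L T'"
  unfolding gronwall_const_def by (intro mult_mono) (auto intro!: mult_left_mono)

lemma has_vector_derivative_reflect:
  fixes u :: "real \<Rightarrow> 'a::real_normed_vector"
  assumes "(u has_vector_derivative D) (at (a + b - t) within {a..b})"
  shows "((\<lambda>t. u (a + b - t)) has_vector_derivative - D) (at t within {a..b})"
proof -
  have "((\<lambda>t. a + b - t) has_vector_derivative -1) (at t within {a..b})"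
    by (auto intro!: derivative_eq_intros simp: has_vector_derivative_def)
  moreover have "(\<lambda>t. a + b - t) ` {a..b} = {a..b}"
    by (auto simp: image_iff intro!: bexI[of _ "a + b - _"])
  ultimately have "((u \<circ> (\<lambda>t. a + b - t)) has_vector_derivative (-1) *\<^sub>R D) (at t within {a..b})"
    using assms by (intro vector_diff_chain_within) auto
  then show ?thesis by (simp add: o_def)
qed

lemma gronwall_forward:
  fixes u :: "real \<Rightarrow> 'a::euclidean_space"
  assumes u: "\<And>t. t \<in> {a..b} \<Longrightarrow> (u has_vector_derivative u' t) (at t within {a..b})"
    and bound: "\<And>t. t \<in> {a..b} \<Longrightarrow> norm (u' t) \<le> L * norm (u t) + c"
    and L: "L \<ge> 0" and c: "c \<ge> 0" and ab: "a \<le> b"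
  shows "norm (u b) \<le> gronwall_const L (b - a) * (norm (u a) + c)"
proof -
  define K where "K = 2 * L + 1"
  \<comment> \<open>The squared norm is differentiable even where u vanishes. The weight cancels the
    rate K, whose summand 1 comes from splitting 2 |u| c into squares, and the subtracted term
    cancels the source, so the derivative of w is at most 0.\<close>
  define w where "w t = exp (- (K * (t - a))) * (u t \<bullet> u t) - c\<^sup>2 * (t - a)" for t
  define w' where "w' t = exp (- (K * (t - a))) * (2 * (u t \<bullet> u' t) - K * (u t \<bullet> u t)) - c\<^sup>2" for t
  have "(w has_derivative (\<lambda>h. w' t * h)) (at t within {a..b})" if t: "a \<le> t" "t \<le> b" for t
  proof -
    have 1: "(u has_derivative (\<lambda>h. h *\<^sub>R u' t)) (at t within {a..b})"
      using u[of t] t by (simp add: has_vector_derivative_def)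
    have "((\<lambda>t. u t \<bullet> u t) has_derivative (\<lambda>h. u t \<bullet> (h *\<^sub>R u' t) + (h *\<^sub>R u' t) \<bullet> u t)) (at t within {a..b})"
      by (rule has_derivative_inner[OF 1 1])
    then have 2: "((\<lambda>t. u t \<bullet> u t) has_real_derivative 2 * (u t \<bullet> u' t)) (at t within {a..b})"
      unfolding has_field_derivative_def
      by (rule has_derivative_eq_rhs) (auto simp: fun_eq_iff inner_commute)
    have 3: "((\<lambda>t. exp (- (K * (t - a)))) has_real_derivative - K * exp (- (K * (t - a)))) (at t within {a..b})"
      by (auto intro!: derivative_eq_intros)
    have 4: "((\<lambda>t. c\<^sup>2 * (t - a)) has_real_derivative c\<^sup>2) (at t within {a..b})"
      by (auto intro!: derivative_eq_intros)
    have "(w has_real_derivative w' t) (at t within {a..b})"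
      unfolding w_def[abs_def] w'_def
      by (rule DERIV_cong[OF DERIV_diff[OF DERIV_mult[OF 3 2] 4]]) (simp add: algebra_simps)
    then show ?thesis by (simp add: has_field_derivative_def)
  qed
  then obtain t where t: "t \<in> {a..b}" "w b - w a = w' t * (b - a)"
    using mvt_very_simple[OF ab, of w "\<lambda>t h. w' t * h"] by blast
  have "u t \<bullet> u' t \<le> norm (u t) * (L * norm (u t) + c)"
    using norm_cauchy_schwarz[of "u t" "u' t"] mult_left_mono[OF bound[OF t(1)], of "norm (u t)"] by simp
  moreover have "2 * (norm (u t) * c) \<le> (norm (u t))\<^sup>2 + c\<^sup>2"
    using sum_squares_bound[of "norm (u t)" c] by simp
  ultimately have "2 * (u t \<bullet> u' t) - K * (u t \<bullet> u t) \<le> c\<^sup>2"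
    unfolding K_def power2_norm_eq_inner[symmetric] by (simp add: algebra_simps power2_eq_square)
  then have "exp (- (K * (t - a))) * (2 * (u t \<bullet> u' t) - K * (u t \<bullet> u t)) \<le> exp (- (K * (t - a))) * c\<^sup>2"
    by (rule mult_left_mono) simp
  also have "\<dots> \<le> 1 * c\<^sup>2"
    using t(1) L by (intro mult_right_mono) (auto simp: K_def)
  finally have "w' t \<le> 0" by (simp add: w'_def)
  then have "w b \<le> w a" using t(2) ab mult_nonpos_nonneg[of "w' t" "b - a"] by simp
  then have "exp (- (K * (b - a))) * (norm (u b))\<^sup>2 \<le> (norm (u a))\<^sup>2 + c\<^sup>2 * (b - a)"
    by (simp add: w_def power2_norm_eq_inner)
  also have "\<dots> \<le> (1 + (b - a)) * (norm (u a) + c)\<^sup>2"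
  proof -
    have "(norm (u a))\<^sup>2 \<le> (norm (u a) + c)\<^sup>2" "c\<^sup>2 \<le> (norm (u a) + c)\<^sup>2"
      using c by (auto intro!: power_mono)
    then show ?thesis using ab mult_right_mono[of "c\<^sup>2" "(norm (u a) + c)\<^sup>2" "b - a"] by (simp add: algebra_simps)
  qed
  finally have "(norm (u b))\<^sup>2 \<le> (1 + (b - a)) * exp (K * (b - a)) * (norm (u a) + c)\<^sup>2"
    by (simp add: exp_minus divide_simps mult_ac)
  also have "\<dots> = gronwall_const L (b - a) * (norm (u a) + c)\<^sup>2"
    by (simp add: gronwall_const_def K_def)
  \<comment> \<open>The constant is at least 1, hence at most its square; this lets the root be
    taken with the same constant.\<close>
  also have "\<dots> \<le> (gronwall_const L (b - a))\<^sup>2 * (norm (u a) + c)\<^sup>2"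
    using gronwall_const_ge_1[OF L, of "b - a"] ab
    by (intro mult_right_mono) (auto simp: power2_eq_square intro: mult_left_le_imp_le)
  finally have "(norm (u b))\<^sup>2 \<le> (gronwall_const L (b - a) * (norm (u a) + c))\<^sup>2"
    by (simp add: power_mult_distrib)
  then show ?thesis
    by (rule power2_le_imp_le) (use gronwall_const_ge_1[OF L, of "b - a"] ab c in auto)
qed

lemma gronwall:
  fixes u :: "real \<Rightarrow> 'a::euclidean_space"
  assumes u: "\<And>t. t \<in> {a..b} \<Longrightarrow> (u has_vector_derivative u' t) (at t within {a..b})"
    and bound: "\<And>t. t \<in> {a..b} \<Longrightarrow> norm (u' t) \<le> L * norm (u t) + c"
    and L: "L \<ge> 0" and c: "c \<ge> 0" and s: "s \<in> {a..b}" and t: "t \<in> {a..b}"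
  shows "norm (u t) \<le> gronwall_const L (b - a) * (norm (u s) + c)"
proof -
  have le: "gronwall_const L \<bar>t - s\<bar> * (norm (u s) + c) \<le> gronwall_const L (b - a) * (norm (u s) + c)"
    using s t L c by (intro mult_right_mono gronwall_const_mono) auto
  show ?thesis
  proof (cases "s \<le> t")
    case True
    then have sub: "{s..t} \<subseteq> {a..b}" using s t by auto
    have "norm (u t) \<le> gronwall_const L (t - s) * (norm (u s) + c)"
      by (rule gronwall_forward[of s t u u'])
        (use True L c sub bound in \<open>auto intro!: has_vector_derivative_within_subset[OF u sub]\<close>)
    then show ?thesis using le True by simp
  next
    case False
    then have sub: "{t..s} \<subseteq> {a..b}" using s t by auto
    \<comment> \<open>Reflecting time exchanges s and t and reduces the backward estimate to the
      forward one.\<close>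
    define v where "v \<tau> = u (t + s - \<tau>)" for \<tau>
    have "norm (v s) \<le> gronwall_const L (s - t) * (norm (v t) + c)"
    proof (rule gronwall_forward[of t s v "\<lambda>\<tau>. - u' (t + s - \<tau>)"])
      fix \<tau> assume \<tau>: "\<tau> \<in> {t..s}"
      then have \<tau>': "t + s - \<tau> \<in> {t..s}" by auto
      show "(v has_vector_derivative - u' (t + s - \<tau>)) (at \<tau> within {t..s})"
        unfolding v_def
        by (rule has_vector_derivative_reflect has_vector_derivative_within_subset[OF u sub])+
          (use \<tau>' sub in auto)
      show "norm (- u' (t + s - \<tau>)) \<le> L * norm (v \<tau>) + c"
        using bound[of "t + s - \<tau>"] \<tau>' sub by (auto simp: v_def)
    qed (use False L c in auto)
    then show ?thesis using le False by (simp add: v_def)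
  qed
qed

lemma solution_unique:
  fixes x y :: "real \<Rightarrow> 'a::euclidean_space"
  assumes x: "solves_on f x {a..b}" and y: "solves_on f y {a..b}"
    and lip: "\<And>t. t \<in> {a..b} \<Longrightarrow> norm (f t (x t) - f t (y t)) \<le> L * norm (x t - y t)" and L: "L \<ge> 0"
    and s: "s \<in> {a..b}" "x s = y s" and t: "t \<in> {a..b}"
  shows "x t = y t"
proof -
  have "norm (x t - y t) \<le> gronwall_const L (b - a) * (norm (x s - y s) + 0)"
    by (rule gronwall[where u' = "\<lambda>t. f t (x t) - f t (y t)"])
      (use x y lip L s t in \<open>auto simp: solves_on_def intro!: has_vector_derivative_diff\<close>)
  then show ?thesis using s(2) by simp
qed

lemma solves_on_reflect:
  assumes "solves_on f x {a..b}"
  shows "solves_on (\<lambda>t y. - f (a + b - t) y) (\<lambda>t. x (a + b - t)) {a..b}"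
  unfolding solves_on_def
proof
  fix t assume "t \<in> {a..b}"
  then have "a + b - t \<in> {a..b}" by auto
  then show "((\<lambda>t. x (a + b - t)) has_vector_derivative - f (a + b - t) (x (a + b - t))) (at t within {a..b})"
    using assms unfolding solves_on_def by (intro has_vector_derivative_reflect) auto
qed

text \<open>Integrating an exponential of rate K gains a factor 1 / K, which beats the Lipschitz
  constant of the field in the weighted norm.\<close>

lemma integral_exp_bound:
  fixes v :: "real \<Rightarrow> 'a::euclidean_space"
  assumes "continuous_on {a..t} v" "a \<le> t" "K > 0" "\<And>\<tau>. \<tau> \<in> {a..t} \<Longrightarrow> norm (v \<tau>) \<le> M * exp (K * (\<tau> - a))" "M \<ge> 0"
  shows "norm (integral {a..t} v) \<le> M / K * exp (K * (t - a))"
proof -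
  have "((\<lambda>\<tau>. M / K * exp (K * (\<tau> - a))) has_vector_derivative M * exp (K * (\<tau> - a))) (at \<tau> within {a..t})" for \<tau>
    unfolding has_real_derivative_iff_has_vector_derivative[symmetric]
    using assms(3) by (auto intro!: derivative_eq_intros)
  then have I: "((\<lambda>\<tau>. M * exp (K * (\<tau> - a))) has_integral (M / K * exp (K * (t - a)) - M / K * exp (K * (a - a)))) {a..t}"
    by (intro fundamental_theorem_of_calculus assms)
  then have "norm (integral {a..t} v) \<le> integral {a..t} (\<lambda>\<tau>. M * exp (K * (\<tau> - a)))"
    by (intro Henstock_Kurzweil_Integration.integral_norm_bound_integral integrable_continuous_real assms continuous_intros) auto
  also have "\<dots> = M / K * exp (K * (t - a)) - M / K"
    using integral_unique[OF I] by simp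
  also have "\<dots> \<le> M / K * exp (K * (t - a))" using assms by simp
  finally show ?thesis .
qed

text \<open>Picard iteration for \<open>y t = exp (- K * (t - a)) *\<^sub>R x t\<close>, for which the integral operator contracts.\<close>
lemma solution_exists:
  fixes f :: "real \<Rightarrow> 'a::euclidean_space \<Rightarrow> 'a"
  assumes f: "continuous_on UNIV (\<lambda>p. f (fst p) (snd p))"
    and lip: "\<And>t x y. norm (f t x - f t y) \<le> L * norm (x - y)" and L: "L > 0" and ab: "a \<le> b"
  obtains x where "x a = x0" "solves_on f x {a..b}"
proof -
  \<comment> \<open>The contraction factor L / K becomes 1 / 2.\<close>
  define K where "K = 2 * L"
  have K: "K > 0" using L by (simp add: K_def)
  \<comment> \<open>The iterates have to be bounded continuous functions on the whole line; freezing
    time outside [a,b] provides this.\<close>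
  define c where "c t = max a (min b t)" for t
  have c: "continuous_on S c" "c t \<in> {a..b}" "t \<in> {a..b} \<Longrightarrow> c t = t" for t S
    unfolding c_def using ab by (auto intro!: continuous_intros)
  define v where "v y \<tau> = f \<tau> (exp (K * (\<tau> - a)) *\<^sub>R apply_bcontfun y \<tau>)" for y \<tau>
  define Z where "Z y t = x0 + integral {a..t} (v y)" for y t
  have cv: "continuous_on S (v y)" for y S
    unfolding v_def by (rule continuous_on_compose2[OF f, of _ "\<lambda>\<tau>. (\<tau>, exp (K * (\<tau> - a)) *\<^sub>R apply_bcontfun y \<tau>)", simplified])
      (intro continuous_intros continuous_on_apply_bcontfun)
  have Zder: "(Z y has_vector_derivative v y t) (at t within {a..b})" if "t \<in> {a..b}" for y t
    unfolding Z_def using integral_has_vector_derivative[OF cv that, of y]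
    by (auto intro!: derivative_eq_intros)
  have cZ: "continuous_on {a..b} (Z y)" for y
    using Zder has_vector_derivative_continuous continuous_on_eq_continuous_within by blast
  define q where "q y t = exp (- (K * (c t - a))) *\<^sub>R Z y (c t)" for y t
  have q: "q y \<in> bcontfun" for y
  proof -
    have 1: "continuous_on {a..b} (\<lambda>t. exp (- (K * (t - a))) *\<^sub>R Z y t)"
      by (intro continuous_intros cZ)
    have "continuous_on UNIV (q y)"
      unfolding q_def by (rule continuous_on_compose2[OF 1 c(1)]) (use c(2) in auto)
    moreover have "range (q y) \<subseteq> (\<lambda>t. exp (- (K * (t - a))) *\<^sub>R Z y t) ` {a..b}"
      unfolding q_def using c(2) by blast
    then have "bounded (range (q y))"
      using compact_imp_bounded[OF compact_continuous_image[OF 1 compact_Icc]] bounded_subset by blast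
    ultimately show ?thesis by (simp add: bcontfun_def)
  qed
  define Q where "Q y = Bcontfun (q y)" for y
  have Q: "apply_bcontfun (Q y) = q y" for y
    unfolding Q_def by (rule Bcontfun_inverse[OF q])
  have "dist (Q y) (Q z) \<le> 1 / 2 * dist y z" for y z
  proof (rule dist_bound, unfold Q)
    fix t
    have t: "c t \<in> {a..b}" by (rule c)
    have "norm (integral {a..c t} (\<lambda>\<tau>. v y \<tau> - v z \<tau>)) \<le> L * dist y z / K * exp (K * (c t - a))"
    proof (rule integral_exp_bound)
      fix \<tau>
      have "norm (v y \<tau> - v z \<tau>) \<le> L * norm (exp (K * (\<tau> - a)) *\<^sub>R (apply_bcontfun y \<tau> - apply_bcontfun z \<tau>))"
        unfolding v_def using lip by (simp add: scaleR_diff_right)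
      also have "\<dots> = L * dist (apply_bcontfun y \<tau>) (apply_bcontfun z \<tau>) * exp (K * (\<tau> - a))"
        by (simp add: dist_norm)
      also have "\<dots> \<le> L * dist y z * exp (K * (\<tau> - a))"
        using dist_bounded[of y \<tau> z] L by (intro mult_right_mono mult_left_mono) auto
      finally show "norm (v y \<tau> - v z \<tau>) \<le> L * dist y z * exp (K * (\<tau> - a))" .
    qed (use t K L in \<open>auto intro!: continuous_intros cv\<close>)
    moreover have "Z y (c t) - Z z (c t) = integral {a..c t} (\<lambda>\<tau>. v y \<tau> - v z \<tau>)"
      unfolding Z_def by (subst integral_diff) (auto intro!: integrable_continuous_real cv)
    ultimately have Zd: "norm (Z y (c t) - Z z (c t)) \<le> dist y z / 2 * exp (K * (c t - a))"
      using L by (simp add: K_def)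
    have "dist (q y t) (q z t) = exp (- (K * (c t - a))) * norm (Z y (c t) - Z z (c t))"
      unfolding q_def dist_norm by (simp flip: scaleR_diff_right)
    also have "\<dots> \<le> exp (- (K * (c t - a))) * (dist y z / 2 * exp (K * (c t - a)))"
      by (rule mult_left_mono[OF Zd]) simp
    also have "\<dots> = 1 / 2 * dist y z"
      by (simp add: exp_minus)
    finally show "dist (q y t) (q z t) \<le> 1 / 2 * dist y z" .
  qed
  then obtain y where y: "Q y = y"
    using banach_fix_type[of "1 / 2" Q] by auto
  define x where "x t = exp (K * (t - a)) *\<^sub>R apply_bcontfun y t" for t
  have xZ: "x t = Z y t" if t: "t \<in> {a..b}" for t
  proof -
    have "apply_bcontfun y t = exp (- (K * (t - a))) *\<^sub>R Z y t"
      using Q[of y] c(3)[OF t] unfolding y q_def by simp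
    then show ?thesis by (simp add: x_def flip: exp_add)
  qed
  show thesis
  proof
    show "x a = x0" using xZ[of a] ab by (simp add: Z_def)
    show "solves_on f x {a..b}"
      unfolding solves_on_def
    proof
      fix t assume t: "t \<in> {a..b}"
      have "(x has_vector_derivative v y t) (at t within {a..b})"
        using Zder[OF t] by (rule has_vector_derivative_transform[OF t, rotated]) (rule xZ)
      then show "(x has_vector_derivative f t (x t)) (at t within {a..b})"
        by (simp add: v_def x_def)
    qed
  qed
qed

text \<open>The field is cut off by projecting onto a ball, and Gronwall's inequality keeps the solution inside it.\<close>
lemma solution_near_approximate_solution:
  fixes h :: "real \<Rightarrow> 'a::euclidean_space \<Rightarrow> 'a"
  assumes h: "continuous_on UNIV (\<lambda>p. h (fst p) (snd p))"
    and lip: "\<And>t x y. t \<in> {a..b} \<Longrightarrow> x \<in> cball 0 (R + 1) \<Longrightarrow> y \<in> cball 0 (R + 1) \<Longrightarrow> norm (h t x - h t y) \<le> L * norm (x - y)"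
    and L: "L \<ge> 0" and ab: "a \<le> b"
    and p: "\<And>t. t \<in> {a..b} \<Longrightarrow> (p has_vector_derivative p' t) (at t within {a..b})"
    and pR: "\<And>t. t \<in> {a..b} \<Longrightarrow> norm (p t) \<le> R"
    and defect: "\<And>t. t \<in> {a..b} \<Longrightarrow> norm (h t (p t) - p' t) \<le> c"
    and small: "gronwall_const L (b - a) * (norm (x0 - p a) + c) \<le> 1"
  obtains x where "x a = x0" "solves_on h x {a..b}"
    "\<And>t. t \<in> {a..b} \<Longrightarrow> norm (x t - p t) \<le> gronwall_const L (b - a) * (norm (x0 - p a) + c)"
proof -
  let ?B = "cball 0 (R + 1) :: 'a set"
  have R: "R \<ge> 0" using pR[of a] ab order_trans[OF norm_ge_zero] by auto
  have c: "c \<ge> 0" using defect[of a] ab by (meson atLeastAtMost_iff norm_ge_zero order_refl order_trans)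
  have B: "convex ?B" "closed ?B" "?B \<noteq> {}" using R by auto
  \<comment> \<open>The Lipschitz bound is given for times in [a,b] only, whereas the existence
    result wants it at all times.\<close>
  define k where "k t = max a (min b t)" for t
  have k: "k t \<in> {a..b}" "t \<in> {a..b} \<Longrightarrow> k t = t" for t unfolding k_def using ab by auto
  define \<pi> where "\<pi> = closest_point ?B"
  have \<pi>: "\<pi> x \<in> ?B" "x \<in> ?B \<Longrightarrow> \<pi> x = x" "norm (\<pi> x - \<pi> y) \<le> norm (x - y)" for x y
    unfolding \<pi>_def using closest_point_in_set[OF B(2,3), of x] closest_point_self[of x ?B]
      closest_point_lipschitz[OF B, of x y] by (simp_all add: dist_norm)
  define f where "f t x = h (k t) (\<pi> x)" for t x
  have "continuous_on UNIV (\<lambda>p. (k (fst p), \<pi> (snd p)))"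
    unfolding k_def \<pi>_def
    by (intro continuous_intros continuous_on_compose2[OF continuous_on_closest_point[OF B, of UNIV]]) auto
  then have f: "continuous_on UNIV (\<lambda>p. f (fst p) (snd p))"
    unfolding f_def using continuous_on_compose2[OF h, of UNIV "\<lambda>p. (k (fst p), \<pi> (snd p))"] by simp
  have lip_f: "norm (f t x - f t y) \<le> L * norm (x - y)" for t x y
    unfolding f_def using lip[OF k(1) \<pi>(1) \<pi>(1)] mult_left_mono[OF \<pi>(3) L] order_trans by blast
  \<comment> \<open>The existence result asks for a positive constant and L may be 0; the Gronwall
    estimate below keeps L itself.\<close>
  have lip1: "norm (f t x - f t y) \<le> (L + 1) * norm (x - y)" for t x y
    using lip_f[of t x y] norm_ge_zero[of "x - y"] unfolding distrib_right by linarith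
  have "L + 1 > 0" using L by simp
  then obtain x where x: "x a = x0" "solves_on f x {a..b}"
    using solution_exists[OF f lip1 _ ab] by blast
  have near: "norm (x t - p t) \<le> gronwall_const L (b - a) * (norm (x0 - p a) + c)" if t: "t \<in> {a..b}" for t
  proof -
    have "norm (x t - p t) \<le> gronwall_const L (b - a) * (norm (x a - p a) + c)"
    proof (rule gronwall[where u' = "\<lambda>t. f t (x t) - p' t"])
      fix s assume s: "s \<in> {a..b}"
      show "((\<lambda>t. x t - p t) has_vector_derivative f s (x s) - p' s) (at s within {a..b})"
        using x(2) p s unfolding solves_on_def by (intro has_vector_derivative_diff) auto
      have "p s \<in> ?B" using pR[OF s] by simp
      then have "f s (p s) = h s (p s)" by (simp add: f_def k(2)[OF s] \<pi>(2))
      then have "norm (f s (x s) - p' s) \<le> norm (f s (x s) - f s (p s)) + norm (h s (p s) - p' s)"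
        using norm_triangle_ineq[of "f s (x s) - f s (p s)" "h s (p s) - p' s"] by simp
      then show "norm (f s (x s) - p' s) \<le> L * norm (x s - p s) + c"
        using lip_f[of s "x s" "p s"] defect[OF s] by linarith
    qed (use L c ab t in auto)
    then show ?thesis by (simp add: x(1))
  qed
  have "solves_on h x {a..b}"
    unfolding solves_on_def
  proof
    fix t assume t: "t \<in> {a..b}"
    have "norm (x t) \<le> R + 1"
      using near[OF t] small pR[OF t] norm_triangle_sub[of "x t" "p t"] by linarith
    then have "f t (x t) = h t (x t)" by (simp add: f_def k(2)[OF t] \<pi>(2))
    then show "(x has_vector_derivative h t (x t)) (at t within {a..b})"
      using x(2) t unfolding solves_on_def by metis
  qed
  then show thesis using that x(1) near by blast
qed

section \<open>Periodic continuation of solutions\<close>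

lemma has_vector_derivative_within_Un:
  assumes "(f has_vector_derivative D) (at t within S)" "(f has_vector_derivative D) (at t within S')"
  shows "(f has_vector_derivative D) (at t within S \<union> S')"
  using assms by (simp add: has_vector_derivative_def has_derivative_within Lim_within_Un)

lemma periodic_shift_int:
  fixes f :: "real \<Rightarrow> 'b"
  assumes "\<And>t. f (t + T) = f t"
  shows "f (t + of_int n * T) = f t"
proof -
  have *: "f (t + of_nat m * T) = f t" for m t
  proof (induction m)
    case (Suc m)
    have "f (t + of_nat (Suc m) * T) = f ((t + of_nat m * T) + T)" by (simp add: algebra_simps)
    then show ?case using assms Suc by simp
  qed simp
  show ?thesis
  proof (cases "n \<ge> 0")
    case True
    then show ?thesis using *[of t "nat n"] by simp
  next
    case False
    then show ?thesis using *[of "t + of_int n * T" "nat (- n)"] by simp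
  qed
qed

lemma periodic_continuation:
  fixes f :: "real \<Rightarrow> 'a::real_normed_vector \<Rightarrow> 'a"
  assumes T: "T > 0" and per: "\<And>t x. f (t + T) x = f t x"
    and x: "solves_on f x {0..T}" and eq: "x T = x 0"
  obtains X where "\<And>t. (X has_vector_derivative f t (X t)) (at t)" "\<And>t. X (t + T) = X t"
    "\<And>t. t \<in> {0..T} \<Longrightarrow> X t = x t"
proof -
  define X where "X t = x (t - of_int \<lfloor>t / T\<rfloor> * T)" for t
  \<comment> \<open>Valid on closed period intervals: at the right end, where the floor jumps,
    \<open>x T = x 0\<close> makes both formulas agree. This yields one-sided derivatives at both
    ends.\<close>
  have Xn: "X t = x (t - of_int n * T)" if t: "t \<in> {of_int n * T..of_int (n + 1) * T}" for n t
  proof (cases "t = of_int (n + 1) * T")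
    case True
    then have "\<lfloor>t / T\<rfloor> = n + 1" using T by simp
    then have "X t = x 0" by (simp add: X_def True)
    moreover have "t - of_int n * T = T" by (simp add: True algebra_simps)
    ultimately show ?thesis by (simp add: eq)
  next
    case False
    then have "t < of_int (n + 1) * T" using t by simp
    then have "\<lfloor>t / T\<rfloor> = n"
      using t T by (intro floor_unique) (simp_all add: le_divide_eq divide_less_eq)
    then show ?thesis by (simp add: X_def)
  qed
  have der: "(X has_vector_derivative f t (X t)) (at t within {of_int n * T..of_int (n + 1) * T})"
    if t: "t \<in> {of_int n * T..of_int (n + 1) * T}" for n t
  proof -
    let ?S = "{of_int n * T..of_int (n + 1) * T}"
    let ?g = "\<lambda>t. t - of_int n * T"
    have "?g ` ?S \<subseteq> {0..T}" by (auto simp: algebra_simps)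
    moreover have "?g t \<in> {0..T}" using t by (auto simp: algebra_simps)
    ultimately have "(x has_vector_derivative f (?g t) (x (?g t))) (at (?g t) within ?g ` ?S)"
      using x unfolding solves_on_def by (blast intro: has_vector_derivative_within_subset)
    moreover have "(?g has_vector_derivative 1) (at t within ?S)"
      by (auto intro!: derivative_eq_intros simp: has_vector_derivative_def)
    ultimately have "((x \<circ> ?g) has_vector_derivative 1 *\<^sub>R f (?g t) (x (?g t))) (at t within ?S)"
      by (rule vector_diff_chain_within[rotated])
    moreover have "f (?g t) y = f t y" for y
      using periodic_shift_int[of "\<lambda>t. f t y" T "t" "- n"] per by simp
    ultimately have "((x \<circ> ?g) has_vector_derivative f t (X t)) (at t within ?S)"
      using Xn[OF t] by simp
    then show ?thesis
      by (rule has_vector_derivative_transform[OF t, rotated]) (simp add: Xn)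
  qed
  show thesis
  proof
    fix t
    define n where "n = \<lfloor>t / T\<rfloor>"
    have "of_int n \<le> t / T" "t / T < of_int (n + 1)" unfolding n_def by linarith+
    then have n: "of_int n * T \<le> t" "t < of_int (n + 1) * T"
      by (simp_all only: pos_le_divide_eq[OF T] pos_divide_less_eq[OF T])
    show "(X has_vector_derivative f t (X t)) (at t)"
    proof (cases "t = of_int n * T")
      case False
      then have int: "t \<in> interior {of_int n * T..of_int (n + 1) * T}"
        unfolding interior_atLeastAtMost_real using n by simp
      have "(X has_vector_derivative f t (X t)) (at t within {of_int n * T..of_int (n + 1) * T})"
        using n by (intro der) simp
      then show ?thesis unfolding at_within_interior[OF int] .
    next
      \<comment> \<open>At a multiple of T the left and right period intervals give one-sided
        derivatives of equal value, and their union is a neighbourhood of t.\<close>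
      case True
      have lt: "of_int (n - 1) * T < t" unfolding True by (rule mult_strict_right_mono) (use T in auto)
      then have "(X has_vector_derivative f t (X t)) (at t within {of_int (n - 1) * T..of_int n * T})"
        using der[of t "n - 1"] True by simp
      moreover have "(X has_vector_derivative f t (X t)) (at t within {of_int n * T..of_int (n + 1) * T})"
        using n by (intro der) simp
      ultimately have D: "(X has_vector_derivative f t (X t))
          (at t within {of_int (n - 1) * T..of_int n * T} \<union> {of_int n * T..of_int (n + 1) * T})"
        by (rule has_vector_derivative_within_Un)
      have int: "t \<in> interior {of_int (n - 1) * T..of_int (n + 1) * T}"
        unfolding interior_atLeastAtMost_real using lt n(2) by simp
      have "{of_int (n - 1) * T..of_int n * T} \<union> {of_int n * T..of_int (n + 1) * T}
          = {of_int (n - 1) * T..of_int (n + 1) * T}"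
        using lt n(2) True by (intro ivl_disj_un_two_touch) linarith+
      then show ?thesis using D unfolding at_within_interior[OF int, symmetric] by simp
    qed
    have "(t + T) / T = t / T + 1" using T by (simp add: field_simps)
    then have "\<lfloor>(t + T) / T\<rfloor> = \<lfloor>t / T\<rfloor> + 1" by simp
    then show "X (t + T) = X t" by (simp add: X_def algebra_simps)
  next
    show "X t = x t" if "t \<in> {0..T}" for t using Xn[of t 0] that by simp
  qed
qed

section \<open>The unperturbed flow\<close>

lemma C1_map_lipschitz_snd:
  fixes f :: "real \<Rightarrow> 'a::euclidean_space \<Rightarrow> 'b::real_normed_vector"
  assumes "C1_map (\<lambda>z. f (fst z) (snd z))"
  obtains L where "L \<ge> 0" "\<And>t x y. t \<in> {0..T} \<Longrightarrow> x \<in> cball 0 R \<Longrightarrow> y \<in> cball 0 R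
      \<Longrightarrow> norm (f t x - f t y) \<le> L * norm (x - y)"
proof -
  obtain L where L: "L \<ge> 0" "\<And>p q. p \<in> cball 0 (T + R) \<Longrightarrow> q \<in> cball 0 (T + R)
      \<Longrightarrow> norm (f (fst p) (snd p) - f (fst q) (snd q)) \<le> L * norm (p - q)"
    using C1_map_lipschitz_on_cball[OF assms] by blast
  have mem: "(t, x) \<in> cball 0 (T + R)" if "t \<in> {0..T}" "x \<in> cball 0 R" for t and x :: 'a
    using that norm_Pair_le[of t x] by simp
  show thesis
  proof
    show "norm (f t x - f t y) \<le> L * norm (x - y)" if "t \<in> {0..T}" "x \<in> cball 0 R" "y \<in> cball 0 R" for t x y
      using L(2)[OF mem[OF that(1,2)] mem[OF that(1,3)]] by (simp add: norm_Pair)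
  qed (rule L)
qed

text \<open>Restricting the total derivative to vectors (0, v) gives the spatial derivative together
  with its joint continuity in t and x.\<close>

lemma C1_map_partial_derivative:
  fixes f :: "real \<Rightarrow> 'a::euclidean_space \<Rightarrow> 'b::real_normed_vector"
  assumes "C1_map (\<lambda>z. f (fst z) (snd z))"
  obtains A where "continuous_on UNIV A" "\<And>t x. (f t has_derivative blinfun_apply (A (t, x))) (at x)"
proof -
  obtain f' where f': "\<And>z. ((\<lambda>z. f (fst z) (snd z)) has_derivative blinfun_apply (f' z)) (at z)" "continuous_on UNIV f'"
    using assms unfolding C1_map_def by blast
  have inj: "bounded_linear (\<lambda>v::'a. (0::real, v))"
    by (intro bounded_linear_Pair bounded_linear_zero bounded_linear_ident)
  define A where "A z = f' z o\<^sub>L Blinfun (\<lambda>v. (0, v))" for z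
  show thesis
  proof
    show "continuous_on UNIV A"
      unfolding A_def by (intro continuous_intros f'(2))
    fix t :: real and x :: 'a
    have "((\<lambda>x. (t, x)) has_derivative (\<lambda>v. (0, v))) (at x)"
      by (auto intro!: derivative_eq_intros)
    from has_derivative_compose[OF this f'(1)[of "(t, x)"]]
    have "(f t has_derivative (\<lambda>v. f' (t, x) (0, v))) (at x)" by simp
    moreover have "blinfun_apply (A (t, x)) = (\<lambda>v. f' (t, x) (0, v))"
      by (rule ext) (simp add: A_def bounded_linear_Blinfun_apply[OF inj])
    ultimately show "(f t has_derivative blinfun_apply (A (t, x))) (at x)" by simp
  qed
qed

locale perturbed_flow =
  fixes \<phi> \<psi> :: "real \<Rightarrow> 'a::euclidean_space \<Rightarrow> 'a" and T :: real and \<Omega> :: "real \<Rightarrow> real \<Rightarrow> 'a \<Rightarrow> 'a"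
  assumes T_pos: "T > 0"
    and phi_C1: "C1_map (\<lambda>z. \<phi> (fst z) (snd z))"
    and psi_C1: "C1_map (\<lambda>z. \<psi> (fst z) (snd z))"
    and Omega_init [simp]: "\<Omega> s s \<xi> = \<xi>"
    and Omega_deriv: "((\<lambda>t. \<Omega> t s \<xi>) has_vector_derivative \<psi> t (\<Omega> t s \<xi>)) (at t)"
begin

lemma Omega_solves: "solves_on \<psi> (\<lambda>t. \<Omega> t s \<xi>) S"
  unfolding solves_on_def by (intro ballI has_vector_derivative_at_within[OF Omega_deriv])

lemma continuous_on_Omega: "continuous_on S (\<lambda>t. \<Omega> t s \<xi>)"
  by (rule continuous_at_imp_continuous_on) (rule ballI, rule has_vector_derivative_continuous[OF Omega_deriv])

lemma solution_bounded:
  assumes "solves_on f (x :: real \<Rightarrow> 'a) {a..b}"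
  obtains R where "\<And>t. t \<in> {a..b} \<Longrightarrow> norm (x t) \<le> R"
proof -
  have "continuous_on {a..b} x"
    using assms has_vector_derivative_continuous unfolding solves_on_def continuous_on_eq_continuous_within by blast
  then have "bounded (x ` {a..b})" by (intro compact_imp_bounded compact_continuous_image compact_Icc)
  then show thesis using that unfolding bounded_iff by blast
qed

text \<open>Both solutions are bounded on the compact interval, so one ball supplies the Lipschitz
  constant for \<psi>, which is only locally Lipschitz.\<close>

lemma flow_unique:
  assumes x: "solves_on \<psi> x {a..b}" and y: "solves_on \<psi> y {a..b}" and ab: "{a..b} \<subseteq> {0..T}"
    and s: "s \<in> {a..b}" "x s = y s" and t: "t \<in> {a..b}"
  shows "x t = y t"
proof -
  obtain R1 where R1: "\<And>t. t \<in> {a..b} \<Longrightarrow> norm (x t) \<le> R1" using solution_bounded[OF x] by blast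
  obtain R2 where R2: "\<And>t. t \<in> {a..b} \<Longrightarrow> norm (y t) \<le> R2" using solution_bounded[OF y] by blast
  obtain L where L: "L \<ge> 0" "\<And>t x y. t \<in> {0..T} \<Longrightarrow> x \<in> cball 0 (max R1 R2) \<Longrightarrow> y \<in> cball 0 (max R1 R2)
      \<Longrightarrow> norm (\<psi> t x - \<psi> t y) \<le> L * norm (x - y)"
    using C1_map_lipschitz_snd[OF psi_C1] by blast
  show ?thesis
  proof (rule solution_unique[OF x y _ L(1) s t])
    show "norm (\<psi> t (x t) - \<psi> t (y t)) \<le> L * norm (x t - y t)" if t: "t \<in> {a..b}" for t
      using R1[OF t] R2[OF t] t ab by (intro L(2)) auto
  qed
qed

lemma Omega_cocycle:
  assumes "s \<in> {0..T}" "r \<in> {0..T}" "t \<in> {0..T}"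
  shows "\<Omega> t s (\<Omega> s r \<xi>) = \<Omega> t r \<xi>"
  by (rule flow_unique[OF Omega_solves Omega_solves order_refl assms(1) Omega_init assms(3)])

text \<open>No ball is known beforehand to contain the orbits of nearby \<xi>. The orbit of \<xi>0
  is therefore used as an approximate solution without defect: the solution constructed near it has
  the desired estimate and is the orbit of \<xi> by uniqueness.\<close>

lemma Omega_lipschitz_at:
  obtains C \<delta> where "C \<ge> 0" "\<delta> > 0"
    "\<And>\<xi> t. norm (\<xi> - \<xi>0) < \<delta> \<Longrightarrow> t \<in> {0..T} \<Longrightarrow> norm (\<Omega> t 0 \<xi> - \<Omega> t 0 \<xi>0) \<le> C * norm (\<xi> - \<xi>0)"
proof -
  obtain R where R: "\<And>t. t \<in> {0..T} \<Longrightarrow> norm (\<Omega> t 0 \<xi>0) \<le> R"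
    using solution_bounded[OF Omega_solves] by blast
  obtain L where L: "L \<ge> 0" "\<And>t x y. t \<in> {0..T} \<Longrightarrow> x \<in> cball 0 (R + 1) \<Longrightarrow> y \<in> cball 0 (R + 1)
      \<Longrightarrow> norm (\<psi> t x - \<psi> t y) \<le> L * norm (x - y)"
    using C1_map_lipschitz_snd[OF psi_C1] by blast
  define C where "C = gronwall_const L (T - 0)"
  have C: "C \<ge> 1" unfolding C_def using L(1) T_pos by (intro gronwall_const_ge_1) auto
  show thesis
  proof
    show "norm (\<Omega> t 0 \<xi> - \<Omega> t 0 \<xi>0) \<le> C * norm (\<xi> - \<xi>0)" if \<xi>: "norm (\<xi> - \<xi>0) < 1 / C" and t: "t \<in> {0..T}" for \<xi> t
    proof -
      have small: "gronwall_const L (T - 0) * (norm (\<xi> - \<Omega> 0 0 \<xi>0) + 0) \<le> 1"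
      proof -
        have "C * norm (\<xi> - \<xi>0) < 1" using \<xi> C by (simp add: field_simps)
        then show ?thesis unfolding C_def by simp
      qed
      obtain x where x: "x 0 = \<xi>" "solves_on \<psi> x {0..T}"
          "\<And>t. t \<in> {0..T} \<Longrightarrow> norm (x t - \<Omega> t 0 \<xi>0) \<le> gronwall_const L (T - 0) * (norm (\<xi> - \<Omega> 0 0 \<xi>0) + 0)"
      proof (rule solution_near_approximate_solution[OF C1_map_continuous[OF psi_C1], of 0 T R L
            "\<lambda>t. \<Omega> t 0 \<xi>0" "\<lambda>t. \<psi> t (\<Omega> t 0 \<xi>0)" 0 \<xi>])
        show "((\<lambda>t. \<Omega> t 0 \<xi>0) has_vector_derivative \<psi> s (\<Omega> s 0 \<xi>0)) (at s within {0..T})" for s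
          by (rule has_vector_derivative_at_within[OF Omega_deriv])
      qed (use L R T_pos small that in auto)
      have "x t = \<Omega> t 0 \<xi>"
        by (rule flow_unique[OF x(2) Omega_solves order_refl _ _ t, of 0]) (use x(1) T_pos in auto)
      then show ?thesis using x(3)[OF t] by (simp add: C_def)
    qed
  qed (use C in auto)
qed

text \<open>The increment is split at the orbit of \<xi>0, into a part Lipschitz in \<xi> uniformly
  in t and a part continuous in t.\<close>

lemma continuous_on_Omega_pair: "continuous_on ({0..T} \<times> UNIV) (\<lambda>p. \<Omega> (fst p) 0 (snd p))"
  unfolding continuous_on_def
proof
  fix p0 assume p0: "p0 \<in> {0..T} \<times> (UNIV :: 'a set)"
  obtain t0 \<xi>0 where p0_eq: "p0 = (t0, \<xi>0)" by (cases p0)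
  obtain C \<delta> where C: "C \<ge> 0" "\<delta> > 0"
    "\<And>\<xi> t. norm (\<xi> - \<xi>0) < \<delta> \<Longrightarrow> t \<in> {0..T} \<Longrightarrow> norm (\<Omega> t 0 \<xi> - \<Omega> t 0 \<xi>0) \<le> C * norm (\<xi> - \<xi>0)"
    using Omega_lipschitz_at[of \<xi>0] by blast
  let ?F = "at p0 within {0..T} \<times> UNIV"
  have fst: "((\<lambda>p. fst p) \<longlongrightarrow> t0) ?F" and snd: "((\<lambda>p. snd p) \<longlongrightarrow> \<xi>0) ?F"
    unfolding p0_eq by (auto intro!: tendsto_eq_intros)
  have "((\<lambda>t. \<Omega> t 0 \<xi>0) \<longlongrightarrow> \<Omega> t0 0 \<xi>0) (at t0)"
    using has_vector_derivative_continuous[OF Omega_deriv] by (simp add: continuous_at)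
  then have A: "((\<lambda>p. \<Omega> (fst p) 0 \<xi>0) \<longlongrightarrow> \<Omega> t0 0 \<xi>0) ?F"
    by (rule tendsto_compose[OF _ fst, unfolded])
  have "((\<lambda>p. \<Omega> (fst p) 0 (snd p) - \<Omega> (fst p) 0 \<xi>0) \<longlongrightarrow> 0) ?F"
  proof (rule Lim_null_comparison)
    show "((\<lambda>p. C * norm (snd p - \<xi>0)) \<longlongrightarrow> 0) ?F"
      by (rule tendsto_eq_intros snd refl | simp)+
    have "\<forall>\<^sub>F p in ?F. norm (snd p - \<xi>0) < \<delta>"
      using tendstoD[OF snd C(2)] by (simp add: dist_norm)
    moreover have "\<forall>\<^sub>F p in ?F. p \<in> {0..T} \<times> UNIV" by (simp add: eventually_at_filter)
    ultimately show "\<forall>\<^sub>F p in ?F. norm (\<Omega> (fst p) 0 (snd p) - \<Omega> (fst p) 0 \<xi>0) \<le> C * norm (snd p - \<xi>0)"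
      by eventually_elim (auto intro!: C(3))
  qed
  from tendsto_add[OF this A]
  show "((\<lambda>p. \<Omega> (fst p) 0 (snd p)) \<longlongrightarrow> \<Omega> (fst p0) 0 (snd p0)) ?F" by (simp add: p0_eq)
qed

text \<open>Backwards in time, the solution from y at time t stays near the orbit through y0 at time
  s. C depends on s and y0 but not on t, as required when the starting time moves.\<close>

lemma Omega_backward_lipschitz:
  obtains C where "C \<ge> 1" "\<And>t y. t \<in> {0..T} \<Longrightarrow> C * norm (y - \<Omega> t s y0) \<le> 1
      \<Longrightarrow> norm (\<Omega> 0 t y - \<Omega> 0 s y0) \<le> C * norm (y - \<Omega> t s y0)"
proof -
  let ?q = "\<lambda>t. \<Omega> t s y0"
  obtain R where R: "\<And>t. t \<in> {0..T} \<Longrightarrow> norm (?q t) \<le> R"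
    using solution_bounded[OF Omega_solves] by blast
  obtain L where L: "L \<ge> 0" "\<And>t x y. t \<in> {0..T} \<Longrightarrow> x \<in> cball 0 (R + 1) \<Longrightarrow> y \<in> cball 0 (R + 1)
      \<Longrightarrow> norm (\<psi> t x - \<psi> t y) \<le> L * norm (x - y)"
    using C1_map_lipschitz_snd[OF psi_C1] by blast
  define C where "C = gronwall_const L T"
  have C: "C \<ge> 1" unfolding C_def using L(1) T_pos by (intro gronwall_const_ge_1) auto
  show thesis
  proof
    show "norm (\<Omega> 0 t y - ?q 0) \<le> C * norm (y - ?q t)" if t: "t \<in> {0..T}" and y: "C * norm (y - ?q t) \<le> 1" for t y
    proof -
      \<comment> \<open>The time-reversed field on [0,t], for which the initial time 0 corresponds
        to the original time t.\<close>
      define h where "h \<tau> x = - \<psi> (0 + t - \<tau>) x" for \<tau> x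
      have Ct: "gronwall_const L (t - 0) * (norm (y - ?q (0 + t - 0)) + 0) \<le> C * norm (y - ?q t)"
        unfolding C_def using t L(1) by (auto intro!: mult_right_mono gronwall_const_mono)
      have "continuous_on UNIV (\<lambda>p. (\<lambda>z. \<psi> (fst z) (snd z)) (0 + t - fst p, snd p :: 'a))"
        by (rule continuous_on_compose2[OF C1_map_continuous[OF psi_C1, of UNIV]]) (intro continuous_intros, simp)
      then have cont: "continuous_on UNIV (\<lambda>p. h (fst p) (snd p))"
        unfolding h_def by (intro continuous_intros) simp
      have reflected: "solves_on h (\<lambda>\<tau>. ?q (0 + t - \<tau>)) {0..t}"
        unfolding h_def by (rule solves_on_reflect[OF Omega_solves])
      obtain z where z: "z 0 = y" "solves_on h z {0..t}"
          "\<And>\<tau>. \<tau> \<in> {0..t} \<Longrightarrow> norm (z \<tau> - ?q (0 + t - \<tau>)) \<le> gronwall_const L (t - 0) * (norm (y - ?q (0 + t - 0)) + 0)"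
      proof (rule solution_near_approximate_solution[OF cont, of 0 t R L "\<lambda>\<tau>. ?q (0 + t - \<tau>)"
            "\<lambda>\<tau>. h \<tau> (?q (0 + t - \<tau>))" 0 y])
        fix \<tau> and x x' :: 'a assume \<tau>: "\<tau> \<in> {0..t}" and x: "x \<in> cball 0 (R + 1)" "x' \<in> cball 0 (R + 1)"
        have "t - \<tau> \<in> {0..T}" using \<tau> t by auto
        then show "norm (h \<tau> x - h \<tau> x') \<le> L * norm (x - x')"
          using L(2)[OF _ x, of "t - \<tau>"] by (simp add: h_def norm_minus_commute)
      next
        fix \<tau> assume \<tau>: "\<tau> \<in> {0..t}"
        show "((\<lambda>\<tau>. ?q (0 + t - \<tau>)) has_vector_derivative h \<tau> (?q (0 + t - \<tau>))) (at \<tau> within {0..t})"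
          using reflected \<tau> unfolding solves_on_def by blast
        show "norm (?q (0 + t - \<tau>)) \<le> R" using \<tau> t by (intro R) auto
      qed (use L t Ct y that in auto)
      have "solves_on \<psi> (\<lambda>\<tau>. z (0 + t - \<tau>)) {0..t}"
        using solves_on_reflect[OF z(2)] by (simp add: h_def)
      then have "z (0 + t - 0) = \<Omega> 0 t y"
        by (rule flow_unique[OF _ Omega_solves, of _ 0 t t]) (use t z(1) in auto)
      then show ?thesis using z(3)[of t] Ct t by simp
    qed
  qed (rule C)
qed

text \<open>Near s the curve x is close to the unperturbed orbit through x s, and that whole orbit
  is pulled back to the single point \<open>\<Omega> 0 s (x s)\<close>.\<close>

lemma continuous_on_pullback:
  assumes x: "continuous_on {0..T} x"
  shows "continuous_on {0..T} (\<lambda>t. \<Omega> 0 t (x t))"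
  unfolding continuous_on_def
proof
  fix s assume s: "s \<in> {0..T}"
  obtain C where C: "C \<ge> 1" "\<And>t y. t \<in> {0..T} \<Longrightarrow> C * norm (y - \<Omega> t s (x s)) \<le> 1
      \<Longrightarrow> norm (\<Omega> 0 t y - \<Omega> 0 s (x s)) \<le> C * norm (y - \<Omega> t s (x s))"
    using Omega_backward_lipschitz by blast
  let ?F = "at s within {0..T}"
  have "(x \<longlongrightarrow> x s) ?F" using x s by (simp add: continuous_on_def)
  moreover have "((\<lambda>t. \<Omega> t s (x s)) \<longlongrightarrow> \<Omega> s s (x s)) ?F"
    using continuous_on_Omega[of "{0..T}"] s unfolding continuous_on_def by blast
  ultimately have "((\<lambda>t. x t - \<Omega> t s (x s)) \<longlongrightarrow> x s - \<Omega> s s (x s)) ?F" by (rule tendsto_diff)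
  then have lim: "((\<lambda>t. C * norm (x t - \<Omega> t s (x s))) \<longlongrightarrow> 0) ?F"
    using tendsto_mult_right_zero tendsto_norm_zero by fastforce
  have "((\<lambda>t. \<Omega> 0 t (x t) - \<Omega> 0 s (x s)) \<longlongrightarrow> 0) ?F"
  proof (rule Lim_null_comparison[OF _ lim])
    have "\<forall>\<^sub>F t in ?F. C * norm (x t - \<Omega> t s (x s)) < 1" by (rule order_tendstoD(2)[OF lim]) simp
    moreover have "\<forall>\<^sub>F t in ?F. t \<in> {0..T}" by (simp add: eventually_at_filter)
    ultimately show "\<forall>\<^sub>F t in ?F. norm (\<Omega> 0 t (x t) - \<Omega> 0 s (x s)) \<le> C * norm (x t - \<Omega> t s (x s))"
      by eventually_elim (intro C(2), auto)
  qed
  then show "((\<lambda>t. \<Omega> 0 t (x t)) \<longlongrightarrow> \<Omega> 0 s (x s)) ?F" by (simp add: LIM_zero_iff)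
qed

end

section \<open>First-order expansion in the perturbation parameter\<close>

text \<open>\<open>R\<close> bounds the unperturbed orbits starting in \<open>S\<close>, and \<open>L\<close> and \<open>M\<close> are the bounds for the fields
  on the ball of radius \<open>R + 1\<close> that contains the orbits of the perturbed system.\<close>
locale perturbed_tube = perturbed_flow \<phi> \<psi> T \<Omega>
  for \<phi> \<psi> :: "real \<Rightarrow> 'a::euclidean_space \<Rightarrow> 'a" and T :: real and \<Omega> +
  fixes \<eta> :: "real \<Rightarrow> real \<Rightarrow> 'a \<Rightarrow> 'a" and A :: "real \<times> 'a \<Rightarrow> 'a \<Rightarrow>\<^sub>L 'a" and S :: "'a set" and R L M :: real
  assumes A_cont: "continuous_on UNIV A"
    and A_deriv: "(\<psi> t has_derivative blinfun_apply (A (t, x))) (at x)"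
    and eta_init [simp]: "\<eta> s s \<xi> = 0"
    and eta_deriv: "((\<lambda>t. \<eta> t s \<xi>) has_vector_derivative
          \<phi> t (\<Omega> t 0 \<xi>) + blinfun_apply (A (t, \<Omega> t 0 \<xi>)) (\<eta> t s \<xi>)) (at t)"
    and tube: "\<xi> \<in> S \<Longrightarrow> t \<in> {0..T} \<Longrightarrow> norm (\<Omega> t 0 \<xi>) \<le> R"
    and L_ge_1: "L \<ge> 1" and M_ge_1: "M \<ge> 1"
    and lip_phi: "t \<in> {0..T} \<Longrightarrow> x \<in> cball 0 (R + 1) \<Longrightarrow> y \<in> cball 0 (R + 1) \<Longrightarrow> norm (\<phi> t x - \<phi> t y) \<le> L * norm (x - y)"
    and lip_psi: "t \<in> {0..T} \<Longrightarrow> x \<in> cball 0 (R + 1) \<Longrightarrow> y \<in> cball 0 (R + 1) \<Longrightarrow> norm (\<psi> t x - \<psi> t y) \<le> L * norm (x - y)"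
    and A_bound: "t \<in> {0..T} \<Longrightarrow> x \<in> cball 0 (R + 1) \<Longrightarrow> norm (A (t, x)) \<le> L"
    and phi_bound: "t \<in> {0..T} \<Longrightarrow> x \<in> cball 0 (R + 1) \<Longrightarrow> norm (\<phi> t x) \<le> M"
begin

text \<open>Built on 2 L because \<phi> and \<psi> each contribute L to the Lipschitz constant of
  \<open>field \<epsilon>\<close> for \<epsilon> in [0,1].\<close>

definition C :: real where "C = gronwall_const (2 * L) T"

lemma C_ge_1: "C \<ge> 1"
  unfolding C_def using L_ge_1 T_pos by (intro gronwall_const_ge_1) auto

lemma tube_gronwall:
  fixes u :: "real \<Rightarrow> 'a"
  assumes "\<And>t. t \<in> {0..T} \<Longrightarrow> (u has_vector_derivative u' t) (at t within {0..T})"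
    and "\<And>t. t \<in> {0..T} \<Longrightarrow> norm (u' t) \<le> 2 * L * norm (u t) + c"
    and "c \<ge> 0" "s \<in> {0..T}" "t \<in> {0..T}"
  shows "norm (u t) \<le> C * (norm (u s) + c)"
  using gronwall[OF assms(1,2) _ assms(3-5)] L_ge_1 by (simp add: C_def)

definition field :: "real \<Rightarrow> real \<Rightarrow> 'a \<Rightarrow> 'a" where
  "field \<epsilon> t x = \<epsilon> *\<^sub>R \<phi> t x + \<psi> t x"

lemma lip_field:
  assumes \<epsilon>: "0 \<le> \<epsilon>" "\<epsilon> \<le> 1" and t: "t \<in> {0..T}" and x: "x \<in> cball 0 (R + 1)" and y: "y \<in> cball 0 (R + 1)"
  shows "norm (field \<epsilon> t x - field \<epsilon> t y) \<le> 2 * L * norm (x - y)"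
proof -
  have "field \<epsilon> t x - field \<epsilon> t y = \<epsilon> *\<^sub>R (\<phi> t x - \<phi> t y) + (\<psi> t x - \<psi> t y)"
    by (simp add: field_def algebra_simps)
  then have "norm (field \<epsilon> t x - field \<epsilon> t y) \<le> \<epsilon> * norm (\<phi> t x - \<phi> t y) + norm (\<psi> t x - \<psi> t y)"
    using norm_triangle_ineq[of "\<epsilon> *\<^sub>R (\<phi> t x - \<phi> t y)" "\<psi> t x - \<psi> t y"] \<epsilon>(1) by simp
  moreover have "\<epsilon> * norm (\<phi> t x - \<phi> t y) \<le> 1 * norm (\<phi> t x - \<phi> t y)"
    using \<epsilon>(2) by (rule mult_right_mono) simp
  ultimately show ?thesis using lip_phi[OF t x y] lip_psi[OF t x y] by simp
qed

lemma Omega_in_ball: "\<xi> \<in> S \<Longrightarrow> t \<in> {0..T} \<Longrightarrow> \<Omega> t 0 \<xi> \<in> cball 0 (R + 1)"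
  using tube by fastforce

text \<open>The unperturbed orbit solves the perturbed equation up to a defect \<epsilon> M, and the
  smallness condition keeps the true solution within distance 1 of it.\<close>

lemma perturbed_solution:
  assumes \<epsilon>: "0 \<le> \<epsilon>" "\<epsilon> \<le> 1" "C * (\<epsilon> * M) \<le> 1" and \<xi>: "\<xi> \<in> S"
  obtains x where "x 0 = \<xi>" "solves_on (field \<epsilon>) x {0..T}" "\<And>t. t \<in> {0..T} \<Longrightarrow> x t \<in> cball 0 (R + 1)"
proof -
  have cont: "continuous_on UNIV (\<lambda>p. field \<epsilon> (fst p) (snd p))"
    unfolding field_def by (intro continuous_intros C1_map_continuous phi_C1 psi_C1)
  have small: "gronwall_const (2 * L) (T - 0) * (norm (\<xi> - \<Omega> 0 0 \<xi>) + \<epsilon> * M) \<le> 1"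
    using \<epsilon>(3) by (simp add: C_def)
  obtain x where x: "x 0 = \<xi>" "solves_on (field \<epsilon>) x {0..T}"
    "\<And>t. t \<in> {0..T} \<Longrightarrow> norm (x t - \<Omega> t 0 \<xi>) \<le> gronwall_const (2 * L) (T - 0) * (norm (\<xi> - \<Omega> 0 0 \<xi>) + \<epsilon> * M)"
  proof (rule solution_near_approximate_solution[OF cont, of 0 T R "2 * L" "\<lambda>t. \<Omega> t 0 \<xi>" "\<lambda>t. \<psi> t (\<Omega> t 0 \<xi>)" "\<epsilon> * M" \<xi>])
    show "((\<lambda>t. \<Omega> t 0 \<xi>) has_vector_derivative \<psi> s (\<Omega> s 0 \<xi>)) (at s within {0..T})" for s
      by (rule has_vector_derivative_at_within[OF Omega_deriv])
    show "norm (field \<epsilon> t (\<Omega> t 0 \<xi>) - \<psi> t (\<Omega> t 0 \<xi>)) \<le> \<epsilon> * M" if "t \<in> {0..T}" for t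
      using phi_bound[OF that Omega_in_ball[OF \<xi> that]] \<epsilon>(1) by (simp add: field_def mult_left_mono)
  qed (use L_ge_1 T_pos lip_field[OF \<epsilon>(1,2)] tube[OF \<xi>] small that in auto)
  show thesis
  proof (rule that[OF x(1,2)])
    fix t assume t: "t \<in> {0..T}"
    have "norm (x t - \<Omega> t 0 \<xi>) \<le> 1" using x(3)[OF t] small by linarith
    then show "x t \<in> cball 0 (R + 1)"
      using tube[OF \<xi> t] norm_triangle_sub[of "x t" "\<Omega> t 0 \<xi>"] by simp
  qed
qed

text \<open>Yields the continuity of the displacement over one period, and at \<epsilon> = 0 a
  Lipschitz bound for the unperturbed orbits.\<close>

lemma perturbed_solution_lipschitz:
  assumes \<epsilon>: "0 \<le> \<epsilon>" "\<epsilon> \<le> 1"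
    and x: "solves_on (field \<epsilon>) x {0..T}" "\<And>t. t \<in> {0..T} \<Longrightarrow> x t \<in> cball 0 (R + 1)"
    and y: "solves_on (field \<epsilon>) y {0..T}" "\<And>t. t \<in> {0..T} \<Longrightarrow> y t \<in> cball 0 (R + 1)"
    and s: "s \<in> {0..T}" and t: "t \<in> {0..T}"
  shows "norm (x t - y t) \<le> C * norm (x s - y s)"
proof -
  have "norm (x t - y t) \<le> C * (norm (x s - y s) + 0)"
  proof (rule tube_gronwall[OF _ _ order_refl s t])
    fix r assume r: "r \<in> {0..T}"
    show "((\<lambda>t. x t - y t) has_vector_derivative field \<epsilon> r (x r) - field \<epsilon> r (y r)) (at r within {0..T})"
      using x(1) y(1) r unfolding solves_on_def by (intro has_vector_derivative_diff) auto
    show "norm (field \<epsilon> r (x r) - field \<epsilon> r (y r)) \<le> 2 * L * norm (x r - y r) + 0"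
      using lip_field[OF \<epsilon> r x(2)[OF r] y(2)[OF r]] by simp
  qed
  then show ?thesis by simp
qed

lemma A_uniformly_continuous:
  assumes "\<omega> > 0"
  obtains d where "d > 0" "\<And>t x y. t \<in> {0..T} \<Longrightarrow> x \<in> cball 0 (R + 1) \<Longrightarrow> y \<in> cball 0 (R + 1) \<Longrightarrow> norm (x - y) < d
    \<Longrightarrow> norm (A (t, x) - A (t, y)) \<le> \<omega>"
proof -
  have "uniformly_continuous_on ({0..T} \<times> cball 0 (R + 1)) A"
    by (intro compact_uniformly_continuous continuous_on_subset[OF A_cont] compact_Times compact_Icc compact_cball) auto
  then obtain d where d: "d > 0" "\<And>p q. p \<in> {0..T} \<times> cball 0 (R + 1) \<Longrightarrow> q \<in> {0..T} \<times> cball 0 (R + 1) \<Longrightarrow> dist q p < d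
      \<Longrightarrow> dist (A q) (A p) < \<omega>"
    using assms unfolding uniformly_continuous_on_def by metis
  show thesis
  proof
    fix t and x y :: 'a assume "t \<in> {0..T}" "x \<in> cball 0 (R + 1)" "y \<in> cball 0 (R + 1)" "norm (x - y) < d"
    then show "norm (A (t, x) - A (t, y)) \<le> \<omega>"
      using d(2)[of "(t, y)" "(t, x)"] by (simp add: dist_Pair_Pair dist_norm)
  qed (rule d)
qed

text \<open>Mean value inequality along the segment from p to x for \<psi> minus its linear part at
  p, whose derivative is small near p.\<close>

lemma psi_remainder:
  assumes t: "t \<in> {0..T}" and x: "x \<in> cball 0 (R + 1)" and p: "p \<in> cball 0 (R + 1)" and xp: "norm (x - p) < d"
    and d: "\<And>y. y \<in> cball 0 (R + 1) \<Longrightarrow> norm (y - p) < d \<Longrightarrow> norm (A (t, y) - A (t, p)) \<le> \<omega>"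
  shows "norm (\<psi> t x - \<psi> t p - A (t, p) (x - p)) \<le> \<omega> * norm (x - p)"
proof -
  have "norm ((\<psi> t x - A (t, p) x) - (\<psi> t p - A (t, p) p)) \<le> \<omega> * norm (x - p)"
  proof (rule differentiable_bound[of "closed_segment p x" "\<lambda>y. \<psi> t y - A (t, p) y" "\<lambda>y. blinfun_apply (A (t, y) - A (t, p))"])
    fix y assume y: "y \<in> closed_segment p x"
    have "((\<lambda>y. \<psi> t y - A (t, p) y) has_derivative (\<lambda>v. A (t, y) v - A (t, p) v)) (at y)"
      by (intro has_derivative_diff A_deriv bounded_linear_imp_has_derivative blinfun.bounded_linear_right)
    moreover have "blinfun_apply (A (t, y) - A (t, p)) = (\<lambda>v. A (t, y) v - A (t, p) v)"
      by (rule ext) (rule blinfun.diff_left)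
    ultimately show "((\<lambda>y. \<psi> t y - A (t, p) y) has_derivative blinfun_apply (A (t, y) - A (t, p))) (at y within closed_segment p x)"
      by (simp only: has_derivative_at_withinI)
    have "y \<in> cball 0 (R + 1)"
      using y closed_segment_subset[OF p x convex_cball] by blast
    moreover have "norm (y - p) < d"
      using segment_bound(1)[OF y] xp by (simp add: norm_minus_commute)
    ultimately show "onorm (blinfun_apply (A (t, y) - A (t, p))) \<le> \<omega>"
      unfolding norm_blinfun.rep_eq[symmetric] by (rule d)
  qed auto
  then show ?thesis by (simp add: blinfun.diff_right algebra_simps)
qed

lemma perturbed_solution_near_Omega:
  assumes \<epsilon>: "0 \<le> \<epsilon>"
    and x: "solves_on (field \<epsilon>) x {0..T}" "\<And>t. t \<in> {0..T} \<Longrightarrow> x t \<in> cball 0 (R + 1)"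
    and s: "s \<in> {0..T}" "x s = \<Omega> s 0 \<xi>" and \<xi>: "\<xi> \<in> S" and t: "t \<in> {0..T}"
  shows "norm (x t - \<Omega> t 0 \<xi>) \<le> C * (\<epsilon> * M)"
proof -
  have "norm (x t - \<Omega> t 0 \<xi>) \<le> C * (norm (x s - \<Omega> s 0 \<xi>) + \<epsilon> * M)"
  proof (rule tube_gronwall[OF _ _ _ s(1) t])
    fix r assume r: "r \<in> {0..T}"
    show "((\<lambda>t. x t - \<Omega> t 0 \<xi>) has_vector_derivative field \<epsilon> r (x r) - \<psi> r (\<Omega> r 0 \<xi>)) (at r within {0..T})"
      using x(1) r has_vector_derivative_at_within[OF Omega_deriv]
      unfolding solves_on_def by (intro has_vector_derivative_diff) auto
    have eq: "field \<epsilon> r (x r) - \<psi> r (\<Omega> r 0 \<xi>) = \<epsilon> *\<^sub>R \<phi> r (x r) + (\<psi> r (x r) - \<psi> r (\<Omega> r 0 \<xi>))"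
      by (simp add: field_def)
    have "norm (field \<epsilon> r (x r) - \<psi> r (\<Omega> r 0 \<xi>)) \<le> \<epsilon> * norm (\<phi> r (x r)) + norm (\<psi> r (x r) - \<psi> r (\<Omega> r 0 \<xi>))"
      unfolding eq
      using norm_triangle_ineq[of "\<epsilon> *\<^sub>R \<phi> r (x r)" "\<psi> r (x r) - \<psi> r (\<Omega> r 0 \<xi>)"] \<epsilon> by simp
    also have "\<dots> \<le> \<epsilon> * M + L * norm (x r - \<Omega> r 0 \<xi>)"
      by (intro add_mono mult_left_mono phi_bound lip_psi x r Omega_in_ball \<xi> \<epsilon>)
    also have "L * norm (x r - \<Omega> r 0 \<xi>) \<le> 2 * L * norm (x r - \<Omega> r 0 \<xi>)"
      using L_ge_1 by (intro mult_right_mono) auto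
    finally show "norm (field \<epsilon> r (x r) - \<psi> r (\<Omega> r 0 \<xi>)) \<le> 2 * L * norm (x r - \<Omega> r 0 \<xi>) + \<epsilon> * M" by simp
  qed (use \<epsilon> M_ge_1 in auto)
  then show ?thesis using s(2) by simp
qed

text \<open>The error u of the first-order approximation vanishes at time s and satisfies a linear
  differential inequality. Its source is (\<epsilon> L + \<omega>) times the distance between the
  two orbits, which is itself of order \<epsilon>; so the error is o(\<epsilon>), uniformly in s,
  \<xi> and t.\<close>

lemma expansion:
  assumes e: "e > 0"
  obtains \<epsilon>1 where "\<epsilon>1 > 0" "\<And>\<epsilon> x s \<xi> t. 0 < \<epsilon> \<Longrightarrow> \<epsilon> < \<epsilon>1 \<Longrightarrow> solves_on (field \<epsilon>) x {0..T} \<Longrightarrow>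
      (\<And>t. t \<in> {0..T} \<Longrightarrow> x t \<in> cball 0 (R + 1)) \<Longrightarrow> s \<in> {0..T} \<Longrightarrow> x s = \<Omega> s 0 \<xi> \<Longrightarrow> \<xi> \<in> S \<Longrightarrow> t \<in> {0..T} \<Longrightarrow>
      norm (x t - \<Omega> t 0 \<xi> - \<epsilon> *\<^sub>R \<eta> t s \<xi>) \<le> \<epsilon> * e"
proof -
  define P where "P = C * C * M"
  have P: "P > 0" unfolding P_def using C_ge_1 M_ge_1 by simp
  \<comment> \<open>Half of the permitted error, as \<omega> P = e / 2; the other half is \<epsilon>
    L P.\<close>
  define \<omega> where "\<omega> = e / (2 * P)"
  have \<omega>: "\<omega> > 0" using e P by (simp add: \<omega>_def)
  obtain d where d: "d > 0" "\<And>t x y. t \<in> {0..T} \<Longrightarrow> x \<in> cball 0 (R + 1) \<Longrightarrow> y \<in> cball 0 (R + 1) \<Longrightarrow> norm (x - y) < d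
    \<Longrightarrow> norm (A (t, x) - A (t, y)) \<le> \<omega>"
    using A_uniformly_continuous[OF \<omega>] by blast
  have CM: "C * M > 0" using C_ge_1 M_ge_1 by simp
  \<comment> \<open>The first entry keeps the distance of the orbits, at most C \<epsilon> M, below
    d; the second gives \<epsilon> L P \<le> e / 2.\<close>
  define \<epsilon>1 where "\<epsilon>1 = min (d / (C * M)) (e / (2 * P * L))"
  show thesis
  proof
    show "\<epsilon>1 > 0" using d(1) CM e P L_ge_1 by (simp add: \<epsilon>1_def)
    fix \<epsilon> x s \<xi> t
    assume \<epsilon>: "0 < \<epsilon>" "\<epsilon> < \<epsilon>1" and x: "solves_on (field \<epsilon>) x {0..T}" "\<And>t. t \<in> {0..T} \<Longrightarrow> x t \<in> cball 0 (R + 1)"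
      and s: "s \<in> {0..T}" "x s = \<Omega> s 0 \<xi>" and \<xi>: "\<xi> \<in> S" and t: "t \<in> {0..T}"
    have "\<epsilon> < d / (C * M)" using \<epsilon>(2) by (simp add: \<epsilon>1_def)
    then have \<epsilon>d: "C * (\<epsilon> * M) < d" using CM by (simp add: pos_less_divide_eq mult_ac)
    have "\<epsilon> < e / (2 * P * L)" using \<epsilon>(2) by (simp add: \<epsilon>1_def)
    then have \<epsilon>e: "\<epsilon> * L * P \<le> e / 2" using P L_ge_1 by (simp add: pos_less_divide_eq field_simps)
    have near: "norm (x r - \<Omega> r 0 \<xi>) \<le> C * (\<epsilon> * M)" if "r \<in> {0..T}" for r
      using perturbed_solution_near_Omega[OF _ x s \<xi> that] \<epsilon>(1) by simp
    define v where "v r = x r - \<Omega> r 0 \<xi>" for r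
    define u where "u r = v r - \<epsilon> *\<^sub>R \<eta> r s \<xi>" for r
    define c where "c = (\<epsilon> * L + \<omega>) * (C * (\<epsilon> * M))"
    have "norm (u t) \<le> C * (norm (u s) + c)"
    proof (rule tube_gronwall[OF _ _ _ s(1) t])
      fix r assume r: "r \<in> {0..T}"
      let ?p = "\<Omega> r 0 \<xi>"
      let ?u' = "(field \<epsilon> r (x r) - \<psi> r ?p) - \<epsilon> *\<^sub>R (\<phi> r ?p + A (r, ?p) (\<eta> r s \<xi>))"
      have xr: "(x has_vector_derivative field \<epsilon> r (x r)) (at r within {0..T})"
        using x(1) r unfolding solves_on_def by blast
      show "(u has_vector_derivative ?u') (at r within {0..T})"
        unfolding u_def v_def
        by (intro has_vector_derivative_diff xr has_vector_derivative_at_within[OF Omega_deriv]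
            bounded_linear.has_vector_derivative[OF bounded_linear_scaleR_right
              has_vector_derivative_at_within[OF eta_deriv]])
      have p: "?p \<in> cball 0 (R + 1)" by (rule Omega_in_ball[OF \<xi> r])
      have "norm (v r) < d" using near[OF r] \<epsilon>d by (simp add: v_def)
      then have rem: "norm (\<psi> r (x r) - \<psi> r ?p - A (r, ?p) (v r)) \<le> \<omega> * norm (v r)"
        unfolding v_def by (intro psi_remainder[OF r x(2)[OF r] p] d(2) r p) auto
      have "?u' = \<epsilon> *\<^sub>R (\<phi> r (x r) - \<phi> r ?p) + ((\<psi> r (x r) - \<psi> r ?p - A (r, ?p) (v r)) + A (r, ?p) (u r))"
        by (simp add: field_def u_def blinfun.diff_right blinfun.scaleR_right algebra_simps)
      then have "norm ?u' \<le> norm (\<epsilon> *\<^sub>R (\<phi> r (x r) - \<phi> r ?p)) +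
          (norm (\<psi> r (x r) - \<psi> r ?p - A (r, ?p) (v r)) + norm (A (r, ?p) (u r)))"
        by (simp only:) (intro norm_triangle_le add_left_mono norm_triangle_ineq)
      also have "norm (\<epsilon> *\<^sub>R (\<phi> r (x r) - \<phi> r ?p)) \<le> \<epsilon> * (L * norm (v r))"
        using lip_phi[OF r x(2)[OF r] p] \<epsilon>(1) by (simp add: v_def)
      also have "norm (A (r, ?p) (u r)) \<le> L * norm (u r)"
        using norm_blinfun[of "A (r, ?p)" "u r"] A_bound[OF r p] mult_right_mono[of "norm (A (r, ?p))" L "norm (u r)"]
        by simp
      also have "L * norm (u r) \<le> 2 * L * norm (u r)"
        using L_ge_1 by (intro mult_right_mono) auto
      also note rem
      also have "\<epsilon> * (L * norm (v r)) + (\<omega> * norm (v r) + 2 * L * norm (u r)) = 2 * L * norm (u r) + (\<epsilon> * L + \<omega>) * norm (v r)"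
        by (simp add: algebra_simps)
      also have "(\<epsilon> * L + \<omega>) * norm (v r) \<le> c"
        unfolding c_def using near[OF r] \<epsilon>(1) \<omega> L_ge_1 by (intro mult_left_mono) (auto simp: v_def)
      finally show "norm ?u' \<le> 2 * L * norm (u r) + c" by simp
    qed (use \<epsilon>(1) \<omega> L_ge_1 C_ge_1 M_ge_1 in \<open>auto simp: c_def\<close>)
    also have "u s = 0" by (simp add: u_def v_def s(2))
    also have "C * (norm (0::'a) + c) = \<epsilon> * (\<epsilon> * L * P + \<omega> * P)"
      by (simp add: c_def P_def algebra_simps)
    also have "\<dots> \<le> \<epsilon> * e"
      using \<epsilon>e \<epsilon>(1) P by (intro mult_left_mono) (auto simp: \<omega>_def)
    finally show "norm (x t - \<Omega> t 0 \<xi> - \<epsilon> *\<^sub>R \<eta> t s \<xi>) \<le> \<epsilon> * e"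
      by (simp add: u_def v_def)
  qed
qed

section \<open>Dependence of \<eta> on the starting time and the starting point\<close>

lemma eta_bound:
  assumes \<xi>: "\<xi> \<in> S" and s: "s \<in> {0..T}" and t: "t \<in> {0..T}"
  shows "norm (\<eta> t s \<xi>) \<le> C * M"
proof -
  have "norm (\<eta> t s \<xi>) \<le> C * (norm (\<eta> s s \<xi>) + M)"
  proof (rule tube_gronwall[OF has_vector_derivative_at_within[OF eta_deriv] _ _ s t])
    fix r assume r: "r \<in> {0..T}"
    let ?p = "\<Omega> r 0 \<xi>"
    have "norm (\<phi> r ?p + A (r, ?p) (\<eta> r s \<xi>)) \<le> norm (\<phi> r ?p) + norm (A (r, ?p)) * norm (\<eta> r s \<xi>)"
      using norm_triangle_ineq[of "\<phi> r ?p" "A (r, ?p) (\<eta> r s \<xi>)"] norm_blinfun[of "A (r, ?p)" "\<eta> r s \<xi>"] by linarith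
    also have "\<dots> \<le> M + (2 * L) * norm (\<eta> r s \<xi>)"
      using phi_bound[OF r Omega_in_ball[OF \<xi> r]] A_bound[OF r Omega_in_ball[OF \<xi> r]] L_ge_1
      by (intro add_mono mult_right_mono) auto
    finally show "norm (\<phi> r ?p + A (r, ?p) (\<eta> r s \<xi>)) \<le> 2 * L * norm (\<eta> r s \<xi>) + M" by simp
  qed (use M_ge_1 in auto)
  then show ?thesis by simp
qed

text \<open>Two linear equations along neighbouring orbits are compared from time s on. There the
  first solution is 0 and the second is \<open>\<eta> s s' \<xi>'\<close>; the remaining terms
  measure how far the coefficients differ.\<close>

lemma eta_difference:
  assumes \<omega>: "\<omega> > 0" and \<xi>: "\<xi> \<in> S" "\<xi>' \<in> S" and s: "s \<in> {0..T}" "s' \<in> {0..T}" and t: "t \<in> {0..T}"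
    and d: "\<And>t x y. t \<in> {0..T} \<Longrightarrow> x \<in> cball 0 (R + 1) \<Longrightarrow> y \<in> cball 0 (R + 1) \<Longrightarrow> norm (x - y) < d
    \<Longrightarrow> norm (A (t, x) - A (t, y)) \<le> \<omega>" and near: "C * norm (\<xi> - \<xi>') < d"
  shows "norm (\<eta> t s \<xi> - \<eta> t s' \<xi>') \<le> C * (norm (\<eta> s s' \<xi>') + (L * (C * norm (\<xi> - \<xi>')) + \<omega> * (C * M)))"
proof -
  let ?c = "L * (C * norm (\<xi> - \<xi>')) + \<omega> * (C * M)"
  have field0: "field 0 = \<psi>" by (simp add: fun_eq_iff field_def)
  have Om: "norm (\<Omega> r 0 \<xi> - \<Omega> r 0 \<xi>') \<le> C * norm (\<xi> - \<xi>')" if "r \<in> {0..T}" for r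
  proof -
    have "norm (\<Omega> r 0 \<xi> - \<Omega> r 0 \<xi>') \<le> C * norm (\<Omega> 0 0 \<xi> - \<Omega> 0 0 \<xi>')"
    proof (rule perturbed_solution_lipschitz[of 0])
      show "solves_on (field 0) (\<lambda>t. \<Omega> t 0 \<xi>) {0..T}" "solves_on (field 0) (\<lambda>t. \<Omega> t 0 \<xi>') {0..T}"
        unfolding field0 by (rule Omega_solves)+
      show "\<Omega> t 0 \<xi> \<in> cball 0 (R + 1)" "\<Omega> t 0 \<xi>' \<in> cball 0 (R + 1)" if "t \<in> {0..T}" for t
        by (rule Omega_in_ball[OF \<xi>(1) that] Omega_in_ball[OF \<xi>(2) that])+
    qed (use that T_pos in auto)
    then show ?thesis by simp
  qed
  have "norm (\<eta> t s \<xi> - \<eta> t s' \<xi>') \<le> C * (norm (\<eta> s s \<xi> - \<eta> s s' \<xi>') + ?c)"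
  proof (rule tube_gronwall[OF has_vector_derivative_diff[OF has_vector_derivative_at_within[OF eta_deriv]
          has_vector_derivative_at_within[OF eta_deriv]] _ _ s(1) t])
    fix r assume r: "r \<in> {0..T}"
    let ?p = "\<Omega> r 0 \<xi>" and ?p' = "\<Omega> r 0 \<xi>'" and ?v = "\<eta> r s \<xi>" and ?v' = "\<eta> r s' \<xi>'"
    have p: "?p \<in> cball 0 (R + 1)" "?p' \<in> cball 0 (R + 1)" using Omega_in_ball \<xi> r by blast+
    have "\<phi> r ?p + A (r, ?p) ?v - (\<phi> r ?p' + A (r, ?p') ?v') = A (r, ?p) (?v - ?v') + ((\<phi> r ?p - \<phi> r ?p') + (A (r, ?p) - A (r, ?p')) ?v')"
      by (simp add: blinfun.bilinear_simps)
    then have "norm (\<phi> r ?p + A (r, ?p) ?v - (\<phi> r ?p' + A (r, ?p') ?v')) \<le>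
        norm (A (r, ?p) (?v - ?v')) + (norm (\<phi> r ?p - \<phi> r ?p') + norm ((A (r, ?p) - A (r, ?p')) ?v'))"
      by (simp only:) (intro norm_triangle_le add_left_mono norm_triangle_ineq)
    also have "norm (A (r, ?p) (?v - ?v')) \<le> 2 * L * norm (?v - ?v')"
    proof -
      have "norm (A (r, ?p) (?v - ?v')) \<le> norm (A (r, ?p)) * norm (?v - ?v')" by (rule norm_blinfun)
      also have "\<dots> \<le> 2 * L * norm (?v - ?v')"
        using A_bound[OF r p(1)] L_ge_1 by (intro mult_right_mono) auto
      finally show ?thesis .
    qed
    also have "norm (\<phi> r ?p - \<phi> r ?p') \<le> L * (C * norm (\<xi> - \<xi>'))"
      using lip_phi[OF r p] mult_left_mono[OF Om[OF r], of L] L_ge_1 by linarith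
    also have "norm ((A (r, ?p) - A (r, ?p')) ?v') \<le> \<omega> * (C * M)"
    proof -
      have "norm ((A (r, ?p) - A (r, ?p')) ?v') \<le> norm (A (r, ?p) - A (r, ?p')) * norm ?v'" by (rule norm_blinfun)
      also have "\<dots> \<le> \<omega> * (C * M)"
        using Om[OF r] near \<omega> by (intro mult_mono d r p eta_bound \<xi> s) auto
      finally show ?thesis .
    qed
    finally show "norm (\<phi> r ?p + A (r, ?p) ?v - (\<phi> r ?p' + A (r, ?p') ?v')) \<le> 2 * L * norm (?v - ?v') + ?c" by simp
  qed (use \<omega> L_ge_1 C_ge_1 M_ge_1 in auto)
  then show ?thesis by simp
qed

text \<open>Needed for compactness in s and \<xi> together, and for the continuity of the field
  whose degree is taken.\<close>

lemma continuous_on_eta: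
  assumes t: "t \<in> {0..T}"
  shows "continuous_on ({0..T} \<times> S) (\<lambda>p. \<eta> t (fst p) (snd p))"
  unfolding continuous_on_iff
proof (intro ballI allI impI)
  fix p' and e :: real assume p': "p' \<in> {0..T} \<times> S" and e: "e > 0"
  obtain s' \<xi>' where p'_eq: "p' = (s', \<xi>')" by (cases p')
  then have s': "s' \<in> {0..T}" and \<xi>': "\<xi>' \<in> S" using p' by auto
  define \<omega> where "\<omega> = e / (4 * (C * (C * M)))"
  have CM: "C * (C * M) > 0" "L * C > 0" "C > 0" using C_ge_1 M_ge_1 L_ge_1 by simp_all
  have \<omega>: "\<omega> > 0" using e CM by (simp add: \<omega>_def)
  obtain d where d: "d > 0" "\<And>t x y. t \<in> {0..T} \<Longrightarrow> x \<in> cball 0 (R + 1) \<Longrightarrow> y \<in> cball 0 (R + 1) \<Longrightarrow> norm (x - y) < d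
    \<Longrightarrow> norm (A (t, x) - A (t, y)) \<le> \<omega>"
    using A_uniformly_continuous[OF \<omega>] by blast
  have "continuous (at s') (\<lambda>s. \<eta> s s' \<xi>')" by (rule has_vector_derivative_continuous[OF eta_deriv])
  moreover have "e / (4 * C) > 0" using e CM by simp
  ultimately obtain d1 where d1: "d1 > 0" "\<And>s. dist s s' < d1 \<Longrightarrow> norm (\<eta> s s' \<xi>') < e / (4 * C)"
    unfolding continuous_at_eps_delta by (auto simp: dist_norm)
  \<comment> \<open>The entries bound the initial discrepancy, the variation of A, and the variation
    of \<phi>. With the choice of \<omega>, each of the three terms is at most e / 4 after
    multiplication by C.\<close>
  define \<delta> where "\<delta> = min d1 (min (d / C) (e / (4 * (C * (L * C)))))"
  show "\<exists>\<delta>>0. \<forall>p\<in>{0..T} \<times> S. dist p p' < \<delta> \<longrightarrow> dist (\<eta> t (fst p) (snd p)) (\<eta> t (fst p') (snd p')) < e"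
  proof (intro exI conjI ballI impI)
    show "\<delta> > 0" using d1(1) d(1) e CM by (simp add: \<delta>_def)
    fix p assume p: "p \<in> {0..T} \<times> S" "dist p p' < \<delta>"
    obtain s \<xi> where p_eq: "p = (s, \<xi>)" by (cases p)
    then have s: "s \<in> {0..T}" and \<xi>: "\<xi> \<in> S" using p by auto
    have dist: "dist s s' < \<delta>" "norm (\<xi> - \<xi>') < \<delta>"
      using p(2) dist_fst_le[of p p'] dist_snd_le[of p p'] by (auto simp: p_eq p'_eq dist_norm)
    have near: "C * norm (\<xi> - \<xi>') < d"
      using dist(2) CM(3) by (simp add: \<delta>_def pos_less_divide_eq mult.commute)
    have 1: "norm (\<eta> s s' \<xi>') < e / (4 * C)" using dist(1) by (intro d1(2)) (simp add: \<delta>_def)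
    have "norm (\<xi> - \<xi>') < e / (4 * (C * (L * C)))" using dist(2) by (simp add: \<delta>_def)
    moreover have "4 * (C * (L * C)) > 0" using CM by simp
    ultimately have "norm (\<xi> - \<xi>') * (4 * (C * (L * C))) < e" by (simp only: pos_less_divide_eq)
    then have 2: "C * (L * (C * norm (\<xi> - \<xi>'))) < e / 4" by (simp add: mult_ac)
    have 3: "C * (\<omega> * (C * M)) = e / 4" using C_ge_1 M_ge_1 by (simp add: \<omega>_def)
    have 4: "C * norm (\<eta> s s' \<xi>') < e / 4" using 1 CM(3) by (simp add: field_simps)
    have "norm (\<eta> t s \<xi> - \<eta> t s' \<xi>') \<le> C * (norm (\<eta> s s' \<xi>') + (L * (C * norm (\<xi> - \<xi>')) + \<omega> * (C * M)))"
      by (rule eta_difference[OF \<omega> \<xi> \<xi>' s s' t d(2) near])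
    also have "\<dots> = C * norm (\<eta> s s' \<xi>') + (C * (L * (C * norm (\<xi> - \<xi>'))) + C * (\<omega> * (C * M)))"
      by (simp only: distrib_left)
    also have "\<dots> < e" using 2 3 4 e by linarith
    finally show "dist (\<eta> t (fst p) (snd p)) (\<eta> t (fst p') (snd p')) < e"
      by (simp add: p_eq p'_eq dist_norm)
  qed
qed

end

section \<open>Uniform constants and existence of the periodic solution\<close>

lemma compact_continuous_norm_bound:
  fixes f :: "'a::topological_space \<Rightarrow> 'b::real_normed_vector"
  assumes "compact K" "continuous_on K f"
  obtains B where "\<And>x. x \<in> K \<Longrightarrow> norm (f x) \<le> B"
  using compact_imp_bounded[OF compact_continuous_image[OF assms(2,1)]] unfolding bounded_iff by auto

theorem theorem1:
  fixes \<phi> \<psi> :: "real \<Rightarrow> real^'k \<Rightarrow> real^'k"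
    and T :: real and U :: "(real^'k) set"
    and \<Omega> :: "real \<Rightarrow> real \<Rightarrow> real^'k \<Rightarrow> real^'k"
    and \<eta> :: "real \<Rightarrow> real \<Rightarrow> real^'k \<Rightarrow> real^'k"
  assumes T_pos: "T > 0"
    and phi_C1: "C1_map (\<lambda>z. \<phi> (fst z) (snd z))"
    and psi_C1: "C1_map (\<lambda>z. \<psi> (fst z) (snd z))"
    and phi_per: "\<forall>t x. \<phi> (t + T) x = \<phi> t x"
    and psi_per: "\<forall>t x. \<psi> (t + T) x = \<psi> t x"
    and Omega_flow: "\<forall>t0 \<xi>. \<Omega> t0 t0 \<xi> = \<xi> \<and>
        (\<forall>t. ((\<lambda>t. \<Omega> t t0 \<xi>) has_vector_derivative \<psi> t (\<Omega> t t0 \<xi>)) (at t))"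
    and eta_sol: "\<forall>s \<xi>. \<eta> s s \<xi> = 0 \<and>
        (\<forall>t. ((\<lambda>t. \<eta> t s \<xi>) has_vector_derivative
               (\<phi> t (\<Omega> t 0 \<xi>) + frechet_derivative (\<psi> t) (at (\<Omega> t 0 \<xi>)) (\<eta> t s \<xi>))) (at t))"
    and U_open: "open U" and U_bdd: "bounded U"
    and A0: "\<forall>\<xi>\<in>frontier U. \<Omega> T 0 \<xi> = \<xi>"
    and A1: "\<forall>s\<in>{0..T}. \<forall>\<xi>\<in>frontier U. \<eta> T s \<xi> - \<eta> 0 s \<xi> \<noteq> 0"
    and A2: "brouwer_degree (\<lambda>\<xi>. \<eta> T 0 \<xi>) U \<noteq> 0"
  shows "\<exists>\<epsilon>0>0. \<forall>\<epsilon>. 0 < \<epsilon> \<and> \<epsilon> < \<epsilon>0 \<longrightarrow>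
     (\<exists>x :: real \<Rightarrow> real^'k.
        (\<forall>t. (x has_vector_derivative (\<epsilon> *\<^sub>R \<phi> t (x t) + \<psi> t (x t))) (at t))
      \<and> (\<forall>t. x (t + T) = x t)
      \<and> (\<forall>t\<in>{0..T}. \<Omega> 0 t (x t) \<in> U))"
proof -
  interpret perturbed_flow \<phi> \<psi> T \<Omega>
    by unfold_locales (use T_pos phi_C1 psi_C1 Omega_flow in auto)
  obtain A where A: "continuous_on UNIV A" "\<And>t x. (\<psi> t has_derivative blinfun_apply (A (t, x))) (at x)"
    using C1_map_partial_derivative[OF psi_C1] by blast
  have A_eq: "frechet_derivative (\<psi> t) (at x) = blinfun_apply (A (t, x))" for t x
    using frechet_derivative_at[OF A(2)] by simp
  have compU: "compact (closure U)" using U_bdd by simp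
  have frU: "frontier U \<subseteq> closure U" by (simp add: frontier_def)
  have "compact ({0..T} \<times> closure U)" by (intro compact_Times compact_Icc compU)
  moreover have "continuous_on ({0..T} \<times> closure U) (\<lambda>p. \<Omega> (fst p) 0 (snd p))"
    by (rule continuous_on_subset[OF continuous_on_Omega_pair]) auto
  ultimately obtain R where R: "\<And>p. p \<in> {0..T} \<times> closure U \<Longrightarrow> norm (\<Omega> (fst p) 0 (snd p)) \<le> R"
    by (rule compact_continuous_norm_bound) (rule that)
  let ?B = "{0..T} \<times> cball 0 (R + 1) :: (real \<times> (real^'k)) set"
  have compB: "compact ?B" by (intro compact_Times compact_Icc compact_cball)
  obtain L1 where L1: "\<And>t x y. t \<in> {0..T} \<Longrightarrow> x \<in> cball 0 (R + 1) \<Longrightarrow> y \<in> cball 0 (R + 1)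
      \<Longrightarrow> norm (\<phi> t x - \<phi> t y) \<le> L1 * norm (x - y)"
    by (rule C1_map_lipschitz_snd[OF phi_C1, of T "R + 1"]) (rule that)
  obtain L2 where L2: "\<And>t x y. t \<in> {0..T} \<Longrightarrow> x \<in> cball 0 (R + 1) \<Longrightarrow> y \<in> cball 0 (R + 1)
      \<Longrightarrow> norm (\<psi> t x - \<psi> t y) \<le> L2 * norm (x - y)"
    by (rule C1_map_lipschitz_snd[OF psi_C1, of T "R + 1"]) (rule that)
  obtain L3 where L3: "\<And>p. p \<in> ?B \<Longrightarrow> norm (A p) \<le> L3"
    by (rule compact_continuous_norm_bound[OF compB continuous_on_subset[OF A(1) subset_UNIV]]) (rule that)
  obtain M1 where M1: "\<And>p. p \<in> ?B \<Longrightarrow> norm (\<phi> (fst p) (snd p)) \<le> M1"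
    by (rule compact_continuous_norm_bound[OF compB C1_map_continuous[OF phi_C1]]) (rule that)
  define L where "L = max 1 (max L1 (max L2 L3))"
  define M where "M = max 1 M1"
  interpret perturbed_tube \<phi> \<psi> T \<Omega> \<eta> A "closure U" R L M
  proof
    fix t s :: real and \<xi> x y :: "real^'k"
    show "continuous_on UNIV A" "(\<psi> t has_derivative blinfun_apply (A (t, x))) (at x)" by (rule A)+
    show "\<eta> s s \<xi> = 0" using eta_sol by blast
    show "((\<lambda>t. \<eta> t s \<xi>) has_vector_derivative
          \<phi> t (\<Omega> t 0 \<xi>) + blinfun_apply (A (t, \<Omega> t 0 \<xi>)) (\<eta> t s \<xi>)) (at t)"
      using eta_sol unfolding A_eq by blast
    show "L \<ge> 1" "M \<ge> 1" by (simp_all add: L_def M_def)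
    assume t: "t \<in> {0..T}"
    show "norm (\<Omega> t 0 \<xi>) \<le> R" if "\<xi> \<in> closure U"
      using R[of "(t, \<xi>)"] t that by simp
    assume x: "x \<in> cball 0 (R + 1)"
    show "norm (A (t, x)) \<le> L"
      using L3[of "(t, x)"] t x by (simp add: L_def)
    show "norm (\<phi> t x) \<le> M"
      using M1[of "(t, x)"] t x by (simp add: M_def)
    assume y: "y \<in> cball 0 (R + 1)"
    have "L1 * norm (x - y) \<le> L * norm (x - y)" "L2 * norm (x - y) \<le> L * norm (x - y)"
      by (intro mult_right_mono; simp add: L_def)+
    then show "norm (\<phi> t x - \<phi> t y) \<le> L * norm (x - y)" "norm (\<psi> t x - \<psi> t y) \<le> L * norm (x - y)"
      using L1[OF t x y] L2[OF t x y] by linarith+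
  qed
  have T: "0 \<in> {0..T}" "T \<in> {0..T}" using T_pos by auto
  let ?D = "\<lambda>p. \<eta> T (fst p) (snd p) - \<eta> 0 (fst p) (snd p)"
  have sub: "{0..T} \<times> frontier U \<subseteq> {0..T} \<times> closure U" using frU by blast
  have "compact ({0..T} \<times> frontier U)"
    using U_bdd by (intro compact_Times compact_Icc compact_frontier_bounded)
  moreover have "continuous_on ({0..T} \<times> frontier U) (\<lambda>p. norm (?D p))"
    by (intro continuous_intros continuous_on_subset[OF continuous_on_eta[OF T(1)] sub]
        continuous_on_subset[OF continuous_on_eta[OF T(2)] sub])
  \<comment> \<open>By compactness (A1) holds with a margin m for all s and all frontier points at
    once.\<close>
  ultimately obtain m where m: "m > 0" "\<And>p. p \<in> {0..T} \<times> frontier U \<Longrightarrow> m \<le> norm (?D p)"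
    by (rule compact_positive_lower_bound) (use A1 in auto)
  \<comment> \<open>With error m / 4, two expansions together cost m / 2 < m, and a single one
    leaves at least 3 m / 4 of the field.\<close>
  obtain \<epsilon>1 where \<epsilon>1: "\<epsilon>1 > 0" "\<And>\<epsilon> x s \<xi> t. 0 < \<epsilon> \<Longrightarrow> \<epsilon> < \<epsilon>1 \<Longrightarrow> solves_on (field \<epsilon>) x {0..T} \<Longrightarrow>
      (\<And>t. t \<in> {0..T} \<Longrightarrow> x t \<in> cball 0 (R + 1)) \<Longrightarrow> s \<in> {0..T} \<Longrightarrow> x s = \<Omega> s 0 \<xi> \<Longrightarrow> \<xi> \<in> closure U \<Longrightarrow> t \<in> {0..T} \<Longrightarrow>
      norm (x t - \<Omega> t 0 \<xi> - \<epsilon> *\<^sub>R \<eta> t s \<xi>) \<le> \<epsilon> * (m / 4)"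
    using expansion[of "m / 4"] m(1) by (metis divide_pos_pos zero_less_numeral)
  \<comment> \<open>The bound 1 serves the Lipschitz constant 2 L, \<epsilon>1 the expansion, and 1
    / (C M) the existence of solutions inside the ball.\<close>
  define \<epsilon>0 where "\<epsilon>0 = min (min 1 \<epsilon>1) (1 / (C * M))"
  have CM: "C * M > 0" using C_ge_1 M_ge_1 by simp
  have main: "\<exists>x. (\<forall>t. (x has_vector_derivative (\<epsilon> *\<^sub>R \<phi> t (x t) + \<psi> t (x t))) (at t))
      \<and> (\<forall>t. x (t + T) = x t) \<and> (\<forall>t\<in>{0..T}. \<Omega> 0 t (x t) \<in> U)" if \<epsilon>: "0 < \<epsilon>" "\<epsilon> < \<epsilon>0" for \<epsilon>
  proof -
    have "\<epsilon> < 1 / (C * M)" using \<epsilon>(2) by (simp add: \<epsilon>0_def)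
    then have \<epsilon>': "0 \<le> \<epsilon>" "\<epsilon> \<le> 1" "\<epsilon> < \<epsilon>1" "C * (\<epsilon> * M) \<le> 1"
      using \<epsilon> CM by (auto simp: \<epsilon>0_def pos_less_divide_eq mult_ac)
    have "\<exists>x. x 0 = \<xi> \<and> solves_on (field \<epsilon>) x {0..T} \<and> (\<forall>t\<in>{0..T}. x t \<in> cball 0 (R + 1))" if \<xi>: "\<xi> \<in> closure U" for \<xi>
      using perturbed_solution[OF \<epsilon>'(1,2,4) \<xi>] by metis
    \<comment> \<open>The solutions are chosen independently for each \<xi>; the Lipschitz estimate
      makes their values at T continuous in \<xi>.\<close>
    then obtain X where X: "\<And>\<xi>. \<xi> \<in> closure U \<Longrightarrow> X \<xi> 0 = \<xi>" "\<And>\<xi>. \<xi> \<in> closure U \<Longrightarrow> solves_on (field \<epsilon>) (X \<xi>) {0..T}"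
      "\<And>\<xi> t. \<xi> \<in> closure U \<Longrightarrow> t \<in> {0..T} \<Longrightarrow> X \<xi> t \<in> cball 0 (R + 1)"
      by metis
    define G where "G \<xi> = (1 / \<epsilon>) *\<^sub>R (X \<xi> T - \<xi>)" for \<xi>
    have "C-lipschitz_on (closure U) (\<lambda>\<xi>. X \<xi> T)"
    proof (rule lipschitz_onI)
      fix \<xi> \<xi>' assume \<xi>: "\<xi> \<in> closure U" "\<xi>' \<in> closure U"
      show "dist (X \<xi> T) (X \<xi>' T) \<le> C * dist \<xi> \<xi>'"
        using perturbed_solution_lipschitz[OF \<epsilon>'(1,2) X(2)[OF \<xi>(1)] X(3)[OF \<xi>(1)] X(2)[OF \<xi>(2)] X(3)[OF \<xi>(2)] T]
        by (simp add: dist_norm X(1) \<xi>)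
    qed (use C_ge_1 in simp)
    then have "continuous_on (closure U) (\<lambda>\<xi>. X \<xi> T)" by (rule lipschitz_on_continuous_on)
    then have contG: "continuous_on (closure U) G" unfolding G_def by (intro continuous_intros)
    have contF: "continuous_on (closure U) (\<lambda>\<xi>. \<eta> T 0 \<xi>)"
    proof -
      have 1: "continuous_on (closure U) (\<lambda>\<xi>. (0::real, \<xi>))" by (intro continuous_intros)
      have 2: "(\<lambda>\<xi>. (0::real, \<xi>)) ` closure U \<subseteq> {0..T} \<times> closure U" using T(1) by auto
      show ?thesis using continuous_on_compose2[OF continuous_on_eta[OF T(2)] 1 2] by simp
    qed
    \<comment> \<open>On the frontier (A0) reduces the expansion at T to norm (G \<xi> - \<eta> T 0
      \<xi>) \<le> m / 4, while \<eta> 0 0 \<xi> = 0 gives norm (\<eta> T 0 \<xi>) \<ge> m; hence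
      norm (G \<xi>) \<ge> 3 m / 4.\<close>
    have close: "norm (\<eta> T 0 \<xi> - G \<xi>) < norm (G \<xi>)" if fr: "\<xi> \<in> frontier U" for \<xi>
    proof -
      have \<xi>: "\<xi> \<in> closure U" using fr frU by blast
      have "norm (X \<xi> T - \<Omega> T 0 \<xi> - \<epsilon> *\<^sub>R \<eta> T 0 \<xi>) \<le> \<epsilon> * (m / 4)"
        by (rule \<epsilon>1(2)[OF \<epsilon>(1) \<epsilon>'(3) X(2)[OF \<xi>] X(3)[OF \<xi>] T(1) _ \<xi> T(2)]) (simp_all add: X(1) \<xi>)
      also have "X \<xi> T - \<Omega> T 0 \<xi> - \<epsilon> *\<^sub>R \<eta> T 0 \<xi> = \<epsilon> *\<^sub>R (G \<xi> - \<eta> T 0 \<xi>)"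
        using A0 fr \<epsilon>(1) by (simp add: G_def scaleR_diff_right)
      finally have "norm (G \<xi> - \<eta> T 0 \<xi>) \<le> m / 4" using \<epsilon>(1) by simp
      moreover have "m \<le> norm (\<eta> T 0 \<xi>)" using m(2)[of "(0, \<xi>)"] T(1) fr by simp
      moreover have "norm (\<eta> T 0 \<xi>) \<le> norm (G \<xi>) + norm (G \<xi> - \<eta> T 0 \<xi>)"
        using norm_triangle_ineq4[of "G \<xi>" "G \<xi> - \<eta> T 0 \<xi>"] by simp
      ultimately show ?thesis using m(1) norm_minus_commute[of "G \<xi>" "\<eta> T 0 \<xi>"] by linarith
    qed
    \<comment> \<open>The degree criterion locates the zero in the closure; that it is not on the
      frontier follows from the case s = 0 of \<open>not_frontier\<close>.\<close>
    have "\<exists>\<xi>\<in>closure U. G \<xi> = 0"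
    proof (rule ccontr)
      assume "\<not> ?thesis"
      then have "brouwer_degree (\<lambda>\<xi>. \<eta> T 0 \<xi>) U = 0"
        by (intro brouwer_degree_eq_0[OF U_open U_bdd contF contG]) (use close in auto)
      then show False using A2 by simp
    qed
    then obtain \<xi>0 where \<xi>0: "\<xi>0 \<in> closure U" "G \<xi>0 = 0" by blast
    define x where "x = X \<xi>0"
    have x: "x 0 = \<xi>0" "solves_on (field \<epsilon>) x {0..T}" "\<And>t. t \<in> {0..T} \<Longrightarrow> x t \<in> cball 0 (R + 1)"
      unfolding x_def using X \<xi>0(1) by blast+
    have xT: "x T = x 0" using \<xi>0(2) \<epsilon>(1) x(1) by (simp add: G_def x_def)
    have not_frontier: "\<Omega> 0 s (x s) \<notin> frontier U" if s: "s \<in> {0..T}" for s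
    proof
      assume fr: "\<Omega> 0 s (x s) \<in> frontier U"
      let ?\<xi> = "\<Omega> 0 s (x s)"
      have \<xi>: "?\<xi> \<in> closure U" using fr frU by blast
      \<comment> \<open>The pulled-back point is the initial value of the unperturbed orbit that
        meets x at time s, so the expansion can be started there.\<close>
      have xs: "x s = \<Omega> s 0 ?\<xi>" using Omega_cocycle[OF T(1) s s, of "x s"] by simp
      have near: "norm (x t - \<Omega> t 0 ?\<xi> - \<epsilon> *\<^sub>R \<eta> t s ?\<xi>) \<le> \<epsilon> * (m / 4)" if "t \<in> {0..T}" for t
        by (rule \<epsilon>1(2)[OF \<epsilon>(1) \<epsilon>'(3) x(2,3) s xs \<xi> that])
      have per: "\<Omega> T 0 ?\<xi> = \<Omega> 0 0 ?\<xi>" using A0 fr by simp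
      \<comment> \<open>The zeroth-order terms cancel, since x is periodic and so is the unperturbed
        orbit by (A0).\<close>
      have "\<epsilon> *\<^sub>R (\<eta> T s ?\<xi> - \<eta> 0 s ?\<xi>) =
          (x 0 - \<Omega> 0 0 ?\<xi> - \<epsilon> *\<^sub>R \<eta> 0 s ?\<xi>) - (x T - \<Omega> T 0 ?\<xi> - \<epsilon> *\<^sub>R \<eta> T s ?\<xi>)"
        unfolding per xT by (simp add: algebra_simps)
      then have "norm (\<epsilon> *\<^sub>R (\<eta> T s ?\<xi> - \<eta> 0 s ?\<xi>)) \<le>
          norm (x 0 - \<Omega> 0 0 ?\<xi> - \<epsilon> *\<^sub>R \<eta> 0 s ?\<xi>) + norm (x T - \<Omega> T 0 ?\<xi> - \<epsilon> *\<^sub>R \<eta> T s ?\<xi>)"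
        by (metis norm_triangle_ineq4)
      also have "\<dots> \<le> \<epsilon> * (m / 4) + \<epsilon> * (m / 4)" by (intro add_mono near T)
      finally have "\<epsilon> * norm (\<eta> T s ?\<xi> - \<eta> 0 s ?\<xi>) \<le> \<epsilon> * (m / 2)" using \<epsilon>(1) by simp
      then have "norm (\<eta> T s ?\<xi> - \<eta> 0 s ?\<xi>) \<le> m / 2" using \<epsilon>(1) by simp
      moreover have "m \<le> norm (\<eta> T s ?\<xi> - \<eta> 0 s ?\<xi>)" using m(2)[of "(s, ?\<xi>)"] s fr by simp
      ultimately show False using m(1) by linarith
    qed
    have "continuous_on {0..T} x"
      using x(2) has_vector_derivative_continuous unfolding solves_on_def continuous_on_eq_continuous_within by blast
    \<comment> \<open>A connected set that meets U and misses its frontier lies in U.\<close>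
    then have "connected ((\<lambda>t. \<Omega> 0 t (x t)) ` {0..T})"
      by (intro connected_continuous_image continuous_on_pullback connected_Icc)
    moreover have "\<Omega> 0 0 (x 0) \<in> U"
    proof -
      have "x 0 \<in> closure U - frontier U" using not_frontier[OF T(1)] x(1) \<xi>0(1) by simp
      then show ?thesis using interior_subset[of U] by (auto simp: frontier_def)
    qed
    ultimately have in_U: "(\<lambda>t. \<Omega> 0 t (x t)) ` {0..T} \<subseteq> U"
      using connected_Int_frontier[of "(\<lambda>t. \<Omega> 0 t (x t)) ` {0..T}" U] not_frontier T(1) by blast
    \<comment> \<open>So far x is a solution on [0,T] only; equality of its end values permits the
      periodic continuation to all times.\<close>
    obtain Y where Y: "\<And>t. (Y has_vector_derivative field \<epsilon> t (Y t)) (at t)" "\<And>t. Y (t + T) = Y t"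
        "\<And>t. t \<in> {0..T} \<Longrightarrow> Y t = x t"
      by (rule periodic_continuation[OF T_pos _ x(2) xT]) (auto simp: field_def phi_per psi_per)
    show ?thesis
      using Y in_U unfolding field_def by (intro exI[of _ Y]) auto
  qed
  show ?thesis
    using main \<epsilon>1(1) CM by (intro exI[of _ \<epsilon>0]) (simp add: \<epsilon>0_def)
qed

end
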